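(* Let $m$ be a positive integer and let $a$ be an integer with $\gcd(a,m)=1$. Let $X,Y$ be integers with $1\le X<m$ and $1\le Y<m$, and let $U,V\ge 0$ be arbitrary integers. Put $\mathcal{X}=\{U+1,\ldots,U+X\}$ and $\mathcal{Y}=\{V+1,\ldots,V+Y\}$. Then $$ \#\{(x,y)\ :\ x\in\mathcal{X},\ y\in\mathcal{Y},\ xy\equiv a \pmod m\}=\frac{\varphi(m)}{m^2}XY+O\left(m^{1/2+o(1)}\right). $$
   Context: Here $\varphi$ is the Euler function. The error term is to be understood as follows: for every $\varepsilon>0$ there is a constant $C(\varepsilon)>0$, depending only on $\varepsilon$, such that the difference between the left-hand side and $\frac{\varphi(m)}{m^2}XY$ is at most $C(\varepsilon)m^{1/2+\varepsilon}$ in absolute value, for all admissible $m,a,X,Y,U,V$. *)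

theory Defs
  imports Complex_Main "HOL-Number_Theory.Number_Theory"
begin

end

theory Submission
  imports
    Defs
    "Berlekamp_Zassenhaus.Distinct_Degree_Factorization"
    "HOL-Algebra.Algebraic_Closure_Type"
    "HOL-Real_Asymp.Real_Asymp"
begin

text \<open>
  Write \<open>e(t) = exp (2 \<pi> i t)\<close> and let \<open>H\<close> be the set of pairs of residues with
  \<open>x y = a\<close> modulo \<open>m\<close>. Detecting the conditions \<open>x \<in> \<X>\<close> and \<open>y \<in> \<Y>\<close> by additive characters
  (\<open>box_points_fourier\<close>) turns the count into an average of the Kloosterman sums
  \<open>K(h, k) = \<Sum>(x, y) \<in> H. e((h x + k y) / m)\<close> over all frequencies \<open>(h, k)\<close>. The frequency \<open>(0, 0)\<close>
  gives the main term, because \<open>H\<close> has \<open>\<phi>(m)\<close> elements. The weights of the other frequencies decay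
  like \<open>1 / (h k)\<close>, so the whole error is of size \<open>m\<^sup>1\<^sup>/\<^sup>2\<close>, up to divisor functions and logarithms, once
  \<open>K(h, k)\<close> is bounded by \<open>C\<^sup>\<omega>\<^sup>(\<^sup>m\<^sup>) \<surd>m \<surd>gcd(h, k, m)\<close> (\<open>norm_kloo_le\<close>). By the Chinese remainder theorem
  (\<open>kloo_mult\<close>) it is enough to prove this bound for prime powers.

  For \<open>p\<^sup>n\<close> with \<open>n \<ge> 2\<close> the bound is elementary: multiplying \<open>(x, y)\<close> by \<open>(1 + p\<^sup>s t, 1 - p\<^sup>s t)\<close> with
  \<open>2 s \<ge> n\<close> permutes \<open>H\<close>, and averaging over \<open>t\<close> removes all terms but those with \<open>h x = k y\<close> modulo
  \<open>p\<^sup>n\<^sup>-\<^sup>s\<close>, of which there are at most \<open>4 p\<^sup>s\<close>. If \<open>n\<close> is odd, one more averaging produces a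
  quadratic Gauss sum modulo \<open>p\<close>, which recovers the missing factor \<open>\<surd>p\<close>.

  For a prime \<open>p\<close> the bound \<open>2 \<surd>p\<close> is Weil's. Over the polynomials over the field with \<open>p\<close> elements,
  let \<open>\<chi>\<close> be the multiplicative function that sends a monic polynomial with roots \<open>r\<^sub>i \<noteq> 0\<close> to
  \<open>e((\<Sum>i. a r\<^sub>i + b / r\<^sub>i) / p)\<close>. This depends on two coefficients only, so the sums of \<open>\<chi>\<close> over the
  polynomials of degree \<open>0, 1, 2\<close> are \<open>1, K, p\<close> and all later ones vanish: the L-function is
  \<open>1 + K T + p T\<^sup>2\<close>. Unique factorization (\<open>charsum_mangoldt\<close>) identifies its logarithmic derivative, so
  that \<open>L\<^sub>n = - (\<alpha>\<^sup>n + \<beta>\<^sup>n)\<close> with \<open>\<alpha> + \<beta> = - K\<close> and \<open>\<alpha> \<beta> = p\<close> (\<open>mangoldt_kloo_recurrence\<close>), where \<open>L\<^sub>n\<close> sums over the prime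
  powers of degree \<open>n\<close>; it is the Kloosterman sum of the field with \<open>p\<^sup>n\<close> elements. Stepanov's method (\<open>stepanov_bound\<close>)
  shows that among the elements of that field with \<open>n = 2 k\<close> every value of the trace
  of \<open>a r + b / r\<close> is taken at most \<open>p\<^sup>n\<^sup>-\<^sup>1 + 5 p\<^sup>k\<close> times. As these numbers add up to
  \<open>p\<^sup>n - 1\<close>, they are all close to \<open>p\<^sup>n\<^sup>-\<^sup>1\<close>, whence \<open>L\<^sub>2\<^sub>k = O(p\<^sup>k)\<close>. Since \<open>K\<close> is real,
  \<open>K\<^sup>2 > 4 p\<close> would make \<open>\<alpha>\<close> and \<open>\<beta>\<close> real with one of them larger than \<open>\<surd>p\<close> in modulus, which contradicts this for large \<open>k\<close>.
\<close>

hide_const (open) Divisibility.irreducible Divisibility.prime Coset.order up_ring.monom up_ring.coeff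
  Polynomials.degree Polynomials.lead_coeff comm_monoid_mult_class.coprime

no_notation var (\<open>X\<index>\<close>)

section \<open>Additive characters\<close>

definition ee :: "real \<Rightarrow> complex" where "ee x = cis (2 * pi * x)"

lemma ee_add: "ee (x + y) = ee x * ee y"
  by (simp add: ee_def cis_mult distrib_left)

lemma ee_0 [simp]: "ee 0 = 1" by (simp add: ee_def)

lemma norm_ee [simp]: "norm (ee x) = 1" by (simp add: ee_def)

lemma ee_of_int [simp]: "ee (of_int n) = 1"
  by (simp add: ee_def cis.ctr complex_eq_iff cos_int_2pin sin_int_2pin)

lemma ee_eq_1_iff: "ee x = 1 \<longleftrightarrow> x \<in> \<int>"
proof
  assume "ee x = 1"
  hence "cos (2 * pi * x) = 1" by (simp add: ee_def complex_eq_iff)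
  then obtain n :: int where "2 * pi * x = of_int n * 2 * pi"
    using cos_one_2pi_int by blast
  hence "x = of_int n" by (simp add: field_simps)
  thus "x \<in> \<int>" by simp
qed (auto elim!: Ints_cases)

lemma cnj_ee: "cnj (ee x) = ee (- x)"
  by (simp add: ee_def cis_cnj)

lemma ee_int_cong:
  assumes "[x = y] (mod int m)" "m > 0"
  shows "ee (of_int x / real m) = ee (of_int y / real m)"
proof -
  from assms obtain k where k: "x = y + int m * k" by (metis cong_iff_lin cong_sym)
  have "of_int x / real m = of_int y / real m + of_int k"
    using assms(2) by (simp add: k add_divide_distrib)
  thus ?thesis by (simp add: ee_add)
qed

definition addchar :: "'a :: prime_card mod_ring \<Rightarrow> complex" where
  "addchar c = ee (of_int (to_int_mod_ring c) / real CARD('a))"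

lemma addchar_of_int:
  "addchar (of_int z :: 'a :: prime_card mod_ring) = ee (of_int z / real CARD('a))"
proof -
  have "to_int_mod_ring (of_int z :: 'a mod_ring) = z mod int CARD('a)"
    by (simp add: of_int_of_int_mod_ring of_int_mod_ring.rep_eq to_int_mod_ring.rep_eq)
  thus ?thesis unfolding addchar_def
    by (metis cong_mod_left ee_int_cong cong_refl zero_less_card_finite)
qed

lemma mod_ring_of_int_cases:
  obtains z where "(c :: 'a :: prime_card mod_ring) = of_int z"
  by (metis of_int_of_int_mod_ring of_int_mod_ring_to_int_mod_ring)

lemma addchar_add: "addchar (c + d) = addchar c * addchar d"
proof -
  obtain x y where "c = of_int x" "d = of_int y" by (meson mod_ring_of_int_cases)
  thus ?thesis using addchar_of_int[of "x + y"] by (simp add: addchar_of_int ee_add add_divide_distrib)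
qed

lemma addchar_0 [simp]: "addchar 0 = 1"
  using addchar_of_int[of 0] by simp

lemma norm_addchar [simp]: "norm (addchar c) = 1"
  by (simp add: addchar_def)

lemma addchar_minus: "addchar (- c) = cnj (addchar c)"
proof -
  obtain x where "c = of_int x" by (meson mod_ring_of_int_cases)
  thus ?thesis using addchar_of_int[of "- x"] by (simp add: addchar_of_int cnj_ee)
qed

lemma addchar_of_nat_mult: "addchar (of_nat n * c) = addchar c ^ n"
  by (induction n) (simp_all add: distrib_right addchar_add)

lemma addchar_eq_1_iff: "addchar c = 1 \<longleftrightarrow> c = 0"
proof
  assume "addchar c = 1"
  hence "of_int (to_int_mod_ring c) / real CARD('a) \<in> \<int>" by (simp add: addchar_def ee_eq_1_iff)
  then obtain k :: int where k: "of_int (to_int_mod_ring c) / real CARD('a) = of_int k"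
    by (auto elim: Ints_cases)
  hence "of_int (to_int_mod_ring c) = (of_int (k * int CARD('a)) :: real)"
    by (simp add: field_simps)
  hence "to_int_mod_ring c = k * int CARD('a)" by linarith
  hence "(of_int (to_int_mod_ring c) :: 'a mod_ring) = 0" by simp
  thus "c = 0" by (simp add: of_int_of_int_mod_ring)
qed simp

text \<open>
  Orthogonality of characters and all vanishing sums below are instances of this: a bijection of the
  index set multiplies every term by the same factor.
\<close>

lemma sum_shift_invariant_0:
  fixes f :: "'b \<Rightarrow> complex"
  assumes "bij_betw \<phi> A A" "\<And>x. x \<in> A \<Longrightarrow> f (\<phi> x) = \<omega> * f x" "\<omega> \<noteq> 1"
  shows "sum f A = 0"
proof -
  have "sum f A = (\<Sum>x\<in>A. f (\<phi> x))" using sum.reindex_bij_betw[OF assms(1), of f] by simp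
  also have "\<dots> = \<omega> * sum f A" using assms(2) by (simp add: sum_distrib_left)
  finally show ?thesis using assms(3) by (simp add: algebra_simps)
qed

lemma sum_addchar: "(\<Sum>c\<in>UNIV. addchar (c * d)) = (if d = 0 then of_nat CARD('a) else 0)"
  for d :: "'a :: prime_card mod_ring"
proof (cases "d = 0")
  case False
  have "(\<Sum>c\<in>UNIV. addchar (c * d)) = 0"
  proof (rule sum_shift_invariant_0[where \<phi> = "\<lambda>c. c + 1" and \<omega> = "addchar d"])
    show "bij (\<lambda>c :: 'a mod_ring. c + 1)"
      by (rule bij_betw_byWitness[where f' = "\<lambda>c. c - 1"]) auto
  qed (use False in \<open>simp_all add: addchar_add addchar_eq_1_iff distrib_right\<close>)
  thus ?thesis using False by simp
qed simp

section \<open>A multiplicative character on polynomials and its L-function\<close>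

text \<open>
  The logarithmic derivative at \<open>0\<close>. For a product of linear factors \<open>X - r\<close> it is minus the sum of
  the \<open>1 / r\<close>, and on the reflected polynomial it is minus the sum of the \<open>r\<close>.
\<close>

definition dlog0 :: "'a :: field poly \<Rightarrow> 'a" where
  "dlog0 h = coeff h 1 / coeff h 0"

lemma dlog0_mult:
  assumes "coeff f 0 \<noteq> 0" "coeff g 0 \<noteq> 0"
  shows "dlog0 (f * g) = dlog0 f + dlog0 g"
  using assms by (simp add: dlog0_def coeff_mult field_simps)

text \<open>
  The sum of \<open>a r + b / r\<close> over the roots \<open>r\<close> of \<open>h\<close>, for monic \<open>h\<close> with \<open>h(0) \<noteq> 0\<close>, read off the coefficients. Writing
  it with \<open>dlog0\<close> makes it additive on products without any splitting field, and gives the right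
  value \<open>0\<close> for constant polynomials.
\<close>

definition hyptrace :: "'a \<Rightarrow> 'a \<Rightarrow> 'a :: field poly \<Rightarrow> 'a" where
  "hyptrace a b h = - (a * dlog0 (reflect_poly h) + b * dlog0 h)"

lemma hyptrace_mult:
  assumes "coeff f 0 \<noteq> 0" "coeff g 0 \<noteq> 0"
  shows "hyptrace a b (f * g) = hyptrace a b f + hyptrace a b g"
proof -
  have "f \<noteq> 0" "g \<noteq> 0" using assms by auto
  thus ?thesis using assms
    by (simp add: hyptrace_def dlog0_mult reflect_poly_mult algebra_simps)
qed

lemma hyptrace_1 [simp]: "hyptrace a b 1 = 0"
  by (simp add: hyptrace_def dlog0_def)

lemma hyptrace_prod:
  assumes "finite A" "\<And>x. x \<in> A \<Longrightarrow> coeff (f x) 0 \<noteq> 0"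
  shows "hyptrace a b (prod f A) = (\<Sum>x\<in>A. hyptrace a b (f x))"
  using assms
  by (induction A rule: finite_induct) (simp_all add: hyptrace_mult poly_prod flip: poly_0_coeff_0)

lemma hyptrace_linear:
  assumes "r \<noteq> 0"
  shows "hyptrace a b [:- r, 1:] = a * r + b / r"
  using assms by (simp add: hyptrace_def dlog0_def reflect_poly_def field_simps)

definition monics :: "nat \<Rightarrow> 'a :: field poly set" where
  "monics n = {h. degree h = n \<and> lead_coeff h = 1 \<and> coeff h 0 \<noteq> 0}"

definition irred_monics :: "'a :: field poly set" where
  "irred_monics = {f. irreducible f \<and> lead_coeff f = 1 \<and> coeff f 0 \<noteq> 0}"

definition prime_power_index :: "nat \<Rightarrow> ('a :: field poly \<times> nat) set" where
  "prime_power_index k = {(f, j). f \<in> irred_monics \<and> j * degree f = k}"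

lemma finite_degree_le: "finite {h :: 'a :: finite_field poly. degree h \<le> n}"
proof -
  have "{h :: 'a poly. degree h \<le> n} \<subseteq> Poly ` {xs. set xs \<subseteq> UNIV \<and> length xs \<le> Suc n}"
  proof
    fix h :: "'a poly" assume "h \<in> {h. degree h \<le> n}"
    hence "length (coeffs h) \<le> Suc n" by (cases "h = 0") (auto simp: length_coeffs_degree)
    thus "h \<in> Poly ` {xs. set xs \<subseteq> UNIV \<and> length xs \<le> Suc n}"
      by (intro image_eqI[of _ _ "coeffs h"]) auto
  qed
  thus ?thesis by (rule finite_subset) (intro finite_imageI finite_lists_length_le; simp)
qed

lemma finite_monics: "finite (monics n :: 'a :: finite_field poly set)"
  by (rule finite_subset[OF _ finite_degree_le[of n]]) (auto simp: monics_def)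

lemma irreducible_degree_pos:
  fixes f :: "'a :: field poly"
  assumes "irreducible f"
  shows "degree f > 0"
proof (rule ccontr)
  assume "\<not> degree f > 0"
  moreover have "f \<noteq> 0" "\<not> f dvd 1" using assms by (auto simp: irreducible_def)
  ultimately show False using is_unit_iff_degree[of f] by simp
qed

lemma finite_prime_power_index:
  assumes "k > 0"
  shows "finite (prime_power_index k :: ('a :: finite_field poly \<times> nat) set)"
proof (rule finite_subset)
  show "prime_power_index k \<subseteq> {h :: 'a poly. degree h \<le> k} \<times> {..k}"
  proof
    fix x :: "'a poly \<times> nat" assume "x \<in> prime_power_index k"
    then obtain f j where x: "x = (f, j)" "irreducible f" "j * degree f = k"
      by (auto simp: prime_power_index_def irred_monics_def)
    hence "degree f > 0" using irreducible_degree_pos by blast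
    moreover have "j > 0" using x assms by (cases j) auto
    ultimately show "x \<in> {h :: 'a poly. degree h \<le> k} \<times> {..k}" using x by auto
  qed
qed (use finite_degree_le in auto)

text \<open>
  The analogue of \<open>\<Sum>d dvd n. \<Lambda> d = log n\<close>: an irreducible factor of multiplicity \<open>\<mu>\<close> is counted once for
  each of its powers \<open>1, \<dots>, \<mu>\<close> that divide \<open>h\<close>.
\<close>

lemma degree_eq_sum_prime_powers:
  fixes h :: "'a :: field_gcd poly"
  assumes "h \<in> monics n"
  defines "P \<equiv> {(f, j). f \<in> irred_monics \<and> j > 0 \<and> f ^ j dvd h}"
  shows "(\<Sum>(f,j)\<in>P. degree f) = n"
proof -
  have h: "h \<noteq> 0" "degree h = n" "lead_coeff h = 1" "coeff h 0 \<noteq> 0"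
    using assms by (auto simp: monics_def)
  have pf: "prime_factors h = {f. f \<in> irred_monics \<and> f dvd h}"
  proof (intro Set.set_eqI iffI)
    fix f assume f: "f \<in> prime_factors h"
    hence "prime f" "f dvd h" by auto
    then obtain g where g: "h = f * g" by blast
    hence "coeff f 0 \<noteq> 0" using h by (auto simp: coeff_mult)
    moreover have "lead_coeff f = 1"
      using \<open>prime f\<close> by (metis coeff_pCons_0 lead_coeff_pCons(2) degree_0 lead_coeff_1 leading_coeff_0_iff monic_normalize normalize_prime not_prime_0)
    moreover have "irreducible f" using \<open>prime f\<close> by auto
    ultimately show "f \<in> {f. f \<in> irred_monics \<and> f dvd h}" using \<open>f dvd h\<close> by (auto simp: irred_monics_def)
  next
    fix f assume f: "f \<in> {f. f \<in> irred_monics \<and> f dvd h}"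
    hence "prime_elem f" "normalize f = f"
      by (auto simp: irred_monics_def irreducible_imp_prime_elem normalize_monic)
    thus "f \<in> prime_factors h" using f h
      by (auto simp: in_prime_factors_iff normalization_semidom_class.prime_def)
  qed
  have P: "P = Sigma (prime_factors h) (\<lambda>f. {1..multiplicity f h})"
  proof (intro Set.set_eqI, clarify)
    fix f :: "'a poly" and j
    have "f \<in> prime_factors h \<and> j \<in> {1..multiplicity f h} \<longleftrightarrow> (f, j) \<in> P"
    proof
      assume *: "f \<in> prime_factors h \<and> j \<in> {1..multiplicity f h}"
      hence "f ^ j dvd h" by (auto intro: multiplicity_dvd')
      thus "(f, j) \<in> P" using * pf by (auto simp: P_def)
    next
      assume *: "(f, j) \<in> P"
      hence "f dvd h" unfolding P_def by (auto elim: dvd_trans[rotated] intro: dvd_power)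
      with * have "f \<in> prime_factors h" using pf by (auto simp: P_def)
      moreover have "j \<le> multiplicity f h"
        using * h(1) by (intro multiplicity_geI) (auto simp: P_def irred_monics_def irreducible_def)
      ultimately show "f \<in> prime_factors h \<and> j \<in> {1..multiplicity f h}" using * by (auto simp: P_def)
    qed
    thus "(f, j) \<in> P \<longleftrightarrow> (f, j) \<in> Sigma (prime_factors h) (\<lambda>f. {1..multiplicity f h})" by auto
  qed
  have "(\<Sum>(f,j)\<in>P. degree f) = (\<Sum>f\<in>prime_factors h. multiplicity f h * degree f)"
    unfolding P by (subst sum.Sigma[symmetric]) auto
  also have "\<dots> = degree (\<Prod>f\<in>prime_factors h. f ^ multiplicity f h)"
  proof -
    have nz: "f \<noteq> 0" if "f \<in> prime_factors h" for f using that by auto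
    hence "degree (f ^ k) = k * degree f" if "f \<in> prime_factors h" for f k
      using that by (simp add: Polynomial.degree_power_eq)
    thus ?thesis using nz
      by (subst degree_prod_eq_sum_degree) auto
  qed
  also have "(\<Prod>f\<in>prime_factors h. f ^ multiplicity f h) = normalize h"
    using prod_prime_factors[OF \<open>h \<noteq> 0\<close>] .
  finally show ?thesis using h by simp
qed

definition charsum :: "('a :: field poly \<Rightarrow> complex) \<Rightarrow> nat \<Rightarrow> complex" where
  "charsum \<chi> n = (\<Sum>h\<in>monics n. \<chi> h)"

text \<open>
  The values of \<open>\<chi>\<close> at prime powers of degree \<open>k\<close>, weighted by the polynomial von Mangoldt function:
  the coefficients of the logarithmic derivative of the L-function of \<open>\<chi>\<close>.
\<close>

definition mangoldt_sum :: "('a :: field poly \<Rightarrow> complex) \<Rightarrow> nat \<Rightarrow> complex" where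
  "mangoldt_sum \<chi> k = (\<Sum>(f,j)\<in>prime_power_index k. of_nat (degree f) * \<chi> f ^ j)"

text \<open>
  The Euler product, in the form \<open>T L' / L\<close>: expand the degree of each polynomial by
  \<open>degree_eq_sum_prime_powers\<close> and divide out the prime power.
\<close>

lemma charsum_mangoldt:
  fixes \<chi> :: "'a :: prime_card mod_ring poly \<Rightarrow> complex"
  assumes mult: "\<And>f g. coeff f 0 \<noteq> 0 \<Longrightarrow> coeff g 0 \<noteq> 0 \<Longrightarrow> \<chi> (f * g) = \<chi> f * \<chi> g"
    and one: "\<chi> 1 = 1"
  shows "of_nat n * charsum \<chi> n = (\<Sum>k=1..n. mangoldt_sum \<chi> k * charsum \<chi> (n - k))"
proof -
  have pow: "\<chi> (f ^ j) = \<chi> f ^ j" if "coeff f 0 \<noteq> 0" for f j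
    using that by (induction j) (simp_all add: one mult coeff_0_power)
  define I where "I = (\<Union>k\<in>{1..n}. (prime_power_index k :: ('a mod_ring poly \<times> nat) set))"
  have finI: "finite I" unfolding I_def by (auto intro!: finite_prime_power_index)
  have I: "f \<in> irred_monics" "j * degree f \<le> n" "j * degree f \<ge> 1" if "(f, j) \<in> I" for f j
    using that by (auto simp: I_def prime_power_index_def)
  have deg: "of_nat n * \<chi> h = (\<Sum>(f,j)\<in>I. if f ^ j dvd h then of_nat (degree f) * \<chi> h else 0)"
    if h: "h \<in> monics n" for h
  proof -
    have *: "{(f, j). f \<in> irred_monics \<and> j > 0 \<and> f ^ j dvd h} = {x\<in>I. fst x ^ snd x dvd h}"
    proof (intro Set.set_eqI, clarify)
      fix f :: "'a mod_ring poly" and j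
      show "(f, j) \<in> {(f, j). f \<in> irred_monics \<and> j > 0 \<and> f ^ j dvd h} \<longleftrightarrow>
            (f, j) \<in> {x\<in>I. fst x ^ snd x dvd h}"
      proof (cases "f \<in> irred_monics \<and> f ^ j dvd h")
        case True
        hence "degree f > 0" by (auto simp: irred_monics_def irreducible_degree_pos)
        have "h \<noteq> 0" using h by (auto simp: monics_def)
        hence "degree (f ^ j) \<le> degree h" using True by (intro dvd_imp_degree_le) auto
        moreover have "degree (f ^ j) = j * degree f" using True by (subst Polynomial.degree_power_eq) (auto simp: irred_monics_def)
        ultimately have "j * degree f \<le> n" using h by (auto simp: monics_def)
        thus ?thesis using True \<open>degree f > 0\<close> by (auto simp: I_def prime_power_index_def)
      qed (use I in auto)
    qed
    have "of_nat n * \<chi> h = of_nat (\<Sum>(f,j)\<in>{x\<in>I. fst x ^ snd x dvd h}. degree f) * \<chi> h"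
      using degree_eq_sum_prime_powers[OF h] unfolding * by simp
    also have "\<dots> = (\<Sum>x\<in>{x\<in>I. fst x ^ snd x dvd h}. of_nat (degree (fst x)) * \<chi> h)"
      by (simp add: sum_distrib_right case_prod_unfold)
    also have "\<dots> = (\<Sum>x\<in>I. if fst x ^ snd x dvd h then of_nat (degree (fst x)) * \<chi> h else 0)"
      using finI by (subst sum.inter_filter) auto
    finally show ?thesis by (simp add: case_prod_unfold)
  qed
  have inner: "(\<Sum>h\<in>monics n. if f ^ j dvd h then of_nat (degree f) * \<chi> h else 0) =
      of_nat (degree f) * \<chi> f ^ j * charsum \<chi> (n - j * degree f)" if fj: "(f, j) \<in> I" for f j
  proof -
    have f: "lead_coeff f = 1" "coeff f 0 \<noteq> 0" "f \<noteq> 0" using I[OF fj] by (auto simp: irred_monics_def)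
    have "lead_coeff (f ^ j) = lead_coeff f ^ j" by (rule lead_coeff_power)
    hence fj0: "lead_coeff (f ^ j) = 1" by (simp only: f(1) power_one)
    have fj1: "coeff (f ^ j) 0 \<noteq> 0" "f ^ j \<noteq> 0" using f(2,3) by (simp_all add: coeff_0_power)
    have fj2: "degree (f ^ j) = j * degree f" using f(3) by (rule Polynomial.degree_power_eq)
    define F where "F = f ^ j"
    note F = fj0[folded F_def] fj1[folded F_def] fj2[folded F_def]
    have bij: "bij_betw (\<lambda>g. f ^ j * g) (monics (n - j * degree f)) {h\<in>monics n. f ^ j dvd h}"
      unfolding bij_betw_def
    proof (intro conjI Set.set_eqI iffI)
      show "inj_on (\<lambda>g. f ^ j * g) (monics (n - j * degree f))" using f by (auto simp: inj_on_def)
    next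
      fix h assume "h \<in> (\<lambda>g. f ^ j * g) ` monics (n - j * degree f)"
      then obtain g where g: "h = F * g" "g \<in> monics (n - j * degree f)" unfolding F_def by blast
      have g': "g \<noteq> 0" "degree g = n - j * degree f" "lead_coeff g = 1" "coeff g 0 \<noteq> 0"
        using g(2) by (auto simp: monics_def)
      have "degree h = n" using g(1) g' F I[OF fj] by (simp add: degree_mult_eq)
      moreover have "lead_coeff h = 1" unfolding g(1) lead_coeff_mult F(1) g'(3) by simp
      moreover have "coeff h 0 \<noteq> 0" unfolding g(1) coeff_mult using F(2) g'(4) by simp
      moreover have "F dvd h" using g(1) by simp
      ultimately show "h \<in> {h\<in>monics n. f ^ j dvd h}" unfolding F_def monics_def by blast
    next
      fix h assume h: "h \<in> {h\<in>monics n. f ^ j dvd h}"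
      hence "F dvd h" unfolding F_def by blast
      then obtain g where g: "h = F * g" by (rule dvdE)
      have h': "h \<noteq> 0" "degree h = n" "lead_coeff h = 1" "coeff h 0 \<noteq> 0"
        using h by (auto simp: monics_def)
      have "g \<noteq> 0" using g h'(1) by auto
      hence "degree h = j * degree f + degree g" unfolding g using F by (simp add: degree_mult_eq)
      moreover have "lead_coeff h = lead_coeff g" unfolding g lead_coeff_mult F(1) by simp
      moreover have "coeff g 0 \<noteq> 0" using h'(4) unfolding g coeff_mult by auto
      ultimately have "g \<in> monics (n - j * degree f)" using h' by (simp add: monics_def)
      thus "h \<in> (\<lambda>g. f ^ j * g) ` monics (n - j * degree f)" using g unfolding F_def by blast
    qed
    have "(\<Sum>h\<in>monics n. if f ^ j dvd h then of_nat (degree f) * \<chi> h else 0) =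
          (\<Sum>h\<in>{h\<in>monics n. f ^ j dvd h}. of_nat (degree f) * \<chi> h)"
      using finite_monics by (subst sum.inter_filter) auto
    also have "\<dots> = (\<Sum>g\<in>monics (n - j * degree f). of_nat (degree f) * \<chi> (f ^ j * g))"
      by (rule sum.reindex_bij_betw[OF bij, symmetric])
    also have "\<dots> = (\<Sum>g\<in>monics (n - j * degree f). of_nat (degree f) * \<chi> f ^ j * \<chi> g)"
      using fj1 f by (intro sum.cong refl) (simp add: mult pow monics_def)
    finally show ?thesis by (simp add: charsum_def sum_distrib_left)
  qed
  have disj: "(prime_power_index k :: ('a mod_ring poly \<times> nat) set) \<inter> prime_power_index k' = {}"
    if "k \<noteq> k'" for k k' using that by (auto simp: prime_power_index_def)
  have "of_nat n * charsum \<chi> n = (\<Sum>h\<in>monics n. of_nat n * \<chi> h)"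
    by (simp add: charsum_def sum_distrib_left)
  also have "\<dots> = (\<Sum>h\<in>monics n. \<Sum>x\<in>I. if fst x ^ snd x dvd h then of_nat (degree (fst x)) * \<chi> h else 0)"
    using deg by (intro sum.cong) (auto simp: case_prod_unfold)
  also have "\<dots> = (\<Sum>x\<in>I. \<Sum>h\<in>monics n. if fst x ^ snd x dvd h then of_nat (degree (fst x)) * \<chi> h else 0)"
    by (rule sum.swap)
  also have "\<dots> = (\<Sum>x\<in>I. of_nat (degree (fst x)) * \<chi> (fst x) ^ snd x * charsum \<chi> (n - snd x * degree (fst x)))"
    using inner by (intro sum.cong) auto
  also have "\<dots> = (\<Sum>k=1..n. \<Sum>x\<in>prime_power_index k. of_nat (degree (fst x)) * \<chi> (fst x) ^ snd x * charsum \<chi> (n - snd x * degree (fst x)))"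
    unfolding I_def using disj by (subst sum.UNION_disjoint) (auto intro!: finite_prime_power_index)
  also have "\<dots> = (\<Sum>k=1..n. mangoldt_sum \<chi> k * charsum \<chi> (n - k))"
    by (intro sum.cong refl) (auto simp: mangoldt_sum_def sum_distrib_right prime_power_index_def intro!: sum.cong)
  finally show ?thesis .
qed

lemma hyptrace_monics:
  assumes "h \<in> monics n" "n > 0"
  shows "hyptrace a b h = - (a * coeff h (n - 1) + b * coeff h 1 / coeff h 0)"
  using assms by (auto simp: hyptrace_def dlog0_def monics_def coeff_reflect_poly)

definition kloo_char :: "'a :: prime_card mod_ring \<Rightarrow> 'a mod_ring \<Rightarrow> 'a mod_ring poly \<Rightarrow> complex" where
  "kloo_char a b h = addchar (hyptrace a b h)"

definition kloo_field :: "'a :: prime_card mod_ring \<Rightarrow> 'a mod_ring \<Rightarrow> complex" where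
  "kloo_field a b = (\<Sum>r\<in>UNIV-{0}. addchar (a * r + b / r))"

lemma kloo_char_mult:
  "coeff f 0 \<noteq> 0 \<Longrightarrow> coeff g 0 \<noteq> 0 \<Longrightarrow> kloo_char a b (f * g) = kloo_char a b f * kloo_char a b g"
  by (simp add: kloo_char_def hyptrace_mult addchar_add)

lemma kloo_char_1 [simp]: "kloo_char a b 1 = 1"
  by (simp add: kloo_char_def)

lemma degree_1_cases:
  fixes h :: "'a :: field poly"
  assumes "degree h = 1"
  obtains c d where "h = [:c, d:]" "d \<noteq> 0"
proof -
  obtain c g where g: "h = pCons c g" by (cases h)
  with assms have "g \<noteq> 0" "degree g = 0" by (auto split: if_splits)
  then obtain d where "g = [:d:]" using degree_eq_zeroE by blast
  with g \<open>g \<noteq> 0\<close> show ?thesis using that by simp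
qed

lemma monic_pCons_iff:
  "degree (pCons c g) = Suc n \<and> lead_coeff (pCons c g) = 1 \<longleftrightarrow> degree g = n \<and> lead_coeff g = (1 :: 'a :: field)"
proof (cases "g = 0")
  case False
  hence "degree (pCons c g) = Suc (degree g)" by (rule degree_pCons_eq)
  thus ?thesis using False by simp
qed simp

lemma monics_0: "monics 0 = {1}"
proof (intro Set.set_eqI iffI)
  fix h :: "'a poly" assume h: "h \<in> monics 0"
  hence "degree h = 0" by (simp add: monics_def)
  then obtain c where "h = [:c:]" by (rule degree_eq_zeroE)
  moreover from this h have "c = 1" by (simp add: monics_def)
  ultimately show "h \<in> {1}" by simp
qed (simp add: monics_def)

lemma charsum_0: "\<chi> 1 = 1 \<Longrightarrow> charsum \<chi> 0 = 1"
  by (simp add: charsum_def monics_0)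

lemma charsum_kloo_1: "charsum (kloo_char a b) 1 = kloo_field a b"
proof -
  have bij: "bij_betw (\<lambda>r. [:- r, 1:]) (UNIV - {0}) (monics 1 :: 'a mod_ring poly set)"
    unfolding bij_betw_def
  proof (intro conjI Set.set_eqI iffI)
    show "inj_on (\<lambda>r. [:- r, 1:]) (UNIV - {0 :: 'a mod_ring})" by (auto simp: inj_on_def)
  next
    fix h :: "'a mod_ring poly" assume "h \<in> (\<lambda>r. [:- r, 1:]) ` (UNIV - {0})"
    thus "h \<in> monics 1" by (auto simp: monics_def)
  next
    fix h :: "'a mod_ring poly" assume h: "h \<in> monics 1"
    hence "degree h = 1" by (simp add: monics_def)
    then obtain c d where cd: "h = [:c, d:]" "d \<noteq> 0" by (rule degree_1_cases)
    with h have "d = 1" "c \<noteq> 0" by (auto simp: monics_def)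
    thus "h \<in> (\<lambda>r. [:- r, 1:]) ` (UNIV - {0})" using cd by (intro image_eqI[of _ _ "- c"]) auto
  qed
  show ?thesis unfolding charsum_def kloo_field_def
    by (subst sum.reindex_bij_betw[OF bij, symmetric], intro sum.cong refl)
       (simp only: kloo_char_def hyptrace_linear Diff_iff singleton_iff simp_thms)
qed

text \<open>
  In \<open>X\<^sup>2 + u X + v\<close> the coefficient \<open>u\<close> is both the second and the last but one, so the character is
  linear in \<open>u\<close> with slope \<open>- (a + b / v)\<close>, and only \<open>v = - b / a\<close> survives the sum over \<open>u\<close>.
\<close>

lemma charsum_kloo_2:
  assumes "a \<noteq> 0" "b \<noteq> (0 :: 'a :: prime_card mod_ring)"
  shows "charsum (kloo_char a b) 2 = of_nat CARD('a)"
proof -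
  define F where "F = (\<lambda>(v, u). [:v, u, 1:] :: 'a mod_ring poly)"
  have F: "degree (F (v, u)) = 2" "coeff (F (v, u)) 0 = v" "coeff (F (v, u)) 1 = u"
    "coeff (F (v, u)) 2 = 1" for v u
    by (simp_all add: F_def numeral_2_eq_2)
  have mon: "F (v, u) \<in> monics 2" if "v \<noteq> 0" for v u
    using F[of v u] that by (simp add: monics_def)
  have bij: "bij_betw F ((UNIV - {0}) \<times> UNIV) (monics 2)"
    unfolding bij_betw_def
  proof (intro conjI Set.set_eqI iffI)
    show "inj_on F ((UNIV - {0 :: 'a mod_ring}) \<times> UNIV)"
    proof (rule inj_onI)
      fix x y assume "F x = F y"
      hence "coeff (F (fst x, snd x)) i = coeff (F (fst y, snd y)) i" for i by simp
      from this[of 0] this[of 1] show "x = y" unfolding F by (simp add: prod_eq_iff)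
    qed
  next
    fix h assume "h \<in> F ` ((UNIV - {0}) \<times> UNIV)"
    thus "h \<in> monics 2" using mon by auto
  next
    fix h :: "'a mod_ring poly" assume "h \<in> monics 2"
    hence h: "degree h = 2" "coeff h 2 = 1" "coeff h 0 \<noteq> 0" by (auto simp: monics_def)
    have "coeff h i = coeff (F (coeff h 0, coeff h 1)) i" for i
    proof -
      consider "i = 0" | "i = 1" | "i = 2" | "i > 2" by linarith
      thus ?thesis
      proof cases
        case 1
        thus ?thesis by (simp only: F(2))
      next
        case 2
        thus ?thesis by (simp only: F(3))
      next
        case 3
        thus ?thesis by (simp only: F(4) h(2))
      next
        case 4
        hence "coeff h i = 0" "coeff (F (coeff h 0, coeff h 1)) i = 0"
          using h(1) F(1)[of "coeff h 0" "coeff h 1"] by (simp_all only: coeff_eq_0)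
        thus ?thesis by simp
      qed
    qed
    hence "h = F (coeff h 0, coeff h 1)" by (rule poly_eqI)
    thus "h \<in> F ` ((UNIV - {0}) \<times> UNIV)" using h(3) by blast
  qed
  have "charsum (kloo_char a b) 2 = (\<Sum>x\<in>(UNIV - {0}) \<times> UNIV. kloo_char a b (F x))"
    unfolding charsum_def by (rule sum.reindex_bij_betw[OF bij, symmetric])
  also have "\<dots> = (\<Sum>v\<in>UNIV - {0}. \<Sum>u\<in>UNIV. kloo_char a b (F (v, u)))"
    by (simp add: sum.cartesian_product)
  also have "\<dots> = (\<Sum>v\<in>UNIV - {0}. \<Sum>u\<in>UNIV. addchar (u * (- (a + b / v))))"
  proof (intro sum.cong refl)
    fix v u :: "'a mod_ring" assume v: "v \<in> UNIV - {0}"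
    hence "hyptrace a b (F (v, u)) = - (a * coeff (F (v, u)) (2 - 1) + b * coeff (F (v, u)) 1 / coeff (F (v, u)) 0)"
      by (intro hyptrace_monics mon) auto
    also have "2 - 1 = (1 :: nat)" by simp
    also have "- (a * coeff (F (v, u)) 1 + b * coeff (F (v, u)) 1 / coeff (F (v, u)) 0) = u * (- (a + b / v))"
      unfolding F using v by (simp add: divide_inverse algebra_simps)
    finally show "kloo_char a b (F (v, u)) = addchar (u * (- (a + b / v)))"
      by (simp add: kloo_char_def)
  qed
  also have "\<dots> = (\<Sum>v\<in>UNIV - {0}. if v = - b / a then of_nat CARD('a) else 0)"
  proof (intro sum.cong refl)
    fix v :: "'a mod_ring" assume v: "v \<in> UNIV - {0}"
    have "v * (- (a + b / v)) = - (a * v + b)" using v by (simp add: right_diff_distrib mult.commute)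
    hence "- (a + b / v) = 0 \<longleftrightarrow> a * v + b = 0" using v
      by (metis (no_types) DiffD2 insertI1 mult_eq_0_iff neg_equal_0_iff_equal)
    also have "\<dots> \<longleftrightarrow> a * v = - b" by (rule eq_neg_iff_add_eq_0[symmetric])
    also have "\<dots> \<longleftrightarrow> v = - b / a" using assms(1)
      by (metis nonzero_mult_div_cancel_left nonzero_eq_divide_eq mult.commute)
    finally show "(\<Sum>u\<in>UNIV. addchar (u * (- (a + b / v)))) = (if v = - b / a then of_nat CARD('a) else 0)"
      by (simp only: sum_addchar)
  qed
  also have "\<dots> = of_nat CARD('a)" using assms by (simp add: sum.delta)
  finally show ?thesis .
qed

text \<open>
  From degree 3 on, the coefficient of \<open>X\<^sup>n\<^sup>-\<^sup>1\<close> can be shifted without touching those of \<open>X\<close> and \<open>1\<close>.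
\<close>

lemma charsum_kloo_ge3:
  assumes "a \<noteq> (0 :: 'a :: prime_card mod_ring)" "n \<ge> 3"
  shows "charsum (kloo_char a b) n = 0"
proof -
  define m where "m = (monom 1 (n - 1) :: 'a mod_ring poly)"
  have cm: "coeff m n = 0" "coeff m 0 = 0" "coeff m 1 = 0" "coeff m (n - 1) = 1" "degree m < n"
    using assms(2) by (auto simp: m_def degree_monom_eq)
  have mon: "h + smult c m \<in> monics n" if "h \<in> monics n" for h c
  proof -
    have "degree (smult c m) < n" using cm(5) by (meson degree_smult_le le_less_trans)
    hence "degree (h + smult c m) = n" using that by (subst degree_add_eq_left) (auto simp: monics_def)
    thus ?thesis using that cm by (auto simp: monics_def)
  qed
  have "charsum (kloo_char a b) n = 0" unfolding charsum_def
  proof (rule sum_shift_invariant_0[where \<phi> = "\<lambda>h. h + m" and \<omega> = "addchar (- a)"])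
    show "bij_betw (\<lambda>h. h + m) (monics n) (monics n)"
      by (rule bij_betw_byWitness[where f' = "\<lambda>h. h + smult (-1) m"])
         (use mon[of _ 1] mon[of _ "-1"] in auto)
  next
    fix h :: "'a mod_ring poly" assume h: "h \<in> monics n"
    have "h + m \<in> monics n" using mon[OF h, of 1] by simp
    hence "hyptrace a b (h + m) = - a + hyptrace a b h"
      using assms(2) h cm by (simp add: hyptrace_monics algebra_simps)
    thus "kloo_char a b (h + m) = addchar (- a) * kloo_char a b h"
      by (simp add: kloo_char_def addchar_add[of "- a", symmetric])
  next
    show "addchar (- a) \<noteq> 1" using assms by (simp add: addchar_eq_1_iff)
  qed
  thus ?thesis .
qed

lemma mangoldt_kloo_recurrence:
  fixes a b :: "'a :: prime_card mod_ring"
  assumes ab: "a \<noteq> 0" "b \<noteq> 0"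
  defines "L \<equiv> mangoldt_sum (kloo_char a b)" and "K \<equiv> kloo_field a b"
  shows "L 1 = K" "L 2 = 2 * of_nat CARD('a) - K ^ 2"
    "n \<ge> 3 \<Longrightarrow> L n = - K * L (n - 1) - of_nat CARD('a) * L (n - 2)"
proof -
  note rec = charsum_mangoldt[of "kloo_char a b", OF kloo_char_mult kloo_char_1, folded L_def]
  have S: "charsum (kloo_char a b) 0 = 1" "charsum (kloo_char a b) 1 = K"
    "charsum (kloo_char a b) 2 = of_nat CARD('a)"
    unfolding K_def by (simp_all only: charsum_0 charsum_kloo_1 charsum_kloo_2[OF ab] kloo_char_1)
  show L1: "L 1 = K" using rec[of 1] S by simp
  have "{1..2} = {1, 2::nat}" by auto
  thus "L 2 = 2 * of_nat CARD('a) - K ^ 2" using rec[of 2] S L1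
    by (simp add: power2_eq_square algebra_simps)
  show "L n = - K * L (n - 1) - of_nat CARD('a) * L (n - 2)" if n: "n \<ge> 3"
  proof -
    have "0 = (\<Sum>k=1..n. L k * charsum (kloo_char a b) (n - k))"
      using rec[of n] charsum_kloo_ge3[OF ab(1) n, of b] by simp
    also have "\<dots> = (\<Sum>k\<in>{n-2,n-1,n}. L k * charsum (kloo_char a b) (n - k))"
    proof (rule sum.mono_neutral_right)
      show "\<forall>k\<in>{1..n} - {n - 2, n - 1, n}. L k * charsum (kloo_char a b) (n - k) = 0"
      proof
        fix k assume "k \<in> {1..n} - {n - 2, n - 1, n}"
        hence "n - k \<ge> 3" by auto
        thus "L k * charsum (kloo_char a b) (n - k) = 0" using charsum_kloo_ge3[OF ab(1)] by simp
      qed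
    qed (use n in auto)
    also have "\<dots> = L (n - 2) * of_nat CARD('a) + L (n - 1) * K + L n"
    proof -
      have "n - (n - 2) = 2" "n - (n - 1) = 1" "n - n = 0" using n by auto
      moreover have "n - 2 \<noteq> n - 1" "n - 2 \<noteq> n" "n - 1 \<noteq> n" using n by auto
      ultimately show ?thesis using S by (simp add: add.assoc)
    qed
    finally show ?thesis by (simp add: algebra_simps eq_neg_iff_add_eq_0)
  qed
qed

lemma card_monics_Suc:
  "card (monics (Suc n) :: 'a :: prime_card mod_ring poly set) = (CARD('a) - 1) * CARD('a) ^ n"
proof -
  define A where "A n = {h :: 'a mod_ring poly. degree h = n \<and> lead_coeff h = 1}" for n
  have A_Suc: "A (Suc n) = (\<lambda>(c, g). pCons c g) ` (UNIV \<times> A n)" for n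
  proof (intro Set.set_eqI iffI)
    fix h assume h: "h \<in> A (Suc n)"
    obtain c g where g: "h = pCons c g" by (cases h)
    hence "g \<in> A n" using h monic_pCons_iff[of c g n] unfolding A_def by blast
    thus "h \<in> (\<lambda>(c, g). pCons c g) ` (UNIV \<times> A n)" using g by auto
  next
    fix h assume "h \<in> (\<lambda>(c, g). pCons c g) ` (UNIV \<times> A n)"
    then obtain c g where g: "h = pCons c g" "g \<in> A n" by auto
    thus "h \<in> A (Suc n)" using monic_pCons_iff[of c g n] unfolding A_def by blast
  qed
  have inj: "inj_on (\<lambda>(c, g). pCons c g) B" for B :: "('a mod_ring \<times> 'a mod_ring poly) set"
    by (auto simp: inj_on_def)
  have A0: "A 0 = {1}"
  proof (intro Set.set_eqI iffI)
    fix h assume h: "h \<in> A 0"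
    hence "degree h = 0" by (simp add: A_def)
    then obtain c where "h = [:c:]" by (rule degree_eq_zeroE)
    moreover from this h have "c = 1" by (simp add: A_def)
    ultimately show "h \<in> {1}" by simp
  qed (simp add: A_def)
  have card_A: "card (A n) = CARD('a) ^ n" for n
    by (induction n) (simp_all add: A0 A_Suc card_image[OF inj] card_cartesian_product)
  have "monics (Suc n) = (\<lambda>(c, g). pCons c g) ` ((UNIV - {0}) \<times> A n)"
  proof (intro Set.set_eqI iffI)
    fix h :: "'a mod_ring poly" assume h: "h \<in> monics (Suc n)"
    obtain c g where g: "h = pCons c g" by (cases h)
    hence "g \<in> A n" using h monic_pCons_iff[of c g n] unfolding A_def monics_def by blast
    moreover have "c \<noteq> 0" using g h by (auto simp: monics_def)
    ultimately show "h \<in> (\<lambda>(c, g). pCons c g) ` ((UNIV - {0}) \<times> A n)" using g by auto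
  next
    fix h assume "h \<in> (\<lambda>(c, g). pCons c g) ` ((UNIV - {0}) \<times> A n)"
    then obtain c g where g: "h = pCons c g" "c \<noteq> 0" "g \<in> A n" by auto
    hence "coeff h 0 \<noteq> 0" by simp
    thus "h \<in> monics (Suc n)" using g monic_pCons_iff[of c g n] unfolding A_def monics_def by blast
  qed
  thus "card (monics (Suc n) :: 'a mod_ring poly set) = (CARD('a) - 1) * CARD('a) ^ n"
    by (simp add: card_image[OF inj] card_cartesian_product card_A card_Diff_singleton)
qed

text \<open>
  For the trivial character the weighted prime powers of degree \<open>n\<close> count the nonzero elements of the field
  with \<open>p\<^sup>n\<close> elements. It follows by comparing two consecutive instances of \<open>charsum_mangoldt\<close>,
  since the number of polynomials is multiplied by \<open>p\<close> from one degree to the next.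
\<close>

lemma mangoldt_trivial:
  "n > 0 \<Longrightarrow> mangoldt_sum (\<lambda>_ :: 'a :: prime_card mod_ring poly. 1) n = of_nat CARD('a) ^ n - 1"
proof (induction n rule: nat_induct_non_zero)
  define p where "p = (of_nat CARD('a) :: complex)"
  define S where "S = charsum (\<lambda>_ :: 'a mod_ring poly. 1)"
  define L where "L = mangoldt_sum (\<lambda>_ :: 'a mod_ring poly. 1)"
  have rec: "of_nat n * S n = (\<Sum>k=1..n. L k * S (n - k))" for n
    unfolding S_def L_def by (rule charsum_mangoldt) auto
  have S0: "S 0 = 1" by (simp add: S_def charsum_0)
  have "CARD('a) \<ge> 1" using prime_card[where 'a = 'a] by (simp add: prime_ge_1_nat)
  hence SS: "S (Suc n) = (p - 1) * p ^ n" for n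
    by (simp add: S_def charsum_def card_monics_Suc p_def of_nat_diff)
  {
    case 1
    show ?case using rec[of 1] S0 SS[of 0] by (simp add: L_def p_def)
  next
    case (Suc n)
    have "of_nat (Suc n) * S (Suc n) = L (Suc n) + (\<Sum>k=1..n. L k * S (Suc n - k))"
      using rec[of "Suc n"] S0 by simp
    also have "(\<Sum>k=1..n. L k * S (Suc n - k)) = L n * S 1 + (\<Sum>k=1..<n. L k * S (Suc n - k))"
      using Suc by (simp add: sum.last_plus atLeastLessThanSuc_atLeastAtMost[symmetric])
    also have "(\<Sum>k=1..<n. L k * S (Suc n - k)) = p * (\<Sum>k=1..<n. L k * S (n - k))"
      unfolding sum_distrib_left
    proof (intro sum.cong refl)
      fix k assume "k \<in> {1..<n}"
      then obtain j where j: "n - k = Suc j" by (metis Suc_diff_Suc atLeastLessThan_iff)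
      hence "Suc n - k = Suc (Suc j)" by auto
      thus "L k * S (Suc n - k) = p * (L k * S (n - k))" using j by (simp add: SS)
    qed
    also have "(\<Sum>k=1..<n. L k * S (n - k)) = of_nat n * S n - L n"
      using rec[of n] Suc S0 by (simp add: sum.last_plus atLeastLessThanSuc_atLeastAtMost[symmetric])
    finally have "L (Suc n) = of_nat (Suc n) * S (Suc n) - L n * S 1 - p * (of_nat n * S n - L n)"
      by (simp add: algebra_simps)
    moreover obtain j where "n = Suc j" using Suc by (cases n) auto
    moreover have "L n = p ^ n - 1" using Suc by (simp add: L_def p_def)
    ultimately have "L (Suc n) = L n + (p - 1) * p ^ n" using SS[of 0]
      by (simp add: SS algebra_simps)
    also have "L n = p ^ n - 1" using Suc by (simp add: L_def p_def)
    finally show ?case by (simp add: L_def p_def algebra_simps)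
  }
qed

section \<open>Roots in the algebraic closure and the trace\<close>

definition ac_eval :: "'a :: field alg_closure \<Rightarrow> 'a poly \<Rightarrow> 'a alg_closure" where
  "ac_eval r h = poly (map_poly to_ac h) r"

lemma map_poly_hom:
  fixes \<phi> :: "'a :: field \<Rightarrow> 'b :: field"
  assumes "comm_ring_hom \<phi>"
  shows "map_poly \<phi> (f - g) = map_poly \<phi> f - map_poly \<phi> g"
    "map_poly \<phi> (f * g) = map_poly \<phi> f * map_poly \<phi> g"
    "map_poly \<phi> (f ^ n) = map_poly \<phi> f ^ n"
    "map_poly \<phi> (prod h A) = (\<Prod>x\<in>A. map_poly \<phi> (h x))"
proof -
  interpret map_poly_comm_ring_hom \<phi> using assms by (simp add: map_poly_comm_ring_hom_def)
  show "map_poly \<phi> (f - g) = map_poly \<phi> f - map_poly \<phi> g"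
    "map_poly \<phi> (f * g) = map_poly \<phi> f * map_poly \<phi> g"
    "map_poly \<phi> (f ^ n) = map_poly \<phi> f ^ n"
    "map_poly \<phi> (prod h A) = (\<Prod>x\<in>A. map_poly \<phi> (h x))"
    by (simp_all add: hom_distribs)
qed

lemma ac_eval_simps [simp]:
  "ac_eval r 0 = 0" "ac_eval r 1 = 1"
  "ac_eval r (f + g) = ac_eval r f + ac_eval r g"
  "ac_eval r (f - g) = ac_eval r f - ac_eval r g"
  "ac_eval r (f * g) = ac_eval r f * ac_eval r g"
  "ac_eval r (f ^ n) = ac_eval r f ^ n"
  "ac_eval r (smult c f) = to_ac c * ac_eval r f"
  "ac_eval r (monom c n) = to_ac c * r ^ n"
proof -
  interpret comm_ring_hom "to_ac :: 'a \<Rightarrow> 'a alg_closure" by unfold_locales simp_all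
  note hom = map_poly_hom[OF comm_ring_hom_axioms]
  show "ac_eval r 0 = 0" "ac_eval r 1 = 1"
    "ac_eval r (f + g) = ac_eval r f + ac_eval r g"
    "ac_eval r (f - g) = ac_eval r f - ac_eval r g"
    "ac_eval r (f * g) = ac_eval r f * ac_eval r g"
    "ac_eval r (f ^ n) = ac_eval r f ^ n"
    "ac_eval r (smult c f) = to_ac c * ac_eval r f"
    "ac_eval r (monom c n) = to_ac c * r ^ n"
    by (simp_all add: ac_eval_def hom hom_distribs poly_monom)
qed

lemma ac_eval_sum: "ac_eval r (sum f A) = (\<Sum>x\<in>A. ac_eval r (f x))"
  by (induction A rule: infinite_finite_induct) simp_all

lemma ac_root_dvd:
  fixes f g :: "'a :: field_gcd poly"
  assumes "irreducible f" "ac_eval r f = 0" "ac_eval r g = 0"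
  shows "f dvd g"
proof (rule ccontr)
  assume "\<not> f dvd g"
  with assms(1) have "coprime f g"
    by (intro prime_elem_imp_coprime) (auto simp: irreducible_imp_prime_elem)
  then obtain u v where "u * f + v * g = 1"
    by (metis bezout_coefficients_fst_snd coprime_imp_gcd_eq_1)
  hence "ac_eval r (u * f + v * g) = 1" by simp
  thus False using assms by simp
qed

lemma frobenius_sum:
  fixes f :: "'b \<Rightarrow> 'a :: prime_card mod_ring alg_closure"
  shows "sum f A ^ (CARD('a) ^ k) = (\<Sum>x\<in>A. f x ^ (CARD('a) ^ k))"
  by (rule freshmans_dream_sum'[where n = k]) (simp_all add: prime_card)

lemma frobenius_add:
  fixes x :: "'a :: prime_card mod_ring alg_closure"
  shows "(x + y) ^ (CARD('a) ^ k) = x ^ (CARD('a) ^ k) + y ^ (CARD('a) ^ k)"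
  by (rule freshmans_dream'[where n = k]) (simp_all add: prime_card)

lemma to_ac_frobenius:
  "to_ac (c :: 'a :: prime_card mod_ring) ^ (CARD('a) ^ k) = to_ac c"
proof -
  have "c ^ (CARD('a) ^ k) = c"
    using finite_field_power_card_power_eq_same[of "CARD('a) ^ k" k c] by simp
  thus ?thesis by (metis to_ac_power)
qed

text \<open>
  The polynomial \<open>X\<^sup>p - X\<close> has at most \<open>p\<close> roots, and the prime field already supplies \<open>p\<close> of them.
\<close>

lemma frobenius_fixed_imp_to_ac:
  fixes x :: "'a :: prime_card mod_ring alg_closure"
  assumes "x ^ CARD('a) = x"
  shows "x \<in> range to_ac"
proof -
  define P :: "'a mod_ring alg_closure poly" where "P = monom 1 CARD('a) - monom 1 1"
  have p2: "CARD('a) > 1" using prime_card[where 'a = 'a] by (rule prime_gt_1_nat)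
  have "coeff P CARD('a) = 1" using p2 by (simp add: P_def)
  hence "P \<noteq> 0" by auto
  have degP: "degree P \<le> CARD('a)" unfolding P_def
    using p2 by (intro degree_diff_le) (auto simp: degree_monom_eq)
  have sub: "range to_ac \<subseteq> {x. poly P x = 0}"
    using to_ac_frobenius[of _ 1] by (auto simp: P_def poly_monom)
  have fin: "finite {x. poly P x = 0}" using \<open>P \<noteq> 0\<close> by (rule poly_roots_finite)
  have "card {x. poly P x = 0} \<le> CARD('a)"
    using card_poly_roots_bound[OF \<open>P \<noteq> 0\<close>] degP by simp
  moreover have "card (range (to_ac :: 'a mod_ring \<Rightarrow> _)) = CARD('a)"
    by (simp add: card_image inj_to_ac)
  ultimately have "range to_ac = {x. poly P x = 0}"
    using sub fin by (metis card_seteq)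
  thus ?thesis using assms by (simp add: P_def poly_monom)
qed

lemma irreducible_has_ac_root:
  fixes f :: "'a :: field poly"
  assumes "irreducible f"
  obtains r where "ac_eval r f = 0"
proof -
  have "degree (map_poly to_ac f) > 0"
    using irreducible_degree_pos[OF assms] by (simp add: degree_map_poly)
  then obtain r where "poly (map_poly to_ac f) r = 0" using alg_closed_imp_poly_has_root by blast
  thus ?thesis using that by (simp add: ac_eval_def)
qed

lemma ac_root_frobenius:
  fixes f :: "'a :: prime_card mod_ring poly"
  assumes "irreducible f" "ac_eval r f = 0"
  shows "r ^ (CARD('a) ^ degree f) = r"
proof -
  have "f dvd (monom 1 1) ^ (CARD('a) ^ degree f) - monom 1 1"
    using degree_divisor1[OF assms(1) refl] .
  then obtain g where "(monom 1 1) ^ (CARD('a) ^ degree f) - monom 1 1 = f * g" by (rule dvdE)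
  hence "ac_eval r ((monom 1 1) ^ (CARD('a) ^ degree f) - monom 1 1) = 0"
    using assms(2) by simp
  thus ?thesis by simp
qed

text \<open>
  The product over the Frobenius orbit of \<open>r\<close> is fixed by Frobenius, so it is defined over the prime
  field; it vanishes at \<open>r\<close> and is therefore divisible by \<open>f\<close>, which has the same degree.
\<close>

lemma ac_root_factorization:
  fixes f :: "'a :: prime_card mod_ring poly"
  assumes f: "irreducible f" "lead_coeff f = 1" and r: "ac_eval r f = 0"
  shows "map_poly to_ac f = (\<Prod>i<degree f. [:- (r ^ CARD('a) ^ i), 1:])"
proof -
  define d where "d = degree f"
  define P where "P = (\<Prod>i<d. [:- (r ^ CARD('a) ^ i), 1:])"
  define \<phi> where "\<phi> = (\<lambda>x :: 'a mod_ring alg_closure. x ^ CARD('a))"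
  have d: "d > 0" using f(1) irreducible_degree_pos by (auto simp: d_def)
  have rd: "r ^ CARD('a) ^ d = r" unfolding d_def by (rule ac_root_frobenius[OF f(1) r])
  have hom: "comm_ring_hom \<phi>"
    by unfold_locales (use frobenius_add[of _ _ 1] in \<open>simp_all add: \<phi>_def power_mult_distrib\<close>)
  interpret comm_ring_hom \<phi> by (rule hom)
  have "map_poly \<phi> P = (\<Prod>i<d. [:- (r ^ CARD('a) ^ Suc i), 1:])"
    unfolding P_def
    by (simp add: map_poly_hom[OF hom] hom_distribs) (simp add: \<phi>_def power_mult[symmetric] mult.commute)
  also have "\<dots> = P"
  proof -
    obtain d' where d': "d = Suc d'" using d by (cases d) auto
    have "(\<Prod>i<d. [:- (r ^ CARD('a) ^ Suc i), 1:]) = (\<Prod>i<d'. [:- (r ^ CARD('a) ^ Suc i), 1:]) * [:- (r ^ CARD('a) ^ d), 1:]"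
      unfolding d' by (rule prod.lessThan_Suc)
    also have "\<dots> = (\<Prod>i<d'. [:- (r ^ CARD('a) ^ Suc i), 1:]) * [:- (r ^ CARD('a) ^ 0), 1:]"
      by (simp only: rd power_0 power_one_right)
    also have "\<dots> = P" unfolding P_def d' prod.lessThan_Suc_shift by (simp only: mult.commute o_def)
    finally show ?thesis .
  qed
  finally have "map_poly \<phi> P = P" .
  hence "coeff P i \<in> range to_ac" for i
    by (metis \<phi>_def coeff_map_poly frobenius_fixed_imp_to_ac hom_zero)
  hence co: "to_ac (of_ac (coeff P i)) = coeff P i" for i by (simp add: to_ac_of_ac)
  define g where "g = map_poly of_ac P"
  have gP: "map_poly to_ac g = P"
    by (rule poly_eqI) (simp add: g_def coeff_map_poly co)
  have P: "lead_coeff P = 1" "degree P = d"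
  proof -
    show "lead_coeff P = 1" unfolding P_def by (simp add: lead_coeff_prod)
    show "degree P = d" unfolding P_def by (subst degree_prod_eq_sum_degree) auto
  qed
  have "degree g = degree (map_poly to_ac g)" by (simp add: degree_map_poly)
  hence g: "degree g = d" using gP P by simp
  have "to_ac (coeff g d) = coeff (map_poly to_ac g) d" by (simp add: coeff_map_poly)
  hence "to_ac (coeff g d) = to_ac 1" using gP P by simp
  hence lg: "lead_coeff g = 1" using g by (metis to_ac_eq_iff)
  have "poly P r = 0" unfolding P_def using d by (auto simp: poly_prod intro!: prod_zero bexI[of _ 0])
  hence "ac_eval r g = 0" by (simp add: ac_eval_def gP)
  hence "f dvd g" using ac_root_dvd f(1) r by blast
  then obtain h where h: "g = f * h" by (rule dvdE)
  have "g \<noteq> 0" using lg by auto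
  hence "f \<noteq> 0" "h \<noteq> 0" using h by auto
  hence "degree h = 0" using g h by (simp add: degree_mult_eq d_def)
  then obtain c where c: "h = [:c:]" by (rule degree_eq_zeroE)
  have "lead_coeff h = 1" using lg unfolding h lead_coeff_mult f(2) by simp
  hence "g = f" using h c by simp
  thus ?thesis using gP by (simp add: P_def d_def)
qed

text \<open>
  For \<open>r\<close> in the field with \<open>p\<^sup>n\<close> elements this is the trace of \<open>a r + b / r\<close> to the prime field.
\<close>

definition ac_trace :: "'a :: prime_card mod_ring \<Rightarrow> 'a mod_ring \<Rightarrow> nat \<Rightarrow> 'a mod_ring alg_closure \<Rightarrow> 'a mod_ring alg_closure" where
  "ac_trace a b n r = (\<Sum>i<n. to_ac a * r ^ CARD('a) ^ i + to_ac b / r ^ CARD('a) ^ i)"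

lemma to_ac_hyptrace:
  assumes "f \<noteq> 0"
  shows "to_ac (hyptrace a b f) = hyptrace (to_ac a) (to_ac b) (map_poly to_ac f)"
  by (auto simp: hyptrace_def dlog0_def coeff_map_poly coeff_reflect_poly degree_map_poly)

lemma ac_trace_degree:
  fixes f :: "'a :: prime_card mod_ring poly"
  assumes f: "f \<in> irred_monics" and r: "ac_eval r f = 0"
  shows "r \<noteq> 0" "ac_trace a b (degree f) r = to_ac (hyptrace a b f)"
proof -
  have f': "irreducible f" "lead_coeff f = 1" "coeff f 0 \<noteq> 0" using f by (auto simp: irred_monics_def)
  show r0: "r \<noteq> 0"
  proof
    assume "r = 0"
    hence "to_ac (coeff f 0) = 0" using r by (simp add: ac_eval_def poly_0_coeff_0 coeff_map_poly)
    thus False using f' by simp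
  qed
  have "to_ac (hyptrace a b f) = hyptrace (to_ac a) (to_ac b) (map_poly to_ac f)"
    by (rule to_ac_hyptrace) (use f' in auto)
  also have "\<dots> = (\<Sum>i<degree f. hyptrace (to_ac a) (to_ac b) [:- (r ^ CARD('a) ^ i), 1:])"
    unfolding ac_root_factorization[OF f'(1,2) r] by (rule hyptrace_prod) (use r0 in auto)
  also have "\<dots> = ac_trace a b (degree f) r"
    unfolding ac_trace_def by (intro sum.cong refl hyptrace_linear) (use r0 in auto)
  finally show "ac_trace a b (degree f) r = to_ac (hyptrace a b f)" ..
qed

lemma ac_root_frobenius_mult:
  fixes r :: "'a :: prime_card mod_ring alg_closure"
  assumes "r ^ (CARD('a) ^ d) = r"
  shows "r ^ (CARD('a) ^ (j * d)) = r"
proof (induction j)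
  case (Suc j)
  have "r ^ (CARD('a) ^ (Suc j * d)) = (r ^ (CARD('a) ^ d)) ^ (CARD('a) ^ (j * d))"
    by (simp add: power_add power_mult)
  thus ?case using Suc assms by simp
qed simp

lemma ac_trace_mult:
  fixes r :: "'a :: prime_card mod_ring alg_closure"
  assumes "r ^ (CARD('a) ^ d) = r"
  shows "ac_trace a b (j * d) r = of_nat j * ac_trace a b d r"
proof (induction j)
  case (Suc j)
  let ?F = "\<lambda>i. to_ac a * r ^ CARD('a) ^ i + to_ac b / r ^ CARD('a) ^ i"
  have split: "(\<Sum>i<m + l. ?F i) = (\<Sum>i<m. ?F i) + (\<Sum>i<l. ?F (i + m))" for m l
    by (induction l) (simp_all only: add_0_right sum.lessThan_Suc add_Suc_right add.assoc add.commute[of m] lessThan_0 sum.empty)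
  have *: "r ^ CARD('a) ^ (i + j * d) = r ^ CARD('a) ^ i" for i
  proof -
    have "r ^ CARD('a) ^ (i + j * d) = (r ^ (CARD('a) ^ (j * d))) ^ (CARD('a) ^ i)"
      by (simp add: power_add power_mult[symmetric] mult.commute)
    thus ?thesis using ac_root_frobenius_mult[OF assms] by simp
  qed
  have "ac_trace a b (Suc j * d) r = (\<Sum>i<j * d + d. ?F i)" by (simp add: ac_trace_def add.commute)
  also have "\<dots> = (\<Sum>i<j * d. ?F i) + (\<Sum>i<d. ?F (i + j * d))"
    by (rule split)
  also have "\<dots> = of_nat j * ac_trace a b d r + ac_trace a b d r"
    using Suc unfolding * by (simp add: ac_trace_def)
  finally show ?case by (simp add: distrib_right)
qed (simp add: ac_trace_def)

section \<open>The method of Stepanov\<close>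

text \<open>
  Over a finite field, the pigeonhole principle replaces the dimension count for a system with more
  unknowns than equations.
\<close>

lemma exists_linear_relation:
  fixes R :: "nat \<Rightarrow> 'a :: {field, finite} poly"
  assumes deg: "\<And>e. e < N \<Longrightarrow> degree (R e) < B" and "B < N"
  obtains D where "\<exists>e<N. D e \<noteq> 0" "(\<Sum>e<N. smult (D e) (R e)) = 0"
proof -
  define \<Phi> where "\<Phi> = (\<lambda>D. restrict (coeff (\<Sum>e<N. smult (D e) (R e))) {..<B})"
  have c2: "card (UNIV :: 'a set) > 1"
  proof -
    have "card {0, 1 :: 'a} \<le> card (UNIV :: 'a set)" by (intro card_mono) auto
    thus ?thesis by simp
  qed
  have "\<not> inj_on \<Phi> (PiE {..<N} (\<lambda>_. UNIV))"
  proof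
    assume "inj_on \<Phi> (PiE {..<N} (\<lambda>_. UNIV))"
    moreover have "\<Phi> ` PiE {..<N} (\<lambda>_. UNIV) \<subseteq> PiE {..<B} (\<lambda>_. UNIV)"
      by (intro image_subsetI) (simp add: \<Phi>_def restrict_PiE_iff)
    moreover have "finite (PiE {..<B} (\<lambda>_. UNIV :: 'a set))" by (intro finite_PiE) auto
    ultimately have "card (PiE {..<N} (\<lambda>_. UNIV :: 'a set)) \<le> card (PiE {..<B} (\<lambda>_. UNIV :: 'a set))"
      by (rule card_inj_on_le)
    hence "card (UNIV :: 'a set) ^ N \<le> card (UNIV :: 'a set) ^ B" by (simp add: card_PiE)
    thus False using c2 \<open>B < N\<close> by (simp add: power_increasing_iff)
  qed
  then obtain D D' where D: "D \<in> PiE {..<N} (\<lambda>_. UNIV)" "D' \<in> PiE {..<N} (\<lambda>_. UNIV)" "D \<noteq> D'" "\<Phi> D = \<Phi> D'"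
    unfolding inj_on_def by blast
  have "\<exists>e<N. D e - D' e \<noteq> 0"
  proof (rule ccontr)
    assume "\<not> (\<exists>e<N. D e - D' e \<noteq> 0)"
    hence "D e = D' e" if "e \<in> {..<N}" for e using that by auto
    hence "D = D'" by (rule PiE_ext[OF D(1,2)])
    thus False using D(3) by simp
  qed
  moreover have "(\<Sum>e<N. smult (D e - D' e) (R e)) = 0"
  proof (rule poly_eqI)
    fix i
    show "coeff (\<Sum>e<N. smult (D e - D' e) (R e)) i = coeff 0 i"
    proof (cases "i < B")
      case True
      have "\<Phi> D i = \<Phi> D' i" using D(4) by simp
      hence "coeff (\<Sum>e<N. smult (D e) (R e)) i = coeff (\<Sum>e<N. smult (D' e) (R e)) i"
        using True by (simp only: \<Phi>_def restrict_apply lessThan_iff if_True)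
      moreover have "(\<Sum>e<N. smult (D e - D' e) (R e)) = (\<Sum>e<N. smult (D e) (R e)) - (\<Sum>e<N. smult (D' e) (R e))"
        by (simp add: smult_diff_left sum_subtractf)
      ultimately show ?thesis by simp
    next
      case False
      have "coeff (R e) i = 0" if "e < N" for e
        by (rule coeff_eq_0) (use deg[OF that] False in linarith)
      thus ?thesis by (simp add: coeff_sum)
    qed
  qed
  ultimately show ?thesis by (rule that[of "\<lambda>e. D e - D' e"])
qed

lemma sum_distinct_degrees:
  fixes T :: "nat \<Rightarrow> 'a :: field poly"
  assumes T: "\<And>e. e < N \<Longrightarrow> T e \<noteq> 0" "\<And>e. e < N \<Longrightarrow> degree (T e) = e + s"
    and D: "\<exists>e<N. D e \<noteq> 0"
  shows "(\<Sum>e<N. smult (D e) (T e)) \<noteq> 0" "degree (\<Sum>e<N. smult (D e) (T e)) < N + s"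
proof -
  define m where "m = Max {e. e < N \<and> D e \<noteq> 0}"
  have m: "m < N" "D m \<noteq> 0" "\<And>e. e < N \<Longrightarrow> D e \<noteq> 0 \<Longrightarrow> e \<le> m"
    using Max_in[of "{e. e < N \<and> D e \<noteq> 0}"] D by (auto simp: m_def)
  have "coeff (\<Sum>e<N. smult (D e) (T e)) (m + s) = (\<Sum>e<N. if e = m then D m * lead_coeff (T m) else 0)"
    unfolding coeff_sum
  proof (intro sum.cong refl)
    fix e assume e: "e \<in> {..<N}"
    show "coeff (smult (D e) (T e)) (m + s) = (if e = m then D m * lead_coeff (T m) else 0)"
    proof (cases "e < m")
      case True
      hence "coeff (T e) (m + s) = 0" using T(2)[of e] e by (intro coeff_eq_0) auto
      thus ?thesis using True by simp
    next
      case False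
      thus ?thesis using m(3)[of e] e T(2)[of m] m(1) by (cases "e = m") auto
    qed
  qed
  also have "\<dots> \<noteq> 0" using m T(1)[of m] by simp
  finally show "(\<Sum>e<N. smult (D e) (T e)) \<noteq> 0" by auto
  show "degree (\<Sum>e<N. smult (D e) (T e)) < N + s"
  proof -
    have "degree (\<Sum>e<N. smult (D e) (T e)) \<le> N + s - 1"
    proof (rule degree_sum_le)
      fix e assume "e \<in> {..<N}"
      hence "degree (T e) \<le> N + s - 1" using T(2)[of e] by auto
      thus "degree (smult (D e) (T e)) \<le> N + s - 1" by (meson degree_smult_le le_trans)
    qed auto
    thus ?thesis using m(1) by linarith
  qed
qed

lemma sum_degree_irred_le:
  fixes G :: "'a :: field_gcd poly"
  assumes "finite Z" "Z \<subseteq> irred_monics" "\<And>f. f \<in> Z \<Longrightarrow> f dvd G" "G \<noteq> 0"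
  shows "(\<Sum>f\<in>Z. degree f) \<le> degree G"
proof -
  have nz: "f \<noteq> 0" if "f \<in> Z" for f using assms(2) that by (auto simp: irred_monics_def)
  have "prod (\<lambda>f. f) Z dvd G" using assms(1-3)
  proof (induction Z rule: finite_induct)
    case (insert f Z)
    have "coprime f g" if "g \<in> Z" for g
    proof (rule primes_coprime)
      have *: "prime h" if "h \<in> irred_monics" for h :: "'a poly"
        using that by (auto simp: irred_monics_def normalization_semidom_class.prime_def
            irreducible_imp_prime_elem normalize_monic)
      show "prime f" "prime g"
        using insert.prems that * by auto
      show "f \<noteq> g" using insert.hyps that by auto
    qed
    hence "coprime f (prod (\<lambda>f. f) Z)" by (intro prod_coprime_right)
    moreover have "prod (\<lambda>f. f) Z dvd G" using insert by auto
    ultimately show ?case using insert by (simp add: divides_mult)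
  qed simp
  hence "degree (prod (\<lambda>f. f) Z) \<le> degree G" using assms(4) by (rule dvd_imp_degree_le)
  thus ?thesis using nz by (subst (asm) degree_prod_eq_sum_degree) auto
qed

lemma mixed_radix:
  fixes e w p :: nat
  shows "e = e mod w + w * ((e div w) mod p) + (p * w) * (e div (p * w))"
proof -
  have "e div (p * w) = e div w div p" by (metis div_mult2_eq mult.commute)
  hence "w * ((e div w) mod p) + (p * w) * (e div (p * w)) = w * (e div w)"
    by (metis (no_types) add_mult_distrib2 mod_mult_div_eq mult.assoc mult.commute)
  thus ?thesis by (metis add.assoc mod_mult_div_eq)
qed

text \<open>
  Let \<open>Q = p\<^sup>k\<close>, \<open>w = Q / p\<close> and let \<open>\<gamma>\<close> be the sum of the first \<open>k\<close> of the \<open>2 k\<close> conjugates of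
  \<open>a r + b / r\<close>, as a rational function of \<open>r\<close>. Where \<open>r = r\<^sup>q\<close> with \<open>q = Q\<^sup>2\<close>, the other half is \<open>\<gamma>\<^sup>Q\<close>, so that the trace is
  \<open>c\<close> exactly if \<open>\<gamma>\<^sup>Q = c - \<gamma>\<close>. Consider \<open>G = \<Sum> D r\<^sup>i \<gamma>\<^sup>j r\<^sup>Q\<^sup>l\<close> with \<open>i < w\<close>, \<open>j < p\<close> and \<open>l < w + 4\<close> and
  coefficients \<open>D\<close> in the prime field. At such a point \<open>G\<^sup>Q = \<Sum> D r\<^sup>i\<^sup>Q\<^sup>+\<^sup>l (c - \<gamma>)\<^sup>j\<close>, an expression of
  degree smaller than the number of coefficients; hence the \<open>D\<close> can be chosen, not all zero, so that it
  vanishes identically. Then \<open>G\<close> vanishes at all these points. On the other hand \<open>\<gamma>\<close> has a pole of order \<open>w\<close> at infinity,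
  so the terms of \<open>G\<close> have distinct degrees \<open>i + w j + Q l\<close> and \<open>G\<close> is not zero; its degree bounds the number of points.
  Powers of \<open>r\<close> are multiplied in throughout to clear the pole of \<open>\<gamma>\<close> at \<open>0\<close>.
\<close>

theorem stepanov_bound:
  fixes a b c :: "'a :: prime_card mod_ring"
  assumes a: "a \<noteq> 0" and k: "k > 0"
    and Z: "finite Z" "Z \<subseteq> irred_monics"
    and root: "\<And>f. f \<in> Z \<Longrightarrow> \<exists>r. ac_eval r f = 0 \<and> r \<noteq> 0 \<and> r ^ (CARD('a) ^ (2 * k)) = r \<and> ac_trace a b (2 * k) r = to_ac c"
  shows "(\<Sum>f\<in>Z. degree f) \<le> CARD('a) ^ k * (CARD('a) ^ (k - 1) + 5)"
proof -
  define p where "p = CARD('a)"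
  define w where "w = p ^ (k - 1)"
  define Q where "Q = p ^ k"
  have p2: "p \<ge> 2" unfolding p_def using prime_card[where 'a = 'a] by (rule prime_ge_2_nat)
  have Qw: "Q = p * w" using k by (cases k) (auto simp: Q_def w_def)
  have w1: "w \<ge> 1" using p2 by (simp add: w_def)
  \<comment> \<open>\<open>M\<close> is just above \<open>w\<close>: the relation needs \<open>Q M\<close> to exceed \<open>w Q + Q\<close> plus lower terms, and \<open>Q M\<close> bounds the degree\<close>
  define M where "M = w + 4"
  define N where "N = Q * M"
  \<comment> \<open>\<open>gt\<close> is \<open>X\<^sup>w \<gamma>\<close>; the exponents \<open>w - p\<^sup>i\<close> do not underflow because \<open>i < k\<close>\<close>
  define gt where "gt = (\<Sum>i<k. monom a (w + p ^ i) + monom b (w - p ^ i))"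
  have piw: "p ^ i \<le> w" if "i < k" for i unfolding w_def using that p2 by (intro power_increasing) auto
  have piw': "p ^ i = w \<longleftrightarrow> i = k - 1" for i
    unfolding w_def using p2 by (intro power_inject_exp) auto
  have gt_le: "degree gt \<le> 2 * w" unfolding gt_def
  proof (intro degree_sum_le degree_add_le)
    fix i assume "i \<in> {..<k}"
    hence "p ^ i \<le> w" using piw by auto
    thus "degree (monom a (w + p ^ i)) \<le> 2 * w" "degree (monom b (w - p ^ i)) \<le> 2 * w"
      by (auto intro!: order.trans[OF degree_monom_le])
  qed auto
  have "coeff gt (2 * w) = (\<Sum>i<k. if i = k - 1 then a else 0)"
    unfolding gt_def coeff_sum
  proof (intro sum.cong refl)
    fix i assume "i \<in> {..<k}"
    hence "p ^ i \<le> w" "p ^ i > 0" using piw p2 by auto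
    thus "coeff (monom a (w + p ^ i) + monom b (w - p ^ i)) (2 * w) = (if i = k - 1 then a else 0)"
      using piw'[of i] w1 by auto
  qed
  hence cgt: "coeff gt (2 * w) = a" using k by simp
  hence dgt: "degree gt = 2 * w" using a gt_le le_degree[of gt "2 * w"] by auto
  have gt0: "gt \<noteq> 0" using cgt a by auto
  \<comment> \<open>a single index \<open>e = i + w j + Q l\<close>, which is also the degree of the term up to a constant\<close>
  define i where "i e = e mod w" for e
  define j where "j e = (e div w) mod p" for e
  define l where "l e = e div Q" for e
  have e_eq: "e = i e + w * j e + Q * l e" for e
    unfolding i_def j_def l_def Qw by (rule mixed_radix)
  have i: "i e \<le> w - 1" for e using w1 by (auto simp: i_def less_Suc_eq_le[symmetric])
  have j: "j e \<le> p - 1" for e using p2 by (auto simp: j_def less_Suc_eq_le[symmetric])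
  have pj: "p - 1 - j e + j e = p - 1" for e using j[of e] by (rule le_add_diff_inverse2)
  have l: "l e \<le> M - 1" if "e < N" for e
    using that less_mult_imp_div_less[of e M Q] by (auto simp: l_def N_def mult.commute)
  \<comment> \<open>the terms of \<open>G\<close> and those of the reduction of \<open>G\<^sup>Q\<close>, both times \<open>X\<^sup>w\<^sup>(\<^sup>p\<^sup>-\<^sup>1\<^sup>)\<close>\<close>
  define T where "T e = monom 1 (i e + l e * Q + w * (p - 1 - j e)) * gt ^ j e" for e
  define R where "R e = monom 1 (i e * Q + l e + w * (p - 1 - j e)) * (monom c w - gt) ^ j e" for e
  have T0: "T e \<noteq> 0" for e using gt0 by (simp add: T_def)
  have degT: "degree (T e) = e + w * (p - 1)" for e
  proof -
    have "degree (T e) = i e + l e * Q + w * (p - 1 - j e) + j e * (2 * w)"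
      using gt0 by (simp add: T_def degree_mult_eq degree_monom_eq Polynomial.degree_power_eq dgt)
    moreover have "w * (p - 1 - j e) + w * j e = w * (p - 1)"
      by (simp only: distrib_left[symmetric] pj)
    moreover have "j e * (2 * w) = w * j e + w * j e" by simp
    moreover have "l e * Q = Q * l e" by simp
    ultimately show ?thesis using e_eq[of e] by linarith
  qed
  define B where "B = (w - 1) * Q + M + 2 * w * (p - 1)"
  have degR: "degree (R e) < B" if e: "e < N" for e
  proof -
    have "degree (monom c w - gt) \<le> 2 * w"
      using degree_monom_le[of c w] dgt by (intro degree_diff_le) auto
    hence "degree ((monom c w - gt) ^ j e) \<le> 2 * w * j e"
      by (meson degree_power_le le_trans mult_le_mono1)
    moreover have "degree (R e) \<le> degree (monom (1 :: 'a mod_ring) (i e * Q + l e + w * (p - 1 - j e))) + degree ((monom c w - gt) ^ j e)"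
      unfolding R_def by (rule degree_mult_le)
    ultimately have "degree (R e) \<le> i e * Q + l e + (w * (p - 1 - j e) + 2 * w * j e)"
      by (simp add: degree_monom_eq)
    also have "w * (p - 1 - j e) + 2 * w * j e \<le> 2 * w * (p - 1 - j e) + 2 * w * j e" by simp
    also have "\<dots> = 2 * w * (p - 1)" by (simp only: distrib_left[symmetric] pj)
    finally have "degree (R e) \<le> i e * Q + l e + 2 * w * (p - 1)" by simp
    moreover have "i e * Q \<le> (w - 1) * Q" using i[of e] by simp
    moreover have "l e < M" using l[OF e] by (simp add: M_def)
    ultimately show ?thesis unfolding B_def by linarith
  qed
  have BN: "B < N"
  proof -
    have "2 * w * (p - 1) = 2 * Q - 2 * w" by (simp add: Qw algebra_simps diff_mult_distrib2)
    moreover have "(w - 1) * Q = w * Q - Q" by (simp add: diff_mult_distrib)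
    moreover have "N = w * Q + 4 * Q" by (simp add: N_def M_def algebra_simps)
    moreover have "w * Q \<ge> Q" "Q \<ge> 2 * w" using w1 p2 by (auto simp: Qw)
    ultimately show ?thesis using w1 unfolding B_def M_def by linarith
  qed
  obtain D where D: "\<exists>e<N. D e \<noteq> 0" "(\<Sum>e<N. smult (D e) (R e)) = 0"
    by (rule exists_linear_relation[OF degR BN])
  define G where "G = (\<Sum>e<N. smult (D e) (T e))"
  have G0: "G \<noteq> 0" and degG: "degree G < N + w * (p - 1)"
    unfolding G_def by (rule sum_distinct_degrees[OF T0 degT D(1)])+
  have dvd: "f dvd G" if f: "f \<in> Z" for f
  proof -
    obtain r where r: "ac_eval r f = 0" "r \<noteq> 0" "r ^ (p ^ (2 * k)) = r" "ac_trace a b (2 * k) r = to_ac c"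
      using root[OF f] by (auto simp: p_def)
    define \<gamma> where "\<gamma> = ac_trace a b k r"
    have "ac_trace a b (k + m) r = \<gamma> + (\<Sum>i<m. to_ac a * r ^ p ^ (k + i) + to_ac b / r ^ p ^ (k + i))" for m
      by (induction m) (simp_all add: \<gamma>_def ac_trace_def p_def add.assoc)
    hence "to_ac c = \<gamma> + (\<Sum>i<k. to_ac a * r ^ p ^ (k + i) + to_ac b / r ^ p ^ (k + i))"
      using r(4) by (metis mult_2)
    also have "(\<Sum>i<k. to_ac a * r ^ p ^ (k + i) + to_ac b / r ^ p ^ (k + i)) = \<gamma> ^ Q"
      unfolding \<gamma>_def ac_trace_def Q_def p_def frobenius_sum
      by (intro sum.cong refl)
         (simp add: frobenius_add power_mult_distrib power_divide to_ac_frobenius power_add mult.commute flip: power_mult)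
    finally have \<gamma>Q: "to_ac c - \<gamma> = \<gamma> ^ Q" by simp
    have ev_gt: "ac_eval r gt = r ^ w * \<gamma>"
      unfolding gt_def ac_eval_sum \<gamma>_def ac_trace_def sum_distrib_left
      by (intro sum.cong refl) (use piw r(2) in \<open>simp add: power_add power_diff field_simps p_def\<close>)
    define s where "s = w * (p - 1)"
    have sj: "w * (p - 1 - j e) + w * j e = s" for e
      by (simp only: s_def distrib_left[symmetric] pj)
    have evT: "ac_eval r (T e) = r ^ s * (r ^ (i e + l e * Q) * \<gamma> ^ j e)" for e
    proof -
      have "ac_eval r (T e) = r ^ (w * (p - 1 - j e) + w * j e) * (r ^ (i e + l e * Q) * \<gamma> ^ j e)"
        by (simp add: T_def ev_gt power_mult_distrib power_add power_mult)
      thus ?thesis by (simp only: sj)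
    qed
    have evR: "ac_eval r (R e) = r ^ s * (r ^ (i e * Q + l e) * (\<gamma> ^ Q) ^ j e)" for e
    proof -
      have "ac_eval r (monom c w - gt) = r ^ w * \<gamma> ^ Q"
        unfolding \<gamma>Q[symmetric] by (simp add: ev_gt algebra_simps)
      hence "ac_eval r (R e) = r ^ (w * (p - 1 - j e) + w * j e) * (r ^ (i e * Q + l e) * (\<gamma> ^ Q) ^ j e)"
        by (simp add: R_def power_mult_distrib power_add power_mult del: ac_eval_simps(4))
      thus ?thesis by (simp only: sj)
    qed
    have TQ: "ac_eval r (T e) ^ Q = r ^ (s * (Q - 1)) * ac_eval r (R e)" for e
    proof -
      have QQ: "Q * Q = p ^ (2 * k)" by (simp add: Q_def mult_2 power_add)
      have "Q > 0" using p2 by (simp add: Q_def)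
      hence "Q = Suc (Q - 1)" by simp
      hence "s * Q = s * (Q - 1) + s" by (metis add.commute mult_Suc_right)
      hence 1: "(r ^ s) ^ Q = r ^ (s * (Q - 1)) * r ^ s" by (simp flip: power_mult power_add)
      have "(r ^ (i e + l e * Q)) ^ Q = r ^ (i e * Q) * (r ^ (Q * Q)) ^ l e"
        by (simp add: distrib_right flip: power_mult power_add) (simp add: mult_ac)
      also have "r ^ (Q * Q) = r" unfolding QQ by (rule r(3))
      finally have 2: "(r ^ (i e + l e * Q)) ^ Q = r ^ (i e * Q + l e)" by (simp add: power_add)
      have 3: "(\<gamma> ^ j e) ^ Q = (\<gamma> ^ Q) ^ j e" by (simp add: mult.commute flip: power_mult)
      show ?thesis unfolding evT evR power_mult_distrib 1 2 3 by (simp add: mult.assoc)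
    qed
    have fro: "to_ac d ^ Q = to_ac d" for d :: "'a mod_ring"
      unfolding Q_def p_def by (rule to_ac_frobenius)
    have "ac_eval r G ^ Q = (\<Sum>e<N. (to_ac (D e) * ac_eval r (T e)) ^ Q)"
      unfolding G_def ac_eval_sum Q_def p_def frobenius_sum by simp
    also have "\<dots> = (\<Sum>e<N. r ^ (s * (Q - 1)) * (to_ac (D e) * ac_eval r (R e)))"
      by (intro sum.cong refl)
         (simp add: power_mult_distrib TQ fro)
    also have "\<dots> = r ^ (s * (Q - 1)) * ac_eval r (\<Sum>e<N. smult (D e) (R e))"
      by (simp add: ac_eval_sum sum_distrib_left)
    also have "\<dots> = 0" unfolding D(2) by simp
    finally have "ac_eval r G = 0" by simp
    moreover have "irreducible f" using f Z(2) by (auto simp: irred_monics_def)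
    ultimately show ?thesis using ac_root_dvd r(1) by blast
  qed
  have "(\<Sum>f\<in>Z. degree f) \<le> degree G"
    using Z dvd G0 by (intro sum_degree_irred_le)
  also have "\<dots> \<le> N + Q" using degG p2 by (simp add: Qw algebra_simps diff_mult_distrib2)
  also have "N + Q = Q * (w + 5)" by (simp add: N_def M_def algebra_simps)
  finally show ?thesis by (simp add: Q_def w_def p_def)
qed

section \<open>The Weil bound for Kloosterman sums over prime fields\<close>

text \<open>
  Let \<open>N c\<close> count the elements with trace \<open>c\<close>. By \<open>stepanov_bound\<close> all \<open>U - N c\<close> are nonnegative,
  and their sum is only \<open>5 p p\<^sup>k + 1\<close>; so the character sum, which does not see the constant \<open>U\<close>, is no larger.
\<close>

lemma norm_mangoldt_kloo_le:
  fixes a b :: "'a :: prime_card mod_ring"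
  assumes a: "a \<noteq> 0" and k: "k > 0"
  shows "norm (mangoldt_sum (kloo_char a b) (2 * k)) \<le> 6 * real CARD('a) * real CARD('a) ^ k"
proof -
  define p where "p = CARD('a)"
  define I where "I = (prime_power_index (2 * k) :: ('a mod_ring poly \<times> nat) set)"
  define t where "t x = of_nat (snd x) * hyptrace a b (fst x)" for x :: "'a mod_ring poly \<times> nat"
  define N where "N c = (\<Sum>x\<in>{x\<in>I. t x = c}. degree (fst x))" for c
  define U where "U = p ^ k * (p ^ (k - 1) + 5)"
  have finI: "finite I" unfolding I_def using k by (intro finite_prime_power_index) auto
  have I: "f \<in> irred_monics" "j * degree f = 2 * k" "irreducible f" "degree f > 0" if "(f, j) \<in> I" for f j
    using that by (auto simp: I_def prime_power_index_def irred_monics_def irreducible_degree_pos)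
  have N_le: "N c \<le> U" for c
  proof -
    have inj: "inj_on fst {x\<in>I. t x = c}"
    proof (rule inj_onI)
      fix x y assume xy: "x \<in> {x\<in>I. t x = c}" "y \<in> {x\<in>I. t x = c}" "fst x = fst y"
      have "(fst x, snd x) \<in> I" "(fst y, snd y) \<in> I" using xy(1,2) by (simp_all only: mem_Collect_eq prod.collapse)
      hence "snd x * degree (fst x) = snd y * degree (fst x)" "degree (fst x) > 0"
        using I xy(3) by metis+
      hence "snd x = snd y" by simp
      thus "x = y" using xy(3) by (simp add: prod_eq_iff)
    qed
    have "N c = (\<Sum>f\<in>fst ` {x\<in>I. t x = c}. degree f)"
      unfolding N_def by (subst sum.reindex[OF inj]) simp
    also have "\<dots> \<le> CARD('a) ^ k * (CARD('a) ^ (k - 1) + 5)"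
    proof (rule stepanov_bound[OF a k])
      show "finite (fst ` {x\<in>I. t x = c})" using finI by auto
      show "fst ` {x\<in>I. t x = c} \<subseteq> irred_monics" using I by auto
    next
      fix f assume "f \<in> fst ` {x\<in>I. t x = c}"
      then obtain j where fj: "(f, j) \<in> I" "t (f, j) = c" by auto
      note I = I[OF fj(1)]
      obtain r where r: "ac_eval r f = 0" using irreducible_has_ac_root[OF I(3)] .
      have fr: "r ^ (CARD('a) ^ degree f) = r" using ac_root_frobenius[OF I(3) r] .
      have "r ^ (CARD('a) ^ (2 * k)) = r" using ac_root_frobenius_mult[OF fr, of j] I(2) by simp
      moreover have "ac_trace a b (2 * k) r = to_ac c"
        using ac_trace_mult[OF fr, of a b j] ac_trace_degree(2)[OF I(1) r, of a b] I(2) fj(2)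
        by (simp add: t_def flip: to_ac_of_nat to_ac_mult)
      ultimately show "\<exists>r. ac_eval r f = 0 \<and> r \<noteq> 0 \<and> r ^ (CARD('a) ^ (2 * k)) = r \<and> ac_trace a b (2 * k) r = to_ac c"
        using r ac_trace_degree(1)[OF I(1) r] by blast
    qed
    finally show ?thesis by (simp add: U_def p_def)
  qed
  have sum_N: "(\<Sum>c\<in>UNIV. of_nat (N c)) = (of_nat p ^ (2 * k) - 1 :: complex)"
  proof -
    have "(\<Sum>c\<in>UNIV. of_nat (N c)) = (\<Sum>c\<in>UNIV. \<Sum>x\<in>{x\<in>I. t x = c}. of_nat (degree (fst x)) :: complex)"
      by (simp add: N_def)
    also have "\<dots> = (\<Sum>x\<in>I. of_nat (degree (fst x)))"
      using finI by (intro sum.group) auto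
    also have "\<dots> = mangoldt_sum (\<lambda>_ :: 'a mod_ring poly. 1) (2 * k)"
      by (simp add: mangoldt_sum_def I_def case_prod_unfold)
    also have "\<dots> = of_nat p ^ (2 * k) - 1" unfolding p_def using k by (intro mangoldt_trivial) auto
    finally show ?thesis .
  qed
  have "mangoldt_sum (kloo_char a b) (2 * k) = (\<Sum>x\<in>I. of_nat (degree (fst x)) * addchar (t x))"
    by (simp add: mangoldt_sum_def I_def case_prod_unfold kloo_char_def t_def addchar_of_nat_mult)
  also have "\<dots> = (\<Sum>c\<in>UNIV. \<Sum>x\<in>{x\<in>I. t x = c}. of_nat (degree (fst x)) * addchar (t x))"
    using finI by (intro sum.group[symmetric]) auto
  also have "\<dots> = (\<Sum>c\<in>UNIV. of_nat (N c) * addchar c)"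
    by (intro sum.cong refl) (simp add: N_def sum_distrib_right)
  also have "\<dots> = (\<Sum>c\<in>UNIV. of_nat U * addchar (c :: 'a mod_ring)) - (\<Sum>c\<in>UNIV. of_nat (U - N c) * addchar c)"
    using N_le by (simp add: of_nat_diff left_diff_distrib sum_subtractf)
  also have "(\<Sum>c\<in>UNIV. of_nat U * addchar (c :: 'a mod_ring)) = 0"
    using sum_addchar[of "1 :: 'a mod_ring"] by (simp flip: sum_distrib_left)
  finally have "norm (mangoldt_sum (kloo_char a b) (2 * k)) = norm (\<Sum>c\<in>UNIV. of_nat (U - N c) * addchar c)"
    by simp
  also have "\<dots> \<le> (\<Sum>c\<in>UNIV. norm (of_nat (U - N c) * addchar c))" by (rule norm_sum)
  also have "\<dots> = (\<Sum>c\<in>(UNIV :: 'a mod_ring set). real (U - N c))" by (simp add: norm_mult)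
  also have "\<dots> = real p * real U - (\<Sum>c\<in>UNIV. real (N c))"
    using N_le by (simp add: of_nat_diff sum_subtractf p_def)
  also have "(\<Sum>c\<in>UNIV. real (N c)) = real p ^ (2 * k) - 1"
    using arg_cong[OF sum_N, of Re] by simp
  also have "real p * real U - (real p ^ (2 * k) - 1) = 5 * real p * real p ^ k + 1"
  proof -
    obtain k' where "k = Suc k'" using k by (cases k) auto
    thus ?thesis by (simp add: U_def algebra_simps power_mult power2_eq_square flip: power_mult_distrib)
  qed
  also have "\<dots> \<le> 6 * real p * real p ^ k"
  proof -
    have "p \<ge> 1" by (simp add: p_def Suc_le_eq)
    hence "1 * 1 \<le> real p * real p ^ k" by (intro mult_mono) auto
    thus ?thesis by simp
  qed
  finally show ?thesis by (simp add: p_def)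
qed

lemma kloo_field_real: "kloo_field a b \<in> \<real>"
proof -
  have "cnj (kloo_field a b) = (\<Sum>r\<in>UNIV - {0}. addchar (- (a * r + b / r)))"
    by (simp add: kloo_field_def flip: addchar_minus)
  also have "\<dots> = (\<Sum>r\<in>UNIV - {0}. addchar (a * r + b / r))"
    by (rule sum.reindex_bij_witness[of _ uminus uminus]) (auto simp: algebra_simps)
  finally have "cnj (kloo_field a b) = kloo_field a b" by (simp only: kloo_field_def)
  thus ?thesis by (simp only: Reals_cnj_iff)
qed

text \<open>
  If \<open>K\<^sup>2 > 4 p\<close>, the reciprocal roots \<open>\<alpha>\<close>, \<open>\<beta>\<close> of the L-function are real, the larger of \<open>\<alpha>\<^sup>2\<close>, \<open>\<beta>\<^sup>2\<close> exceeds \<open>p\<close>, and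
  \<open>\<alpha>\<^sup>2\<^sup>k + \<beta>\<^sup>2\<^sup>k\<close>, where nothing cancels, outgrows the bound of \<open>norm_mangoldt_kloo_le\<close>.
\<close>

theorem weil_bound_field_nonzero:
  fixes a b :: "'a :: prime_card mod_ring"
  assumes ab: "a \<noteq> 0" "b \<noteq> 0"
  shows "norm (kloo_field a b) \<le> 2 * sqrt (real CARD('a))"
proof (rule ccontr)
  define p where "p = real CARD('a)"
  have p: "p > 0" by (simp add: p_def)
  obtain \<kappa> where \<kappa>: "kloo_field a b = of_real \<kappa>" using kloo_field_real[of a b] by (auto simp: Reals_def)
  define L where "L = mangoldt_sum (kloo_char a b)"
  note rec = mangoldt_kloo_recurrence[OF ab, folded L_def, unfolded \<kappa>]
  assume "\<not> ?thesis"
  hence "\<bar>\<kappa>\<bar> > 2 * sqrt p" by (simp add: \<kappa> p_def)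
  hence "\<bar>\<kappa>\<bar> ^ 2 > (2 * sqrt p) ^ 2" using p by (intro power_strict_mono) auto
  hence \<kappa>2: "\<kappa> ^ 2 > 4 * p" using p by (simp add: power_mult_distrib)
  define \<delta> where "\<delta> = sqrt (\<kappa> ^ 2 - 4 * p)"
  have \<delta>: "\<delta> ^ 2 = \<kappa> ^ 2 - 4 * p" using \<kappa>2 by (simp add: \<delta>_def)
  define \<alpha> where "\<alpha> = (- \<kappa> + \<delta>) / 2"
  define \<beta> where "\<beta> = (- \<kappa> - \<delta>) / 2"
  have sum: "\<alpha> + \<beta> = - \<kappa>" by (simp add: \<alpha>_def \<beta>_def field_simps)
  have prod: "\<alpha> * \<beta> = p" using \<delta> by (simp add: \<alpha>_def \<beta>_def field_simps power2_eq_square)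
  have L: "L n = - of_real (\<alpha> ^ n + \<beta> ^ n)" if "n > 0" for n
    using that
  proof (induction n rule: less_induct)
    case (less n)
    consider "n = 1" | "n = 2" | "n \<ge> 3" using less.prems by linarith
    thus ?case
    proof cases
      case 1
      thus ?thesis using rec(1) sum by simp
    next
      case 2
      have "\<alpha> ^ 2 + \<beta> ^ 2 = (\<alpha> + \<beta>) ^ 2 - 2 * (\<alpha> * \<beta>)" by (simp add: power2_eq_square algebra_simps)
      hence "- (\<alpha> ^ 2 + \<beta> ^ 2) = 2 * p - \<kappa> ^ 2" unfolding sum prod by simp
      hence "- of_real (\<alpha> ^ 2 + \<beta> ^ 2) = (of_real (2 * p - \<kappa> ^ 2) :: complex)"
        by (metis of_real_minus)
      thus ?thesis using rec(2) 2 by (simp add: p_def)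
    next
      case 3
      then obtain m where m: "n = Suc (Suc m)" "m > 0" by (cases n; cases "n - 1") auto
      have "\<alpha> ^ n + \<beta> ^ n = (\<alpha> + \<beta>) * (\<alpha> ^ Suc m + \<beta> ^ Suc m) - \<alpha> * \<beta> * (\<alpha> ^ m + \<beta> ^ m)"
        by (simp add: m algebra_simps)
      hence eq: "- (\<alpha> ^ n + \<beta> ^ n) = - \<kappa> * (- (\<alpha> ^ Suc m + \<beta> ^ Suc m)) - p * (- (\<alpha> ^ m + \<beta> ^ m))"
        unfolding sum prod by (simp add: algebra_simps)
      have "L n = - of_real \<kappa> * L (n - 1) - of_nat CARD('a) * L (n - 2)" by (rule rec(3)[OF 3])
      also have "\<dots> = of_real (- \<kappa> * (- (\<alpha> ^ Suc m + \<beta> ^ Suc m)) - p * (- (\<alpha> ^ m + \<beta> ^ m)))"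
        using less.IH[of "Suc m"] less.IH[of m] m by (simp add: p_def)
      finally show ?thesis unfolding eq[symmetric] by simp
    qed
  qed
  define x where "x = max (\<alpha> ^ 2) (\<beta> ^ 2)"
  have "\<alpha> ^ 2 + \<beta> ^ 2 = (\<alpha> + \<beta>) ^ 2 - 2 * (\<alpha> * \<beta>)" by (simp add: power2_eq_square algebra_simps)
  hence "\<alpha> ^ 2 + \<beta> ^ 2 > 2 * p" unfolding sum prod using \<kappa>2 by simp
  hence x: "x > p" by (auto simp: x_def)
  have bound: "(x / p) ^ k \<le> 6 * p" for k
  proof (cases "k = 0")
    case True
    have "p \<ge> 1" by (simp add: p_def Suc_le_eq)
    thus ?thesis using True by simp
  next
    case False
    have "x ^ k \<le> (\<alpha> ^ 2) ^ k + (\<beta> ^ 2) ^ k" by (auto simp: x_def max_def)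
    also have "\<dots> = \<bar>\<alpha> ^ (2 * k) + \<beta> ^ (2 * k)\<bar>" by (simp add: power_mult)
    also have "\<dots> = norm (L (2 * k))"
      using L[of "2 * k"] False by (simp only: norm_minus_cancel norm_of_real)
    also have "\<dots> \<le> 6 * p * p ^ k"
      unfolding L_def p_def using False by (intro norm_mangoldt_kloo_le ab) auto
    finally show ?thesis using p by (simp add: power_divide field_simps)
  qed
  obtain k where "(x / p) ^ k > 6 * p" using real_arch_pow[of "x / p"] x p by auto
  thus False using bound[of k] by simp
qed

lemma kloo_field_0_right:
  assumes "(a :: 'a :: prime_card mod_ring) \<noteq> 0"
  shows "kloo_field a 0 = - 1"
proof -
  have "kloo_field a 0 = (\<Sum>r\<in>UNIV - {0}. addchar (r * a))"
    by (simp add: kloo_field_def mult.commute)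
  also have "\<dots> = (\<Sum>r\<in>UNIV. addchar (r * a)) - addchar (0 * a)"
    by (subst sum.remove[of UNIV "0 :: 'a mod_ring"]) auto
  also have "\<dots> = - 1" using assms by (simp only: sum_addchar) simp
  finally show ?thesis .
qed

lemma kloo_field_commute: "kloo_field a b = kloo_field b a"
  unfolding kloo_field_def
  by (rule sum.reindex_bij_witness[of _ inverse inverse]) (auto simp: divide_inverse add.commute)

theorem weil_bound_field:
  fixes a b :: "'a :: prime_card mod_ring"
  assumes "a \<noteq> 0 \<or> b \<noteq> 0"
  shows "norm (kloo_field a b) \<le> 2 * sqrt (real CARD('a))"
proof -
  have "sqrt 1 \<le> sqrt (real CARD('a))" by (intro real_sqrt_le_mono) (simp add: Suc_le_eq)
  hence "1 \<le> 2 * sqrt (real CARD('a))" unfolding real_sqrt_one by linarith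
  thus ?thesis using assms weil_bound_field_nonzero[of a b]
    by (cases "a = 0"; cases "b = 0") (simp_all add: kloo_field_0_right kloo_field_commute[of 0 b])
qed

section \<open>Kloosterman sums over the integers\<close>

definition hyperbola :: "nat \<Rightarrow> int \<Rightarrow> (int \<times> int) set" where
  "hyperbola m a = {(x, y). x \<in> {0..<int m} \<and> y \<in> {0..<int m} \<and> [x * y = a] (mod int m)}"

definition kloo :: "nat \<Rightarrow> int \<Rightarrow> int \<Rightarrow> int \<Rightarrow> complex" where
  "kloo m a h k = (\<Sum>(x, y)\<in>hyperbola m a. ee (of_int (h * x + k * y) / real m))"

lemma of_int_mod_ring_eq_iff:
  "(of_int x :: 'a :: prime_card mod_ring) = of_int y \<longleftrightarrow> [x = y] (mod int CARD('a))"
proof -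
  have "(of_int x :: 'a mod_ring) = of_int y \<longleftrightarrow> to_int_mod_ring (of_int x :: 'a mod_ring) = to_int_mod_ring (of_int y :: 'a mod_ring)"
    by (metis of_int_mod_ring_to_int_mod_ring)
  thus ?thesis
    by (simp add: of_int_of_int_mod_ring of_int_mod_ring.rep_eq to_int_mod_ring.rep_eq Cong.cong_def)
qed

lemma coprime_imp_not_prime_dvd:
  fixes a q :: int
  assumes "coprime a q" "prime q"
  shows "\<not> q dvd a"
  using assms by (meson coprime_common_divisor dvd_refl not_prime_unit)

text \<open>
  The second coordinate of a point is \<open>a / r\<close>, where \<open>r\<close> is the first.
\<close>

lemma kloo_eq_kloo_field:
  assumes "coprime a (int CARD('a :: prime_card))"
  shows "kloo CARD('a) a h k = kloo_field (of_int h :: 'a mod_ring) (of_int (k * a))"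
proof -
  let ?of = "of_int :: int \<Rightarrow> 'a mod_ring" and ?to = "to_int_mod_ring :: 'a mod_ring \<Rightarrow> int"
  have of_to: "?of (?to r) = r" for r by (simp add: of_int_of_int_mod_ring)
  have to_range: "?to r \<in> {0..<int CARD('a)}" for r
    using range_to_int_mod_ring[where 'a = 'a] by blast
  have to_of: "?to (?of x) = x" if "x \<in> {0..<int CARD('a)}" for x
    using that by (simp add: of_int_of_int_mod_ring)
  have a0: "?of a \<noteq> 0"
  proof
    assume "?of a = 0"
    hence "int CARD('a) dvd a" using of_int_mod_ring_eq_iff[of a 0, where 'a = 'a] by (simp add: cong_0_iff)
    thus False using coprime_imp_not_prime_dvd[OF assms prime_card_int] by simp
  qed
  have hyp: "(x, y) \<in> hyperbola CARD('a) a \<longleftrightarrow>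
      x \<in> {0..<int CARD('a)} \<and> y \<in> {0..<int CARD('a)} \<and> ?of x * ?of y = ?of a" for x y
    using of_int_mod_ring_eq_iff[of "x * y" a, where 'a = 'a] by (simp add: hyperbola_def)
  show ?thesis unfolding kloo_def kloo_field_def
  proof (rule sum.reindex_bij_witness[of _ "\<lambda>r. (?to r, ?to (?of a / r))" "\<lambda>z. ?of (fst z)"])
    fix z assume z: "z \<in> hyperbola CARD('a) a"
    obtain x y where xy: "z = (x, y)" by (cases z)
    have *: "x \<in> {0..<int CARD('a)}" "y \<in> {0..<int CARD('a)}" "?of x * ?of y = ?of a"
      using z hyp xy by auto
    have x0: "?of x \<noteq> 0" using *(3) a0 by auto
    have y: "?of a / ?of x = ?of y" using *(3) x0 by (simp add: field_simps)
    show "(?to (?of (fst z)), ?to (?of a / ?of (fst z))) = z" using * y by (simp add: xy to_of)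
    show "?of (fst z) \<in> UNIV - {0}" using x0 xy by simp
    have "?of h * ?of x + ?of (k * a) / ?of x = ?of (h * x + k * y)"
      using y by (simp add: of_int_mult)  (metis times_divide_eq_right)
    thus "addchar (?of h * ?of (fst z) + ?of (k * a) / ?of (fst z)) =
        (case z of (x, y) \<Rightarrow> ee (of_int (h * x + k * y) / real CARD('a)))"
      using addchar_of_int[of "h * x + k * y", where 'a = 'a] by (simp add: xy)
  next
    fix r assume r: "r \<in> UNIV - {0 :: 'a mod_ring}"
    show "?of (fst (?to r, ?to (?of a / r))) = r" by (simp add: of_to)
    show "(?to r, ?to (?of a / r)) \<in> hyperbola CARD('a) a"
      unfolding hyp using r by (simp only: of_to to_range) simp
  qed
qed

section \<open>The Weil bound for all primes\<close>

definition weil_bound_at :: "nat \<Rightarrow> bool" where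
  "weil_bound_at p \<longleftrightarrow> (\<forall>a h k. coprime a (int p) \<longrightarrow> \<not> (int p dvd h \<and> int p dvd k) \<longrightarrow>
     norm (kloo p a h k) \<le> 2 * sqrt (real p))"

lemma weil_bound_at_card: "weil_bound_at CARD('a :: prime_card)"
  unfolding weil_bound_at_def
proof (intro allI impI)
  fix a h k assume *: "coprime a (int CARD('a))" "\<not> (int CARD('a) dvd h \<and> int CARD('a) dvd k)"
  have "\<not> int CARD('a) dvd a" by (rule coprime_imp_not_prime_dvd[OF *(1) prime_card_int])
  hence ka: "int CARD('a) dvd k * a \<longleftrightarrow> int CARD('a) dvd k"
    using prime_card_int[where 'a = 'a] by (simp add: prime_dvd_mult_iff)
  have z: "(of_int z :: 'a mod_ring) = 0 \<longleftrightarrow> int CARD('a) dvd z" for z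
    using of_int_mod_ring_eq_iff[of z 0, where 'a = 'a] by (simp only: of_int_0 cong_0_iff)
  have "(of_int h :: 'a mod_ring) \<noteq> 0 \<or> (of_int (k * a) :: 'a mod_ring) \<noteq> 0"
    unfolding z ka using *(2) by (simp only: de_Morgan_conj)
  thus "norm (kloo CARD('a) a h k) \<le> 2 * sqrt (real CARD('a))"
    unfolding kloo_eq_kloo_field[OF *(1)] by (rule weil_bound_field)
qed

text \<open>
  The field with \<open>p\<close> elements is a type, so the bound proved so far speaks of cardinalities of types and
  cannot be instantiated with a variable \<open>p\<close>. One type is enough: its cardinality is chosen as
  a prime that violates the bound, if there is such a prime. As the bound does hold for this type, there is none.
\<close>

definition critical_prime :: nat where
  "critical_prime = (SOME p. prime p \<and> (weil_bound_at p \<longrightarrow> (\<forall>q. prime q \<longrightarrow> weil_bound_at q)))"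

lemma critical_prime: "prime critical_prime"
  "weil_bound_at critical_prime \<Longrightarrow> prime q \<Longrightarrow> weil_bound_at q"
proof -
  have "\<exists>p :: nat. prime p \<and> (weil_bound_at p \<longrightarrow> (\<forall>q. prime q \<longrightarrow> weil_bound_at q))"
  proof (cases "\<exists>p. prime p \<and> \<not> weil_bound_at p")
    case False
    hence "\<forall>q. prime q \<longrightarrow> weil_bound_at q" by simp
    thus ?thesis by (intro exI[of _ 2]) (simp only: two_is_prime_nat simp_thms)
  next
    case True
    then obtain p where "prime p" "\<not> weil_bound_at p" by blast
    thus ?thesis by (intro exI[of _ p]) (simp only: simp_thms)
  qed
  from someI_ex[OF this] show "prime critical_prime"
    "weil_bound_at critical_prime \<Longrightarrow> prime q \<Longrightarrow> weil_bound_at q"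
    unfolding critical_prime_def by blast+
qed

typedef critical_residue = "{..<critical_prime}"
  using critical_prime(1) prime_gt_0_nat by blast

lemma card_critical_residue: "CARD(critical_residue) = critical_prime"
  using type_definition.card[OF type_definition_critical_residue] by simp

instance critical_residue :: prime_card
  by standard (simp add: card_critical_residue critical_prime)

theorem weil_bound: "prime p \<Longrightarrow> weil_bound_at p"
  using weil_bound_at_card[where 'a = critical_residue]
  unfolding card_critical_residue by (rule critical_prime(2))

section \<open>Twisted multiplicativity\<close>

lemma hyperbola_mod_mem:
  assumes "m > 0" "[x * y = a] (mod int m)"
  shows "(x mod int m, y mod int m) \<in> hyperbola m a"
  using assms by (simp add: hyperbola_def Cong.cong_def mod_mult_eq)

lemma finite_hyperbola [simp]: "finite (hyperbola m a)"
  by (rule finite_subset[of _ "{0..<int m} \<times> {0..<int m}"]) (auto simp: hyperbola_def)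

lemma mod_eqI:
  assumes "[x = y] (mod int m)" "y \<in> {0..<int m}"
  shows "x mod int m = y"
  using assms by (simp add: Cong.cong_def)

text \<open>
  Write \<open>x = x\<^sub>1 m\<^sub>2 + x\<^sub>2 m\<^sub>1\<close> and likewise \<open>y\<close>; the phase then splits, and \<open>a\<close> is divided by \<open>m\<^sub>2\<^sup>2\<close>
  modulo \<open>m\<^sub>1\<close> and by \<open>m\<^sub>1\<^sup>2\<close> modulo \<open>m\<^sub>2\<close>. The frequencies stay the same, and so do their gcds.
\<close>

lemma kloo_mult:
  fixes a h k :: int
  assumes m: "m1 > 0" "m2 > 0" "coprime m1 m2" and a: "coprime a (int (m1 * m2))"
  obtains a1 a2 where "coprime a1 (int m1)" "coprime a2 (int m2)"
    "kloo (m1 * m2) a h k = kloo m1 a1 h k * kloo m2 a2 h k"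
proof -
  let ?M = "m1 * m2"
  have cop: "coprime (int m1) (int m2)" using m(3) by simp
  have cop': "coprime (int m2) (int m1)" using cop by (metis coprime_iff_gcd_eq_1 gcd.commute)
  obtain n2 where n2: "[int m2 * n2 = 1] (mod int m1)" using cong_solve_coprime_int[OF cop'] by blast
  obtain n1 where n1: "[int m1 * n1 = 1] (mod int m2)" using cong_solve_coprime_int[OF cop] by blast
  define a1 where "a1 = a * n2 ^ 2"
  define a2 where "a2 = a * n1 ^ 2"
  have cn: "coprime n2 (int m1)" "coprime n1 (int m2)"
    using n1 n2 by (metis cong_imp_coprime cong_sym coprime_1_left coprime_mult_left_iff)+
  have ca: "coprime a1 (int m1)" "coprime a2 (int m2)"
    using a cn by (auto simp: a1_def a2_def)
  define \<phi> where "\<phi> = (\<lambda>((x1 :: int, y1 :: int), (x2 :: int, y2 :: int)).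
     ((x1 * m2 + x2 * m1) mod ?M, (y1 * m2 + y2 * m1) mod ?M))"
  define \<psi> where "\<psi> = (\<lambda>(x :: int, y :: int).
     ((x * n2 mod m1, y * n2 mod m1), (x * n1 mod m2, y * n1 mod m2)))"
  have cong_split: "[u = v] (mod int ?M) \<longleftrightarrow> [u = v] (mod int m1) \<and> [u = v] (mod int m2)" for u v
  proof
    assume "[u = v] (mod int m1) \<and> [u = v] (mod int m2)"
    thus "[u = v] (mod int ?M)" using coprime_cong_mult[of u v "int m1" "int m2"] cop by simp
  next
    assume "[u = v] (mod int ?M)"
    thus "[u = v] (mod int m1) \<and> [u = v] (mod int m2)"
      by (metis cong_modulus_mult cong_modulus_mult mult.commute of_nat_mult)
  qed
  have e1: "[(x1 * m2 + x2 * m1) mod ?M = x1 * m2] (mod int m1)" for x1 x2 :: int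
    using cong_split[of "(x1 * m2 + x2 * m1) mod ?M" "x1 * m2 + x2 * m1"]
    by (simp add: Cong.cong_def)
  have e2: "[(x1 * m2 + x2 * m1) mod ?M = x2 * m1] (mod int m2)" for x1 x2 :: int
    using cong_split[of "(x1 * m2 + x2 * m1) mod ?M" "x1 * m2 + x2 * m1"]
    by (simp add: Cong.cong_def)
  have f1: "[x * int m2 * n2 = x] (mod int m1)" for x
    using cong_mult[OF cong_refl[of x] n2] by (simp add: mult.assoc)
  have f2: "[x * int m1 * n1 = x] (mod int m2)" for x
    using cong_mult[OF cong_refl[of x] n1] by (simp add: mult.assoc)
  have "kloo m1 a1 h k * kloo m2 a2 h k =
    (\<Sum>(z1, z2)\<in>hyperbola m1 a1 \<times> hyperbola m2 a2.
       (case z1 of (x, y) \<Rightarrow> ee (of_int (h * x + k * y) / real m1)) *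
       (case z2 of (x, y) \<Rightarrow> ee (of_int (h * x + k * y) / real m2)))"
    unfolding kloo_def by (simp add: sum_product sum.cartesian_product)
  also have "\<dots> = (\<Sum>(x, y)\<in>hyperbola ?M a. ee (of_int (h * x + k * y) / real ?M))"
  proof (rule sum.reindex_bij_witness[of _ \<psi> \<phi>])
    fix z assume z: "z \<in> hyperbola m1 a1 \<times> hyperbola m2 a2"
    obtain x1 y1 x2 y2 where zz: "z = ((x1, y1), (x2, y2))" by (metis surj_pair)
    have r: "x1 \<in> {0..<int m1}" "y1 \<in> {0..<int m1}" "x2 \<in> {0..<int m2}" "y2 \<in> {0..<int m2}"
      and c: "[x1 * y1 = a1] (mod int m1)" "[x2 * y2 = a2] (mod int m2)"
      using z by (auto simp: zz hyperbola_def)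
    define x where "x = (x1 * m2 + x2 * m1) mod ?M"
    define y where "y = (y1 * m2 + y2 * m1) mod ?M"
    have \<phi>z: "\<phi> z = (x, y)" by (simp add: \<phi>_def zz x_def y_def)
    have "[x * n2 = x1] (mod int m1)" "[y * n2 = y1] (mod int m1)"
      "[x * n1 = x2] (mod int m2)" "[y * n1 = y2] (mod int m2)"
      unfolding x_def y_def
      using cong_trans[OF cong_mult[OF e1 cong_refl] f1] cong_trans[OF cong_mult[OF e2 cong_refl] f2] by auto
    hence "\<psi> (x, y) = z" unfolding \<psi>_def prod.case zz using r by (simp only: mod_eqI)
    thus "\<psi> (\<phi> z) = z" by (simp only: \<phi>z)
    have "[x * y = (x1 * m2) * (y1 * m2)] (mod int m1)"
      unfolding x_def y_def by (intro cong_mult e1)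
    also have "(x1 * m2) * (y1 * m2) = (x1 * y1) * (int m2 ^ 2)" by (simp add: power2_eq_square)
    also have "[\<dots> = a1 * (int m2 ^ 2)] (mod int m1)" using c(1) by (intro cong_mult) auto
    also have "a1 * (int m2 ^ 2) = (a * (int m2 * n2)) * (int m2 * n2)" by (simp add: a1_def power2_eq_square)
    also have "[\<dots> = (a * 1) * 1] (mod int m1)" by (intro cong_mult n2 cong_refl)
    finally have 1: "[x * y = a] (mod int m1)" by simp
    have "[x * y = (x2 * m1) * (y2 * m1)] (mod int m2)"
      unfolding x_def y_def by (intro cong_mult e2)
    also have "(x2 * m1) * (y2 * m1) = (x2 * y2) * (int m1 ^ 2)" by (simp add: power2_eq_square)
    also have "[\<dots> = a2 * (int m1 ^ 2)] (mod int m2)" using c(2) by (intro cong_mult) auto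
    also have "a2 * (int m1 ^ 2) = (a * (int m1 * n1)) * (int m1 * n1)" by (simp add: a2_def power2_eq_square)
    also have "[\<dots> = (a * 1) * 1] (mod int m2)" by (intro cong_mult n1 cong_refl)
    finally have 2: "[x * y = a] (mod int m2)" by simp
    have "x \<in> {0..<int ?M}" "y \<in> {0..<int ?M}" using m by (auto simp: x_def y_def)
    thus "\<phi> z \<in> hyperbola ?M a" using 1 2 cong_split unfolding \<phi>z hyperbola_def by auto
    have "[h * x + k * y = h * (x1 * m2 + x2 * m1) + k * (y1 * m2 + y2 * m1)] (mod int ?M)"
      unfolding x_def y_def by (intro cong_add cong_mult cong_refl) (simp_all add: Cong.cong_def)
    hence "ee (of_int (h * x + k * y) / real ?M) =
        ee (of_int (h * (x1 * m2 + x2 * m1) + k * (y1 * m2 + y2 * m1)) / real ?M)"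
      using m by (intro ee_int_cong) auto
    also have "of_int (h * (x1 * m2 + x2 * m1) + k * (y1 * m2 + y2 * m1)) / real ?M =
        of_int (h * x1 + k * y1) / real m1 + of_int (h * x2 + k * y2) / real m2"
      using m by (simp add: field_simps)
    finally show "(case \<phi> z of (x, y) \<Rightarrow> ee (of_int (h * x + k * y) / real ?M)) =
        (case z of (z1, z2) \<Rightarrow> (case z1 of (x, y) \<Rightarrow> ee (of_int (h * x + k * y) / real m1)) *
       (case z2 of (x, y) \<Rightarrow> ee (of_int (h * x + k * y) / real m2)))"
      by (simp only: \<phi>z) (simp only: zz prod.case ee_add)
  next
    fix z assume z: "z \<in> hyperbola ?M a"
    obtain x y where zz: "z = (x, y)" by (cases z)
    have r: "x \<in> {0..<int ?M}" "y \<in> {0..<int ?M}" and c: "[x * y = a] (mod int ?M)"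
      using z by (auto simp: zz hyperbola_def)
    have rec: "[(x * n2 mod m1) * m2 + (x * n1 mod m2) * m1 = x] (mod int ?M)" for x :: int
    proof -
      have "[(x * n2 mod m1) * m2 + (x * n1 mod m2) * m1 = (x * n2) * m2 + 0] (mod int m1)"
        by (intro cong_add cong_mult cong_refl) (simp_all add: Cong.cong_def)
      hence "[(x * n2 mod m1) * m2 + (x * n1 mod m2) * m1 = x] (mod int m1)"
        using cong_trans f1[of x] by (simp add: mult_ac) blast
      moreover have "[(x * n2 mod m1) * m2 + (x * n1 mod m2) * m1 = 0 + (x * n1) * m1] (mod int m2)"
        by (intro cong_add cong_mult cong_refl) (simp_all add: Cong.cong_def)
      hence "[(x * n2 mod m1) * m2 + (x * n1 mod m2) * m1 = x] (mod int m2)"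
        using cong_trans f2[of x] by (simp add: mult_ac) blast
      ultimately show ?thesis using cong_split by blast
    qed
    show "\<phi> (\<psi> z) = z" unfolding \<phi>_def \<psi>_def zz prod.case
      by (simp only: mod_eqI[OF rec r(1)] mod_eqI[OF rec r(2)])
    have "[(x * n2) * (y * n2) = a1] (mod int m1)" "[(x * n1) * (y * n1) = a2] (mod int m2)"
    proof -
      have c': "[x * y = a] (mod int m1)" "[x * y = a] (mod int m2)" using c cong_split by auto
      show "[(x * n2) * (y * n2) = a1] (mod int m1)"
        using cong_mult[OF c'(1) cong_refl[of "n2 ^ 2"]] by (simp add: a1_def power2_eq_square mult_ac)
      show "[(x * n1) * (y * n1) = a2] (mod int m2)"
        using cong_mult[OF c'(2) cong_refl[of "n1 ^ 2"]] by (simp add: a2_def power2_eq_square mult_ac)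
    qed
    thus "\<psi> z \<in> hyperbola m1 a1 \<times> hyperbola m2 a2"
      using m hyperbola_mod_mem unfolding \<psi>_def zz by auto
  qed
  finally have "kloo ?M a h k = kloo m1 a1 h k * kloo m2 a2 h k" by (simp add: kloo_def)
  thus ?thesis using that ca by blast
qed

lemma hyperbola_coprime:
  assumes "(x, y) \<in> hyperbola m a" "coprime a (int m)"
  shows "coprime x (int m)" "coprime y (int m)"
proof -
  have "[a = x * y] (mod int m)" using assms(1) by (auto simp: hyperbola_def cong_sym)
  hence "coprime (x * y) (int m)" using assms(2) cong_imp_coprime by blast
  thus "coprime x (int m)" "coprime y (int m)" by auto
qed

lemma hyperbola_unique:
  assumes "(x, y) \<in> hyperbola m a" "(x, y') \<in> hyperbola m a" "coprime a (int m)"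
  shows "y = y'"
proof -
  have "[x * y = x * y'] (mod int m)" using assms(1,2)
    by (auto simp: hyperbola_def intro: cong_trans cong_sym)
  hence "[y = y'] (mod int m)"
    using hyperbola_coprime[OF assms(1,3)] by (simp add: cong_mult_lcancel)
  thus "y = y'" using assms(1,2) by (auto simp: hyperbola_def Cong.cong_def)
qed

lemma sum_permute_finite:
  assumes "finite A" "\<And>z. z \<in> A \<Longrightarrow> \<tau> z \<in> A" "inj_on \<tau> A"
  shows "(\<Sum>z\<in>A. f (\<tau> z)) = (\<Sum>z\<in>A. f z)"
proof -
  have "\<tau> ` A = A" using assms by (intro endo_inj_surj) auto
  thus ?thesis using sum.reindex[OF assms(3), of f] by simp
qed

section \<open>Counting in residue classes and Gauss sums\<close>

lemma card_residue_class:
  assumes "D > 0"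
  shows "card {x \<in> {0..<int (D * E)}. int D dvd x - c} = E"
proof -
  have "bij_betw (\<lambda>q. c mod int D + int D * q) {0..<int E} {x \<in> {0..<int (D * E)}. int D dvd x - c}"
  proof (rule bij_betw_byWitness[where f' = "\<lambda>x. x div int D"])
    show "\<forall>q\<in>{0..<int E}. (c mod int D + int D * q) div int D = q" using assms by auto
    show "\<forall>x\<in>{x \<in> {0..<int (D * E)}. int D dvd x - c}. c mod int D + int D * (x div int D) = x"
    proof
      fix x assume "x \<in> {x \<in> {0..<int (D * E)}. int D dvd x - c}"
      hence "x mod int D = c mod int D" by (auto simp: mod_eq_dvd_iff)
      thus "c mod int D + int D * (x div int D) = x" by (metis mod_mult_div_eq)
    qed
    show "(\<lambda>q. c mod int D + int D * q) ` {0..<int E} \<subseteq> {x \<in> {0..<int (D * E)}. int D dvd x - c}"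
    proof
      fix x assume "x \<in> (\<lambda>q. c mod int D + int D * q) ` {0..<int E}"
      then obtain q where q': "x = c mod int D + int D * q" "q \<in> {0..<int E}" by blast
      hence q: "x = c mod int D + int D * q" "0 \<le> q" "q \<le> int E - 1" by auto
      have "int D * q \<le> int D * (int E - 1)" using q assms by (intro mult_left_mono) auto
      moreover have "c mod int D < int D" "c mod int D \<ge> 0" using assms by auto
      moreover have "int D * q \<ge> 0" using q by simp
      ultimately have "0 \<le> x" "x < int (D * E)" using q by (auto simp: algebra_simps)
      moreover have "x mod int D = c mod int D" unfolding q(1) by simp
      ultimately show "x \<in> {x \<in> {0..<int (D * E)}. int D dvd x - c}" by (auto simp: mod_eq_dvd_iff)
    qed
    show "(\<lambda>x. x div int D) ` {x \<in> {0..<int (D * E)}. int D dvd x - c} \<subseteq> {0..<int E}"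
    proof
      fix q assume "q \<in> (\<lambda>x. x div int D) ` {x \<in> {0..<int (D * E)}. int D dvd x - c}"
      then obtain x where x: "q = x div int D" "0 \<le> x" "x < int D * int E" by auto
      have "\<not> int E \<le> q"
      proof
        assume "int E \<le> q"
        hence "int D * int E \<le> int D * q" by (intro mult_left_mono) auto
        also have "\<dots> \<le> x" unfolding x(1) using x(2) assms
          by (metis mult.commute div_mult_mod_eq le_add_same_cancel1 of_nat_0_less_iff pos_mod_sign)
        finally show False using x(3) by simp
      qed
      moreover have "q \<ge> 0" using x assms by (simp add: pos_imp_zdiv_nonneg_iff)
      ultimately show "q \<in> {0..<int E}" by simp
    qed
  qed
  from bij_betw_same_card[OF this] show ?thesis by simp
qed

lemma bij_betw_shift_mod:
  assumes "P > 0"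
  shows "bij_betw (\<lambda>t. (t + c) mod int P) {0..<int P} {0..<int P}"
proof (rule bij_betw_byWitness[where f' = "\<lambda>t. (t - c) mod int P"])
  show "\<forall>t\<in>{0..<int P}. ((t + c) mod int P - c) mod int P = t"
    by (simp add: mod_diff_left_eq)
  show "\<forall>t\<in>{0..<int P}. ((t - c) mod int P + c) mod int P = t"
    by (simp add: mod_add_left_eq)
qed (use assms in auto)

lemma sum_ee:
  assumes "P > 0"
  shows "(\<Sum>t\<in>{0..<int P}. ee (of_int (w * t) / real P)) = (if int P dvd w then of_nat P else 0)"
proof (cases "int P dvd w")
  case True
  have "ee (of_int (w * t) / real P) = 1" for t
    using ee_int_cong[of "w * t" 0 P] True assms by (simp add: cong_0_iff)
  thus ?thesis using True by simp
next
  case False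
  have "(\<Sum>t\<in>{0..<int P}. ee (of_int (w * t) / real P)) = 0"
  proof (rule sum_shift_invariant_0[where \<omega> = "ee (of_int w / real P)"])
    show "bij_betw (\<lambda>t. (t + 1) mod int P) {0..<int P} {0..<int P}"
      using assms by (rule bij_betw_shift_mod)
  next
    fix t :: int
    have "[w * ((t + 1) mod int P) = w * (t + 1)] (mod int P)"
      by (intro cong_mult) (simp_all add: Cong.cong_def)
    hence "ee (of_int (w * ((t + 1) mod int P)) / real P) = ee (of_int (w * (t + 1)) / real P)"
      using assms by (rule ee_int_cong)
    also have "of_int (w * (t + 1)) / real P = of_int w / real P + of_int (w * t) / real P"
      by (simp add: algebra_simps add_divide_distrib)
    finally show "ee (of_int (w * ((t + 1) mod int P)) / real P) = ee (of_int w / real P) * ee (of_int (w * t) / real P)"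
      by (simp only: ee_add)
  next
    show "ee (of_int w / real P) \<noteq> 1"
    proof
      assume "ee (of_int w / real P) = 1"
      then obtain q :: int where "of_int w / real P = of_int q" by (auto simp: ee_eq_1_iff elim: Ints_cases)
      hence "of_int w = (of_int (int P * q) :: real)" using assms by (simp add: field_simps)
      hence "w = int P * q" by linarith
      thus False using False by simp
    qed
  qed
  thus ?thesis using False by simp
qed

text \<open>
  Squaring and substituting \<open>t + d\<close> for one variable leaves a sum that is linear in \<open>t\<close>, with slope
  \<open>2 u d\<close>; only \<open>d = 0\<close> contributes.
\<close>

lemma norm_gauss_sum:
  assumes p: "prime p" "odd p" and u: "\<not> int p dvd u"
  shows "norm (\<Sum>t\<in>{0..<int p}. ee (of_int (z * t + u * t ^ 2) / real p)) = sqrt (real p)"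
proof -
  define F where "F t = ee (of_int (z * t + u * t ^ 2) / real p)" for t
  define G where "G = (\<Sum>t\<in>{0..<int p}. F t)"
  have p0: "p > 0" using p by (simp add: prime_gt_0_nat)
  have F_mod: "F (t mod int p) = F t" for t
    unfolding F_def using p0
    by (intro ee_int_cong cong_add cong_mult cong_pow cong_refl) (simp_all add: Cong.cong_def)
  have shift: "(\<Sum>d\<in>{0..<int p}. F (d + c)) = G" for c
    using sum.reindex_bij_betw[OF bij_betw_shift_mod[OF p0, of c], of F] by (simp add: F_mod G_def)
  have prod: "F (d + t) * cnj (F t) = F d * ee (of_int ((2 * u * d) * t) / real p)" for d t
  proof -
    have "of_int (z * (d + t) + u * (d + t) ^ 2) / real p + (- (of_int (z * t + u * t ^ 2) / real p)) =
        of_int (z * d + u * d ^ 2) / real p + of_int ((2 * u * d) * t) / real p"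
      using p0 by (simp add: field_simps power2_eq_square)
    thus ?thesis unfolding F_def cnj_ee ee_add[symmetric] by (simp only:)
  qed
  have dvd: "int p dvd 2 * u * d \<longleftrightarrow> d = 0" if "d \<in> {0..<int p}" for d
  proof
    assume "int p dvd 2 * u * d"
    moreover have "prime (int p)" using p by simp
    moreover have "\<not> int p dvd 2"
    proof
      assume "int p dvd 2"
      hence "p dvd 2" by (metis int_dvd_int_iff of_nat_numeral)
      hence "p = 2" using p(1) primes_dvd_imp_eq two_is_prime_nat by blast
      thus False using p(2) by simp
    qed
    ultimately have "int p dvd d" using u by (simp add: prime_dvd_mult_iff)
    thus "d = 0" using that by (auto dest: zdvd_imp_le)
  qed simp
  have "G * cnj G = (\<Sum>t\<in>{0..<int p}. G * cnj (F t))"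
    by (subst (2) G_def) (simp add: sum_distrib_left)
  also have "\<dots> = (\<Sum>t\<in>{0..<int p}. \<Sum>d\<in>{0..<int p}. F (d + t) * cnj (F t))"
    by (intro sum.cong refl) (simp only: shift flip: sum_distrib_right)
  also have "\<dots> = (\<Sum>d\<in>{0..<int p}. \<Sum>t\<in>{0..<int p}. F d * ee (of_int ((2 * u * d) * t) / real p))"
    by (subst sum.swap) (simp only: prod)
  also have "\<dots> = (\<Sum>d\<in>{0..<int p}. if d = 0 then of_nat p else 0)"
  proof (intro sum.cong refl)
    fix d assume "d \<in> {0..<int p}"
    thus "(\<Sum>t\<in>{0..<int p}. F d * ee (of_int ((2 * u * d) * t) / real p)) = (if d = 0 then of_nat p else 0)"
      unfolding sum_distrib_left[symmetric] sum_ee[OF p0] using dvd by (simp add: F_def)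
  qed
  also have "\<dots> = of_nat p" using p0 by simp
  finally have "G * cnj G = of_nat p" .
  moreover have "G * cnj G = of_real (norm G ^ 2)" by (rule complex_norm_square[symmetric])
  ultimately have "of_real (norm G ^ 2) = (of_real (real p) :: complex)" by simp
  hence "norm G ^ 2 = real p" by (simp only: of_real_eq_iff)
  hence "norm G = sqrt (real p)" by (metis norm_ge_zero real_sqrt_unique)
  thus ?thesis unfolding G_def F_def .
qed

section \<open>Stationary phase modulo prime powers\<close>

lemma hyperbola_ex:
  assumes "m > 0" "coprime x (int m)" "x \<in> {0..<int m}"
  obtains y where "(x, y) \<in> hyperbola m a"
proof -
  obtain x' where x': "[x * x' = 1] (mod int m)" using cong_solve_coprime_int[OF assms(2)] by blast
  have "[x * (x' * a) = a] (mod int m)" using cong_mult[OF x' cong_refl[of a]] by (simp add: mult.assoc)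
  hence "(x mod int m, (x' * a) mod int m) \<in> hyperbola m a" by (rule hyperbola_mod_mem[OF assms(1)])
  thus ?thesis using that assms(3) by simp
qed

lemma inj_on_fst_hyperbola: "coprime a (int m) \<Longrightarrow> inj_on fst (hyperbola m a)"
  by (rule inj_onI) (metis hyperbola_unique prod.collapse)

text \<open>
  For \<open>u v = 1\<close> modulo \<open>m\<close> these maps permute the points of a modular hyperbola.
\<close>

definition twist :: "nat \<Rightarrow> int \<Rightarrow> int \<Rightarrow> int \<times> int \<Rightarrow> int \<times> int" where
  "twist m u v = (\<lambda>(x, y). (x * u mod int m, y * v mod int m))"

lemma twist_hyperbola:
  assumes "m > 0" "[u * v = 1] (mod int m)" "z \<in> hyperbola m a"
  shows "twist m u v z \<in> hyperbola m a"
proof -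
  obtain x y where z: "z = (x, y)" by (cases z)
  have "[(x * y) * (u * v) = a * 1] (mod int m)"
    using assms z by (intro cong_mult) (auto simp: hyperbola_def)
  hence "[(x * u) * (y * v) = a] (mod int m)" by (simp add: mult_ac)
  thus ?thesis unfolding z twist_def prod.case by (rule hyperbola_mod_mem[OF assms(1)])
qed

lemma inj_on_twist:
  assumes "m > 0" "[u * v = 1] (mod int m)"
  shows "inj_on (twist m u v) (hyperbola m a)"
proof (rule inj_onI)
  fix z z' assume z: "z \<in> hyperbola m a" "z' \<in> hyperbola m a" "twist m u v z = twist m u v z'"
  obtain x y x' y' where zz: "z = (x, y)" "z' = (x', y')" by (cases z; cases z')
  have uv: "[t * u * v = t] (mod int m)" "[t * v * u = t] (mod int m)" for t
    using cong_mult[OF cong_refl[of t] assms(2)] by (simp_all add: mult_ac)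
  have eq: "[x * u = x' * u] (mod int m)" "[y * v = y' * v] (mod int m)"
    using z(3) by (auto simp: zz twist_def Cong.cong_def)
  have "[x = x'] (mod int m)" "[y = y'] (mod int m)"
    using cong_mult[OF eq(1) cong_refl[of v]] cong_mult[OF eq(2) cong_refl[of u]] uv
    by (meson cong_trans cong_sym)+
  thus "z = z'" using z(1,2) by (auto simp: zz hyperbola_def Cong.cong_def)
qed

lemma ee_twist:
  assumes "m > 0"
  shows "(case twist m u v (x, y) of (x, y) \<Rightarrow> ee (of_int (h * x + k * y) / real m)) =
     ee (of_int (h * x + k * y) / real m) * ee (of_int (h * x * (u - 1) + k * y * (v - 1)) / real m)"
proof -
  have "[h * (x * u mod int m) + k * (y * v mod int m) = h * (x * u) + k * (y * v)] (mod int m)"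
    by (intro cong_add cong_mult cong_refl) (simp_all add: Cong.cong_def)
  hence "ee (of_int (h * (x * u mod int m) + k * (y * v mod int m)) / real m) =
      ee (of_int (h * (x * u) + k * (y * v)) / real m)" using assms by (rule ee_int_cong)
  also have "h * (x * u) + k * (y * v) = (h * x + k * y) + (h * x * (u - 1) + k * y * (v - 1))"
    by (simp add: algebra_simps)
  finally show ?thesis unfolding twist_def prod.case
    by (simp only: of_int_add[of "h * x + k * y"] add_divide_distrib ee_add)
qed

lemma sum_twist:
  assumes m: "m > 0" and uv: "[u * v = 1] (mod int m)"
    and A: "A \<subseteq> hyperbola m a" "\<And>z. z \<in> A \<Longrightarrow> twist m u v z \<in> A"
  shows "(\<Sum>(x, y)\<in>A. ee (of_int (h * x + k * y) / real m)) =
    (\<Sum>(x, y)\<in>A. ee (of_int (h * x + k * y) / real m) * ee (of_int (h * x * (u - 1) + k * y * (v - 1)) / real m))"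
proof -
  have "finite A" using A(1) by (rule finite_subset) simp
  moreover have "inj_on (twist m u v) A" using inj_on_twist[OF m uv] A(1) by (rule inj_on_subset)
  ultimately have "(\<Sum>z\<in>A. (\<lambda>(x, y). ee (of_int (h * x + k * y) / real m)) (twist m u v z)) =
     (\<Sum>z\<in>A. (\<lambda>(x, y). ee (of_int (h * x + k * y) / real m)) z)"
    using A(2) by (intro sum_permute_finite)
  from this[symmetric] have "(\<Sum>(x, y)\<in>A. ee (of_int (h * x + k * y) / real m)) =
      (\<Sum>z\<in>A. case twist m u v z of (x, y) \<Rightarrow> ee (of_int (h * x + k * y) / real m))" .
  also have "\<dots> = (\<Sum>(x, y)\<in>A. ee (of_int (h * x + k * y) / real m) * ee (of_int (h * x * (u - 1) + k * y * (v - 1)) / real m))"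
  proof (intro sum.cong refl, clarify)
    fix x y
    show "(case twist m u v (x, y) of (x, y) \<Rightarrow> ee (of_int (h * x + k * y) / real m)) =
      ee (of_int (h * x + k * y) / real m) * ee (of_int (h * x * (u - 1) + k * y * (v - 1)) / real m)"
      by (rule ee_twist[OF m])
  qed
  finally show ?thesis .
qed

text \<open>
  For \<open>m = p\<^sup>n\<close> and \<open>d = p\<^sup>r\<close>: the critical points, modulo \<open>d\<close>, of the phase \<open>h x + k a / x\<close>, since \<open>h x - k y\<close> is \<open>x\<close> times its derivative.
\<close>

definition stationary :: "nat \<Rightarrow> nat \<Rightarrow> int \<Rightarrow> int \<Rightarrow> int \<Rightarrow> (int \<times> int) set" where
  "stationary m d a h k = {(x, y) \<in> hyperbola m a. int d dvd h * x - k * y}"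

text \<open>
  The twist by \<open>u = 1 + S t\<close> and \<open>v = 1 - S t\<close> changes the phase by \<open>(h x - k y) t / P\<close>; average over \<open>t\<close> modulo \<open>P\<close>.
\<close>

lemma kloo_eq_stationary:
  assumes P: "P > 0" "S > 0" "P dvd S"
  shows "kloo (P * S) a h k = (\<Sum>(x, y)\<in>stationary (P * S) P a h k. ee (of_int (h * x + k * y) / real (P * S)))"
proof -
  let ?m = "P * S" and ?H = "hyperbola (P * S) a"
  let ?f = "\<lambda>x y. ee (of_int (h * x + k * y) / real (P * S))"
  have m: "?m > 0" using P by simp
  have tw: "kloo ?m a h k = (\<Sum>(x, y)\<in>?H. ?f x y * ee (of_int ((h * x - k * y) * t) / real P))" for t
  proof -
    have "int ?m dvd int S * t * (int S * t)"
    proof -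
      have "int P * int S dvd int S * int S" using P(3) by (intro mult_dvd_mono) auto
      thus ?thesis by (simp add: mult_ac)
    qed
    hence "[(1 + int S * t) * (1 - int S * t) = 1] (mod int ?m)"
      by (simp add: cong_iff_dvd_diff algebra_simps)
    from sum_twist[OF m this order.refl twist_hyperbola[OF m this], of a h k]
    have "kloo ?m a h k = (\<Sum>(x, y)\<in>?H. ?f x y *
       ee (of_int (h * x * (1 + int S * t - 1) + k * y * (1 - int S * t - 1)) / real ?m))"
      by (simp add: kloo_def)
    moreover have "of_int (h * x * (1 + int S * t - 1) + k * y * (1 - int S * t - 1)) / real ?m =
       of_int ((h * x - k * y) * t) / real P" for x y
      using P by (simp add: field_simps)
    ultimately show ?thesis by (simp only:)
  qed
  have st: "stationary ?m P a h k = {z \<in> ?H. int P dvd h * fst z - k * snd z}"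
    by (auto simp: stationary_def)
  have "of_nat P * kloo ?m a h k = (\<Sum>t\<in>{0..<int P}. kloo ?m a h k)" by simp
  also have "\<dots> = (\<Sum>t\<in>{0..<int P}. \<Sum>(x, y)\<in>?H. ?f x y * ee (of_int ((h * x - k * y) * t) / real P))"
    by (intro sum.cong refl tw)
  also have "\<dots> = (\<Sum>z\<in>?H. \<Sum>t\<in>{0..<int P}. ?f (fst z) (snd z) * ee (of_int ((h * fst z - k * snd z) * t) / real P))"
    by (subst sum.swap) (simp add: case_prod_unfold)
  also have "\<dots> = (\<Sum>z\<in>?H. if int P dvd h * fst z - k * snd z then of_nat P * ?f (fst z) (snd z) else 0)"
    unfolding sum_distrib_left[symmetric] sum_ee[OF P(1)] by (intro sum.cong refl) auto
  also have "\<dots> = (\<Sum>z\<in>stationary ?m P a h k. of_nat P * ?f (fst z) (snd z))"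
    unfolding st by (simp only: sum.inter_filter[OF finite_hyperbola])
  also have "\<dots> = of_nat P * (\<Sum>(x, y)\<in>stationary ?m P a h k. ?f x y)"
    by (simp add: sum_distrib_left case_prod_unfold)
  finally show ?thesis using P(1) by simp
qed

text \<open>
  A finer twist, by \<open>1 + P t\<close> and the first three terms \<open>1 - P t + P\<^sup>2 t\<^sup>2\<close> of its inverse. It preserves the
  stationary points, and on them the linear and the quadratic term of the change of phase both have denominator \<open>p\<close>.
\<close>

lemma kloo_stationary_odd:
  fixes a h k :: int
  assumes p: "prime p" and r: "r > 0"
  defines "P \<equiv> p ^ r" and "A \<equiv> stationary (p ^ (2 * r + 1)) (p ^ r) a h k"
  shows "of_nat p * kloo (p ^ (2 * r + 1)) a h k =
    (\<Sum>(x, y)\<in>A. ee (of_int (h * x + k * y) / real (p ^ (2 * r + 1))) *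
       (\<Sum>t\<in>{0..<int p}. ee (of_int ((h * x - k * y) div int P * t + k * y * t ^ 2) / real p)))"
proof -
  let ?m = "p ^ (2 * r + 1)"
  let ?f = "\<lambda>x y. ee (of_int (h * x + k * y) / real ?m)"
  have p0: "p > 0" using p by (simp add: prime_gt_0_nat)
  have m: "?m > 0" and P0: "P > 0" using p0 by (simp_all add: P_def)
  have mP: "?m = P * (P * p)" by (simp add: P_def mult_2 power_add)
  have AH: "A \<subseteq> hyperbola ?m a" by (auto simp: A_def stationary_def)
  have tw: "(\<Sum>(x, y)\<in>A. ?f x y) = (\<Sum>(x, y)\<in>A. ?f x y * ee (of_int ((h * x - k * y) div int P * t + k * y * t ^ 2) / real p))" for t
  proof -
    \<comment> \<open>\<open>u v = 1 + (P t)\<^sup>3\<close>, and \<open>p\<^sup>2\<^sup>r\<^sup>+\<^sup>1\<close> divides \<open>P\<^sup>3\<close> because \<open>r \<ge> 1\<close>\<close>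
    define u where "u = 1 + int P * t"
    define v where "v = 1 - int P * t + (int P * t) ^ 2"
    have "int p dvd int P" using r by (simp add: P_def dvd_power)
    hence "int P * (int P * int p) dvd int P * (int P * int P)" by (intro mult_dvd_mono) auto
    hence "int ?m dvd int P * (int P * int P) * t ^ 3" unfolding mP by simp
    also have "int P * (int P * int P) * t ^ 3 = u * v - 1"
      by (simp add: u_def v_def power2_eq_square power3_eq_cube algebra_simps)
    finally have uv: "[u * v = 1] (mod int ?m)" by (simp add: cong_iff_dvd_diff)
    have cl: "twist ?m u v z \<in> A" if z: "z \<in> A" for z
    proof -
      obtain x y where xy: "z = (x, y)" by (cases z)
      have H: "twist ?m u v z \<in> hyperbola ?m a" using twist_hyperbola[OF m uv] AH z by blast
      have Pm: "[w mod int ?m = w] (mod int P)" for w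
      proof -
        have "[w mod int ?m = w] (mod int P * (int P * int p))" unfolding mP by (simp add: Cong.cong_def)
        thus ?thesis by (rule cong_modulus_mult)
      qed
      have "[u = 1] (mod int P)" "[v = 1] (mod int P)"
        by (simp_all add: u_def v_def cong_iff_dvd_diff power2_eq_square)
      hence "[h * (x * u mod int ?m) - k * (y * v mod int ?m) = h * (x * 1) - k * (y * 1)] (mod int P)"
        by (intro cong_diff cong_mult cong_refl cong_trans[OF Pm]) auto
      moreover have "int P dvd h * x - k * y" using z by (simp add: xy A_def stationary_def P_def)
      ultimately have "int P dvd h * (x * u mod int ?m) - k * (y * v mod int ?m)"
        using cong_dvd_iff[of "h * (x * u mod int ?m) - k * (y * v mod int ?m)" "h * x - k * y" "int P"] by simp
      thus ?thesis using H by (simp add: xy A_def stationary_def twist_def P_def)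
    qed
    have "(\<Sum>(x, y)\<in>A. ?f x y) = (\<Sum>(x, y)\<in>A. ?f x y * ee (of_int (h * x * (u - 1) + k * y * (v - 1)) / real ?m))"
      by (rule sum_twist[OF m uv AH cl])
    also have "\<dots> = (\<Sum>(x, y)\<in>A. ?f x y * ee (of_int ((h * x - k * y) div int P * t + k * y * t ^ 2) / real p))"
    proof (intro sum.cong refl, clarify)
      fix x y assume "(x, y) \<in> A"
      hence "int P dvd h * x - k * y" by (simp add: A_def stationary_def P_def)
      then obtain q where q: "h * x - k * y = int P * q" by blast
      hence hx: "h * x = k * y + int P * q" by simp
      have "h * x * (u - 1) + k * y * (v - 1) = int P * int P * (q * t + k * y * t ^ 2)"
        unfolding hx by (simp add: u_def v_def power2_eq_square algebra_simps)
      hence "real_of_int (h * x * (u - 1) + k * y * (v - 1)) / real ?m =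
          (real P * real P * real_of_int (q * t + k * y * t ^ 2)) / (real P * (real P * real p))"
        unfolding mP by (simp only: of_int_mult of_nat_mult of_int_of_nat_eq)
      also have "\<dots> = of_int (q * t + k * y * t ^ 2) / real p" using P0 by simp
      finally show "?f x y * ee (of_int (h * x * (u - 1) + k * y * (v - 1)) / real ?m) =
          ?f x y * ee (of_int ((h * x - k * y) div int P * t + k * y * t ^ 2) / real p)"
        using P0 by (simp only: q) simp
    qed
    finally show ?thesis .
  qed
  have "kloo ?m a h k = (\<Sum>(x, y)\<in>A. ?f x y)"
    unfolding A_def mP P_def[symmetric] by (rule kloo_eq_stationary) (use P0 p0 in auto)
  hence "of_nat p * kloo ?m a h k = (\<Sum>t\<in>{0..<int p}. \<Sum>(x, y)\<in>A. ?f x y)" by simp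
  also have "\<dots> = (\<Sum>t\<in>{0..<int p}. \<Sum>(x, y)\<in>A. ?f x y * ee (of_int ((h * x - k * y) div int P * t + k * y * t ^ 2) / real p))"
    by (intro sum.cong refl tw)
  also have "\<dots> = (\<Sum>(x, y)\<in>A. ?f x y * (\<Sum>t\<in>{0..<int p}. ee (of_int ((h * x - k * y) div int P * t + k * y * t ^ 2) / real p)))"
    by (subst sum.swap) (simp add: sum_distrib_left case_prod_unfold)
  finally show ?thesis .
qed

text \<open>
  If \<open>p\<close> divides both factors, it divides \<open>2 x\<close>, so \<open>p = 2\<close>; then one of the factors is twice an odd number.
  The factor \<open>2\<close> in the conclusion covers this case.
\<close>

lemma prime_power_dvd_twice_factor:
  fixes u v :: int
  assumes p: "prime p" and uv: "int p ^ r dvd u * v" and x: "v - u = 2 * x" "\<not> int p dvd x"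
  shows "int p ^ r dvd 2 * u \<or> int p ^ r dvd 2 * v"
proof -
  have pp: "prime (int p)" using p by simp
  have cop: "coprime (int p ^ r) w" if "\<not> int p dvd w" for w
    using prime_imp_coprime[OF pp that] by simp
  consider "\<not> int p dvd u" | "\<not> int p dvd v" | "int p dvd u" "int p dvd v" by blast
  thus ?thesis
  proof cases
    case 1
    thus ?thesis using uv cop[of u] by (simp add: coprime_dvd_mult_right_iff)
  next
    case 2
    thus ?thesis using uv cop[of v] by (simp add: coprime_dvd_mult_left_iff)
  next
    case 3
    hence "int p dvd v - u" by simp
    hence "int p dvd 2" using pp x by (simp add: prime_dvd_mult_iff)
    hence "p dvd 2" by (metis int_dvd_int_iff of_nat_numeral)
    hence p2: "p = 2" using p primes_dvd_imp_eq two_is_prime_nat by blast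
    obtain u' v' where u': "u = 2 * u'" "v = 2 * v'" using 3 p2 by (auto elim!: dvdE)
    hence "v' - u' = x" using x(1) by simp
    hence "\<not> int p dvd u' \<or> \<not> int p dvd v'" using x(2) by auto
    thus ?thesis
    proof
      assume "\<not> int p dvd u'"
      moreover have "int p ^ r dvd (2 * v) * u'" using uv by (simp add: u' mult_ac)
      ultimately show ?thesis using cop[of u'] by (simp add: coprime_dvd_mult_left_iff)
    next
      assume "\<not> int p dvd v'"
      moreover have "int p ^ r dvd (2 * u) * v'" using uv by (simp add: u' mult_ac)
      ultimately show ?thesis using cop[of v'] by (simp add: coprime_dvd_mult_left_iff)
    qed
  qed
qed

lemma card_twice_residue_class:
  assumes p: "prime p" and r: "r > 0"
  shows "card {x \<in> {0..<int (p ^ (r + s))}. int p ^ r dvd 2 * (x - c)} \<le> 2 * p ^ s"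
proof (cases "p = 2")
  case True
  obtain r' where r': "r = Suc r'" using r by (cases r) auto
  have pr: "int p ^ r = 2 * int (2 ^ r')" by (simp add: True r')
  have "int p ^ r dvd 2 * (x - c) \<longleftrightarrow> int (2 ^ r') dvd x - c" for x
    unfolding pr by (rule dvd_times_left_cancel_iff) simp
  moreover have "p ^ (r + s) = 2 ^ r' * (2 * p ^ s)" by (simp add: True r' power_add)
  ultimately show ?thesis using card_residue_class[of "2 ^ r'" "2 * p ^ s" c] by simp
next
  case False
  have "\<not> p dvd 2" using p False primes_dvd_imp_eq two_is_prime_nat by blast
  hence "coprime p 2" using p prime_imp_coprime by blast
  hence c2: "coprime (int p ^ r) 2" by (metis coprime_int_iff coprime_power_left_iff of_nat_numeral)
  have "int p ^ r dvd 2 * (x - c) \<longleftrightarrow> int (p ^ r) dvd x - c" for x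
    unfolding of_nat_power by (rule coprime_dvd_mult_right_iff[OF c2])
  moreover have "p ^ (r + s) = p ^ r * p ^ s" by (simp add: power_add)
  ultimately show ?thesis using card_residue_class[of "p ^ r" "p ^ s" c] p by (simp add: prime_gt_0_nat)
qed

text \<open>
  Modulo \<open>p\<close> the condition is \<open>h x = k y\<close> with units \<open>x\<close> and \<open>y\<close>, so if \<open>p\<close> divided one frequency it would divide the other.
\<close>

lemma stationary_units:
  assumes p: "prime p" and r: "r > 0" and n: "n > 0" and a: "coprime a (int p)"
    and hk: "\<not> (int p dvd h \<and> int p dvd k)" and xy: "(x, y) \<in> stationary (p ^ n) (p ^ r) a h k"
  shows "\<not> int p dvd x" "\<not> int p dvd y" "\<not> int p dvd h" "\<not> int p dvd k"
proof -
  have pp: "prime (int p)" using p by simp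
  have H: "(x, y) \<in> hyperbola (p ^ n) a" "int (p ^ r) dvd h * x - k * y"
    using xy by (auto simp: stationary_def)
  have "coprime a (int (p ^ n))" using a by simp
  from hyperbola_coprime[OF H(1) this] have "coprime x (int p)" "coprime y (int p)" using n by auto
  thus x: "\<not> int p dvd x" and y: "\<not> int p dvd y" using coprime_imp_not_prime_dvd pp by blast+
  have "int p dvd int (p ^ r)" using r by (simp add: dvd_power)
  hence "int p dvd h * x - k * y" using H(2) by (rule dvd_trans)
  hence "int p dvd h * x \<longleftrightarrow> int p dvd k * y"
    by (metis cong_dvd_iff cong_iff_dvd_diff)
  hence "int p dvd h \<longleftrightarrow> int p dvd k" using x y pp by (simp add: prime_dvd_mult_iff)
  thus "\<not> int p dvd h" "\<not> int p dvd k" using hk by blast+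
qed

text \<open>
  All stationary points satisfy \<open>h x\<^sup>2 = k a\<close> modulo \<open>p\<^sup>r\<close> with \<open>h\<close> a unit, so any two values of \<open>x\<close> agree up to sign,
  or nearly so if \<open>p = 2\<close>.
\<close>

lemma card_stationary_le:
  assumes p: "prime p" and r: "r > 0" and a: "coprime a (int p)"
    and hk: "\<not> (int p dvd h \<and> int p dvd k)"
  shows "card (stationary (p ^ (r + s)) (p ^ r) a h k) \<le> 4 * p ^ s"
proof (cases "stationary (p ^ (r + s)) (p ^ r) a h k = {}")
  case False
  let ?m = "p ^ (r + s)" and ?A = "stationary (p ^ (r + s)) (p ^ r) a h k"
  have pp: "prime (int p)" using p by simp
  have a': "coprime a (int ?m)" using a by simp
  have AH: "?A \<subseteq> hyperbola ?m a" by (auto simp: stationary_def)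
  have A: "int (p ^ r) dvd h * x - k * y" "int (p ^ r) dvd x * y - a" "x \<in> {0..<int ?m}"
    if "(x, y) \<in> ?A" for x y
  proof -
    have H: "(x, y) \<in> hyperbola ?m a" using AH that by blast
    show "int (p ^ r) dvd h * x - k * y" using that by (simp add: stationary_def)
    have "int ?m dvd x * y - a" using H by (simp add: hyperbola_def cong_iff_dvd_diff)
    moreover have "int (p ^ r) dvd int ?m" by (simp add: power_add)
    ultimately show "int (p ^ r) dvd x * y - a" by (rule dvd_trans[rotated])
    show "x \<in> {0..<int ?m}" using H by (simp add: hyperbola_def)
  qed
  obtain x0 y0 where 0: "(x0, y0) \<in> ?A" using False by auto
  have "r + s > 0" using r by simp
  note units = stationary_units[OF p r this a hk 0]
  have ch: "coprime (int (p ^ r)) h" using prime_imp_coprime[OF pp units(3)] by simp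
  have sq: "int (p ^ r) dvd h * x ^ 2 - k * a" if "(x, y) \<in> ?A" for x y
  proof -
    have "int (p ^ r) dvd x * (h * x - k * y) + k * (x * y - a)"
      using A(1,2)[OF that] by (intro dvd_add dvd_mult) auto
    also have "x * (h * x - k * y) + k * (x * y - a) = h * x ^ 2 - k * a"
      by (simp add: power2_eq_square algebra_simps)
    finally show ?thesis .
  qed
  let ?B = "\<lambda>c. {x \<in> {0..<int ?m}. int p ^ r dvd 2 * (x - c)}"
  have finB: "finite (?B c)" for c by (rule finite_subset[of _ "{0..<int ?m}"]) auto
  have sub: "fst ` ?A \<subseteq> ?B x0 \<union> ?B (- x0)"
  proof
    fix x assume "x \<in> fst ` ?A"
    then obtain y where xy: "(x, y) \<in> ?A" by auto
    have "int (p ^ r) dvd (h * x ^ 2 - k * a) - (h * x0 ^ 2 - k * a)"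
      using sq[OF xy] sq[OF 0] by (rule dvd_diff)
    also have "(h * x ^ 2 - k * a) - (h * x0 ^ 2 - k * a) = h * ((x - x0) * (x + x0))"
      by (simp add: power2_eq_square algebra_simps)
    finally have "int p ^ r dvd (x - x0) * (x + x0)"
      using ch by (simp add: coprime_dvd_mult_right_iff)
    hence "int p ^ r dvd 2 * (x - x0) \<or> int p ^ r dvd 2 * (x + x0)"
      using units(1) by (intro prime_power_dvd_twice_factor[OF p]) auto
    thus "x \<in> ?B x0 \<union> ?B (- x0)" using A(3)[OF xy] by auto
  qed
  have "card ?A = card (fst ` ?A)"
    using inj_on_subset[OF inj_on_fst_hyperbola[OF a'] AH] by (rule card_image[symmetric])
  also have "\<dots> \<le> card (?B x0 \<union> ?B (- x0))" by (rule card_mono[OF _ sub]) (intro finite_UnI finB)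
  also have "\<dots> \<le> card (?B x0) + card (?B (- x0))" by (rule card_Un_le)
  also have "\<dots> \<le> 2 * p ^ s + 2 * p ^ s" by (intro add_mono card_twice_residue_class p r)
  finally show ?thesis by simp
qed simp

lemma norm_kloo_le_card: "norm (kloo m a h k) \<le> real (card (hyperbola m a))"
  unfolding kloo_def by (rule order.trans[OF norm_sum]) (simp add: case_prod_unfold)

text \<open>
  Counting stationary points gives \<open>4 p\<^sup>s\<close> with \<open>s = n - n div 2\<close>. This is enough for even \<open>n\<close>, and for
  \<open>p = 2\<close> at the price of a constant; for odd \<open>n\<close> and \<open>p\<close> the Gauss sums save the factor \<open>\<surd>p\<close>.
\<close>

lemma norm_kloo_prime_power_primitive:
  assumes p: "prime p" and n: "n \<ge> 2" and a: "coprime a (int p)"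
    and hk: "\<not> (int p dvd h \<and> int p dvd k)"
  shows "norm (kloo (p ^ n) a h k) \<le> 8 * sqrt (real (p ^ n))"
proof -
  define r where "r = n div 2"
  have r: "r > 0" using n by (simp add: r_def)
  have p0: "p > 0" using p by (simp add: prime_gt_0_nat)
  have pp: "prime (int p)" using p by simp
  have trivial: "norm (kloo (p ^ (r + s)) a h k) \<le> 4 * real (p ^ s)" if "s \<ge> r" for s
  proof -
    have "kloo (p ^ r * p ^ s) a h k = (\<Sum>(x, y)\<in>stationary (p ^ r * p ^ s) (p ^ r) a h k.
        ee (of_int (h * x + k * y) / real (p ^ r * p ^ s)))"
      using p0 that by (intro kloo_eq_stationary) (auto intro: le_imp_power_dvd)
    hence "norm (kloo (p ^ r * p ^ s) a h k) \<le> real (card (stationary (p ^ r * p ^ s) (p ^ r) a h k))"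
      by (simp only:) (rule order.trans[OF norm_sum], simp add: case_prod_unfold)
    also have "\<dots> \<le> real (4 * p ^ s)"
      using card_stationary_le[OF p r a hk, of s] by (simp only: power_add of_nat_le_iff)
    finally show ?thesis by (simp add: power_add)
  qed
  have sqrt2r: "sqrt (real (p ^ (2 * r))) = real (p ^ r)"
    by (simp add: power_mult mult.commute[of 2] real_sqrt_power[symmetric] power_even_eq)
  show ?thesis
  proof (cases "even n")
    case True
    hence n2: "n = r + r" by (auto simp: r_def)
    have "norm (kloo (p ^ (r + r)) a h k) \<le> 4 * real (p ^ r)" by (rule trivial) simp
    also have "real (p ^ r) = sqrt (real (p ^ (r + r)))" using sqrt2r by (simp add: mult_2)
    finally show ?thesis unfolding n2 by (simp add: order.trans)
  next
    case False
    hence n2: "n = 2 * r + 1" by (auto simp: r_def elim: oddE)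
    have sq: "sqrt (real (p ^ n)) = real (p ^ r) * sqrt (real p)"
    proof -
      have "real (p ^ n) = real (p ^ (2 * r)) * real p" by (simp add: n2)
      thus ?thesis using sqrt2r by (simp only: real_sqrt_mult)
    qed
    show ?thesis
    proof (cases "p = 2")
      case True
      have "norm (kloo (p ^ (r + (r + 1))) a h k) \<le> 4 * real (p ^ (r + 1))" by (rule trivial) simp
      also have "\<dots> = 8 * real (p ^ r)" by (simp add: True)
      also have "\<dots> \<le> 8 * (real (p ^ r) * sqrt (real p))"
        using p0 by (intro mult_left_mono) (auto simp: Suc_le_eq)
      finally show ?thesis unfolding sq[symmetric] by (simp add: n2 mult_2)
    next
      case False
      hence podd: "odd p" using p by (metis prime_odd_nat nat_less_le prime_ge_2_nat)
      let ?A = "stationary (p ^ (2 * r + 1)) (p ^ r) a h k"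
      define T where "T x y = (\<Sum>t\<in>{0..<int p}. ee (of_int ((h * x - k * y) div int (p ^ r) * t + k * y * t ^ 2) / real p))" for x y
      have "\<not> int p dvd k * y" if "(x, y) \<in> ?A" for x y
        using stationary_units(2,4)[OF p r _ a hk that] pp by (simp add: prime_dvd_mult_iff)
      hence T: "norm (T x y) = sqrt (real p)" if "(x, y) \<in> ?A" for x y
        unfolding T_def using that by (intro norm_gauss_sum p podd)
      have "real p * norm (kloo (p ^ (2 * r + 1)) a h k) = norm (of_nat p * kloo (p ^ (2 * r + 1)) a h k)"
        by (simp add: norm_mult)
      also have "\<dots> = norm (\<Sum>(x, y)\<in>?A. ee (of_int (h * x + k * y) / real (p ^ (2 * r + 1))) * T x y)"
        unfolding kloo_stationary_odd[OF p r] T_def ..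
      also have "\<dots> \<le> (\<Sum>z\<in>?A. sqrt (real p))"
        by (rule order.trans[OF norm_sum], rule sum_mono) (auto simp: norm_mult T)
      also have "\<dots> = real (card ?A) * sqrt (real p)" by simp
      also have "card ?A \<le> 4 * p ^ (r + 1)"
        using card_stationary_le[OF p r a hk, of "r + 1"] by (simp add: mult_2)
      hence "real (card ?A) * sqrt (real p) \<le> real (4 * p ^ (r + 1)) * sqrt (real p)"
        by (intro mult_right_mono) (auto simp only: of_nat_le_iff real_sqrt_ge_zero of_nat_0_le_iff)
      also have "\<dots> = real p * (4 * (real (p ^ r) * sqrt (real p)))" by simp
      finally have "norm (kloo (p ^ n) a h k) \<le> 4 * (real (p ^ r) * sqrt (real p))"
        using p0 by (simp add: n2)
      thus ?thesis unfolding sq[symmetric] by (simp add: order.trans)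
    qed
  qed
qed

text \<open>
  The summand depends on the point modulo \<open>m\<close> only, and each point modulo \<open>m\<close> has \<open>p\<close> lifts modulo \<open>m p\<close>.
\<close>

lemma kloo_prime_divisible:
  assumes m: "m > 0" "p dvd m" "p > 0" and a: "coprime a (int m)"
  shows "kloo (m * p) a (int p * h) (int p * k) = of_nat p * kloo m a h k"
proof -
  define \<pi> where "\<pi> = (\<lambda>(x :: int, y :: int). (x mod int m, y mod int m))"
  define g where "g = (\<lambda>(x, y). ee (of_int (h * x + k * y) / real m))"
  have a': "coprime a (int (m * p))"
  proof -
    have "int p dvd int m" using m(2) by simp
    hence "coprime a (int p)" using a by (metis coprime_divisors dvd_refl)
    thus ?thesis using a by simp
  qed
  have cop: "coprime x (int (m * p))" if "coprime x (int m)" for x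
  proof -
    have "int p dvd int m" using m(2) by simp
    hence "coprime x (int p)" using that by (metis coprime_divisors dvd_refl)
    thus ?thesis using that by simp
  qed
  have mp: "m * p > 0" using m by simp
  have \<pi>H: "\<pi> z \<in> hyperbola m a" if z: "z \<in> hyperbola (m * p) a" for z
  proof -
    obtain x y where xy: "z = (x, y)" by (cases z)
    have "[x * y = a] (mod int m * int p)" using z by (simp add: xy hyperbola_def)
    hence "[x * y = a] (mod int m)" by (rule cong_modulus_mult)
    thus ?thesis unfolding \<pi>_def xy prod.case by (rule hyperbola_mod_mem[OF m(1)])
  qed
  have fiber: "card {z \<in> hyperbola (m * p) a. \<pi> z = w} = p" if w: "w \<in> hyperbola m a" for w
  proof -
    obtain x y where xy: "w = (x, y)" by (cases w)
    let ?F = "{z \<in> hyperbola (m * p) a. \<pi> z = w}"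
    have x: "x \<in> {0..<int m}" "coprime x (int m)"
      using w hyperbola_coprime[of x y m a] a by (auto simp: xy hyperbola_def)
    have "fst ` ?F = {x' \<in> {0..<int (m * p)}. int m dvd x' - x}"
    proof (intro Set.set_eqI iffI)
      fix x' assume "x' \<in> fst ` ?F"
      then obtain y' where y': "(x', y') \<in> hyperbola (m * p) a" "x' mod int m = x"
        by (auto simp: \<pi>_def xy)
      moreover have "int m dvd x' - x" using y'(2) by (metis dvd_minus_mod)
      ultimately show "x' \<in> {x' \<in> {0..<int (m * p)}. int m dvd x' - x}"
        by (simp add: hyperbola_def)
    next
      fix x' assume x': "x' \<in> {x' \<in> {0..<int (m * p)}. int m dvd x' - x}"
      hence xc: "[x' = x] (mod int m)" by (simp add: cong_iff_dvd_diff)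
      hence "coprime x' (int m)" using x(2) cong_imp_coprime cong_sym by blast
      hence "coprime x' (int (m * p))" by (rule cop)
      moreover have "x' \<in> {0..<int (m * p)}" using x' by blast
      ultimately obtain y' where y': "(x', y') \<in> hyperbola (m * p) a"
        using hyperbola_ex[OF mp] by blast
      have xm: "x' mod int m = x" using xc x(1) by (rule mod_eqI)
      have "(x, y' mod int m) \<in> hyperbola m a" using \<pi>H[OF y'] xm by (simp add: \<pi>_def)
      hence "y' mod int m = y" using hyperbola_unique w a unfolding xy by blast
      hence "\<pi> (x', y') = w" using xm by (simp add: \<pi>_def xy)
      thus "x' \<in> fst ` ?F" using y' by (intro image_eqI[of _ _ "(x', y')"]) auto
    qed
    moreover have "inj_on fst ?F"
      by (rule inj_on_subset[OF inj_on_fst_hyperbola[OF a']]) blast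
    ultimately have "card ?F = card {x' \<in> {0..<int (m * p)}. int m dvd x' - x}"
      using card_image[of fst ?F] by (simp only:)
    thus ?thesis using card_residue_class[OF m(1), of p x] by simp
  qed
  have "kloo (m * p) a (int p * h) (int p * k) = (\<Sum>z\<in>hyperbola (m * p) a. g (\<pi> z))"
    unfolding kloo_def
  proof (intro sum.cong refl, clarify)
    fix x y :: int
    have "of_int (int p * h * x + int p * k * y) / real (m * p) = of_int (h * x + k * y) / real m"
      using m by (simp add: field_simps)
    moreover have "[h * (x mod int m) + k * (y mod int m) = h * x + k * y] (mod int m)"
      by (intro cong_add cong_mult cong_refl) (simp_all add: Cong.cong_def)
    hence "ee (of_int (h * (x mod int m) + k * (y mod int m)) / real m) = ee (of_int (h * x + k * y) / real m)"
      using m(1) by (rule ee_int_cong)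
    ultimately show "ee (of_int (int p * h * x + int p * k * y) / real (m * p)) = g (\<pi> (x, y))"
      unfolding g_def \<pi>_def prod.case by (simp only:)
  qed
  also have "\<dots> = (\<Sum>w\<in>hyperbola m a. \<Sum>z\<in>{z \<in> hyperbola (m * p) a. \<pi> z = w}. g (\<pi> z))"
    using \<pi>H by (intro sum.group[symmetric]) auto
  also have "\<dots> = (\<Sum>w\<in>hyperbola m a. of_nat p * g w)"
    using fiber by (intro sum.cong refl) simp
  also have "\<dots> = of_nat p * kloo m a h k"
    by (simp add: kloo_def g_def sum_distrib_left case_prod_unfold)
  finally show ?thesis .
qed

section \<open>The bound for arbitrary moduli\<close>

definition gcd3 :: "int \<Rightarrow> int \<Rightarrow> nat \<Rightarrow> real" where
  "gcd3 h k m = of_int (gcd (gcd h k) (int m))"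

lemma gcd3_ge_1: "m > 0 \<Longrightarrow> gcd3 h k m \<ge> 1"
  by (simp add: gcd3_def int_one_le_iff_zero_less)

lemma card_hyperbola_le:
  assumes "coprime a (int m)"
  shows "card (hyperbola m a) \<le> m"
proof -
  have "card (hyperbola m a) = card (fst ` hyperbola m a)"
    by (rule card_image[OF inj_on_fst_hyperbola[OF assms], symmetric])
  also have "\<dots> \<le> card {0..<int m}" by (rule card_mono) (auto simp: hyperbola_def)
  finally show ?thesis by simp
qed

text \<open>
  Common factors \<open>p\<close> of the frequencies are divided out one by one; each contributes \<open>p = \<surd>p \<surd>p\<close>, shared between the
  modulus and the gcd. What remains is the primitive case, or the Weil bound if the modulus is \<open>p\<close>.
\<close>

lemma norm_kloo_prime_power:
  assumes p: "prime p" and a: "coprime a (int p)"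
  shows "norm (kloo (p ^ n) a h k) \<le> 8 * sqrt (real (p ^ n)) * sqrt (gcd3 h k (p ^ n))"
proof (induction n arbitrary: h k)
  case 0
  have "card (hyperbola 1 a) \<le> 1" by (rule card_hyperbola_le) simp
  hence "norm (kloo 1 a h k) \<le> 1" using norm_kloo_le_card[of 1 a h k] by linarith
  moreover have "gcd3 h k 1 = 1" by (simp add: gcd3_def)
  ultimately show ?case by simp
next
  case (Suc n)
  have p0: "p > 0" using p by (simp add: prime_gt_0_nat)
  have g1: "1 \<le> sqrt (gcd3 h k (p ^ Suc n))" using gcd3_ge_1[of "p ^ Suc n" h k] p0 by simp
  show ?case
  proof (cases "int p dvd h \<and> int p dvd k")
    case False
    have "norm (kloo (p ^ Suc n) a h k) \<le> 8 * sqrt (real (p ^ Suc n))"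
    proof (cases "n = 0")
      case True
      have "norm (kloo p a h k) \<le> 2 * sqrt (real p)"
        using weil_bound[OF p] a False unfolding weil_bound_at_def by blast
      also have "\<dots> \<le> 8 * sqrt (real p)" by simp
      finally show ?thesis using True by simp
    next
      case n0: False
      show ?thesis by (rule norm_kloo_prime_power_primitive[OF p _ a False]) (use n0 in auto)
    qed
    also have "\<dots> = 8 * sqrt (real (p ^ Suc n)) * 1" by simp
    also have "\<dots> \<le> 8 * sqrt (real (p ^ Suc n)) * sqrt (gcd3 h k (p ^ Suc n))"
      using g1 by (intro mult_left_mono) auto
    finally show ?thesis .
  next
    case True
    then obtain h' k' where hk: "h = int p * h'" "k = int p * k'" by (auto elim!: dvdE)
    have "gcd (gcd h k) (int (p ^ Suc n)) = int p * gcd (gcd h' k') (int (p ^ n))"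
      unfolding hk by (simp add: gcd_mult_distrib_int abs_mult flip: gcd_mult_distrib_int)
    hence g: "gcd3 h k (p ^ Suc n) = real p * gcd3 h' k' (p ^ n)" by (simp add: gcd3_def)
    have key: "8 * sqrt (real (p ^ Suc n)) * sqrt (gcd3 h k (p ^ Suc n)) =
        real p * (8 * sqrt (real (p ^ n)) * sqrt (gcd3 h' k' (p ^ n)))"
    proof -
      have "sqrt (real p) * sqrt (real p) = real p" by simp
      thus ?thesis unfolding g by (simp add: real_sqrt_mult)
    qed
    show ?thesis
    proof (cases "n = 0")
      case True
      have "norm (kloo p a h k) \<le> real p"
        using norm_kloo_le_card[of p a h k] card_hyperbola_le[OF a] by linarith
      also have "\<dots> \<le> real p * (8 * sqrt (real (p ^ n)) * sqrt (gcd3 h' k' (p ^ n)))"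
        using True by (simp add: gcd3_def)
      finally show ?thesis unfolding key using True by simp
    next
      case n0: False
      have "kloo (p ^ n * p) a (int p * h') (int p * k') = of_nat p * kloo (p ^ n) a h' k'"
        by (rule kloo_prime_divisible) (use p0 n0 a in \<open>auto intro: dvd_power\<close>)
      hence "norm (kloo (p ^ Suc n) a h k) = real p * norm (kloo (p ^ n) a h' k')"
        by (simp add: hk norm_mult mult.commute)
      also have "\<dots> \<le> real p * (8 * sqrt (real (p ^ n)) * sqrt (gcd3 h' k' (p ^ n)))"
        by (intro mult_left_mono Suc.IH) simp
      finally show ?thesis unfolding key .
    qed
  qed
qed

lemma prime_power_split:
  assumes "m > (1 :: nat)"
  obtains p n m' where "prime p" "n > 0" "m = p ^ n * m'" "\<not> p dvd m'" "m' > 0" "m' < m"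
proof -
  obtain p where p: "prime p" "p dvd m" using assms prime_factor_nat[of m] by auto
  obtain m' where m': "m = p ^ multiplicity p m * m'" "\<not> p dvd m'"
    using multiplicity_decompose'[of m p] assms p by (metis not_prime_unit not_less_zero not_less0 nat_neq_iff)
  have n: "multiplicity p m > 0" using p assms by (simp add: prime_multiplicity_gt_zero_iff)
  have m0: "m' > 0" using m' assms by (cases m') auto
  have "p ^ multiplicity p m > 1" using one_less_power[OF prime_gt_1_nat[OF p(1)] n] .
  hence "1 * m' < p ^ multiplicity p m * m'" using m0 by (intro mult_strict_right_mono)
  hence "m' < m" using m'(1) by simp
  thus ?thesis using that p n m' m0 by blast
qed

lemma gcd3_mult_le:
  assumes "coprime m1 m2" "m1 > 0" "m2 > 0"
  shows "gcd3 h k m1 * gcd3 h k m2 \<le> gcd3 h k (m1 * m2)"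
proof -
  let ?g = "gcd h k"
  have c12: "coprime (int m1) (int m2)" using assms by simp
  have "coprime (gcd ?g (int m1)) (gcd ?g (int m2))"
    by (rule coprime_divisors[OF _ _ c12]) simp_all
  moreover have "gcd ?g (int m1) dvd gcd ?g (int (m1 * m2))" "gcd ?g (int m2) dvd gcd ?g (int (m1 * m2))"
    by (intro gcd_mono; simp)+
  ultimately have "gcd ?g (int m1) * gcd ?g (int m2) dvd gcd ?g (int (m1 * m2))"
    by (intro divides_mult)
  moreover have "gcd ?g (int (m1 * m2)) > 0" using assms by (simp add: gcd_pos_int)
  ultimately have "gcd ?g (int m1) * gcd ?g (int m2) \<le> gcd ?g (int (m1 * m2))"
    by (rule zdvd_imp_le)
  thus ?thesis unfolding gcd3_def of_int_mult[symmetric] by (simp only: of_int_le_iff)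
qed

theorem norm_kloo_le:
  assumes "m > 0" "coprime a (int m)"
  shows "norm (kloo m a h k) \<le> 8 ^ card (prime_factors m) * sqrt (real m) * sqrt (gcd3 h k m)"
  using assms
proof (induction m arbitrary: a rule: less_induct)
  case (less m)
  show ?case
  proof (cases "m = 1")
    case True
    have "card (hyperbola 1 a) \<le> 1" by (rule card_hyperbola_le) simp
    hence "norm (kloo 1 a h k) \<le> 1" using norm_kloo_le_card[of 1 a h k] by linarith
    thus ?thesis using True by (simp add: gcd3_def)
  next
    case False
    hence "m > 1" using less.prems by simp
    then obtain p n m' where m: "prime p" "n > 0" "m = p ^ n * m'" "\<not> p dvd m'" "m' > 0" "m' < m"
      by (rule prime_power_split)
    have p0: "p > 0" using m(1) by (simp add: prime_gt_0_nat)
    have cop: "coprime (p ^ n) m'" using prime_imp_coprime[OF m(1,4)] by simp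
    obtain a1 a2 where a12: "coprime a1 (int (p ^ n))" "coprime a2 (int m')"
      "kloo (p ^ n * m') a h k = kloo (p ^ n) a1 h k * kloo m' a2 h k"
      using kloo_mult[of "p ^ n" m' a h k] cop m p0 less.prems(2) by (metis zero_less_power)
    have "coprime a1 (int p)" using a12(1) m(2) by simp
    hence 1: "norm (kloo (p ^ n) a1 h k) \<le> 8 * sqrt (real (p ^ n)) * sqrt (gcd3 h k (p ^ n))"
      by (rule norm_kloo_prime_power[OF m(1)])
    have 2: "norm (kloo m' a2 h k) \<le> 8 ^ card (prime_factors m') * sqrt (real m') * sqrt (gcd3 h k m')"
      by (rule less.IH[OF m(6,5) a12(2)])
    have "prime_factors m = insert p (prime_factors m')"
      using m by (auto simp: prime_factors_product prime_factors_power prime_prime_factors)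
    moreover have "p \<notin> prime_factors m'" using m(4) by auto
    ultimately have card: "card (prime_factors m) = Suc (card (prime_factors m'))" by simp
    have "norm (kloo m a h k) = norm (kloo (p ^ n) a1 h k) * norm (kloo m' a2 h k)"
      unfolding m(3) a12(3) by (rule norm_mult)
    also have "\<dots> \<le> (8 * sqrt (real (p ^ n)) * sqrt (gcd3 h k (p ^ n))) *
       (8 ^ card (prime_factors m') * sqrt (real m') * sqrt (gcd3 h k m'))"
      by (intro mult_mono 1 2) (auto simp: gcd3_def)
    also have "\<dots> = (8 * 8 ^ card (prime_factors m')) * sqrt (real (p ^ n * m')) * sqrt (gcd3 h k (p ^ n) * gcd3 h k m')"
      by (simp add: real_sqrt_mult)
    also have "\<dots> \<le> (8 * 8 ^ card (prime_factors m')) * sqrt (real (p ^ n * m')) * sqrt (gcd3 h k (p ^ n * m'))"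
      using m p0 by (intro mult_left_mono real_sqrt_le_mono gcd3_mult_le cop) auto
    also have "8 * 8 ^ card (prime_factors m') = (8 :: real) ^ card (prime_factors m)" by (simp add: card)
    finally show ?thesis unfolding m(3)[symmetric] .
  qed
qed

section \<open>Divisor functions and harmonic numbers\<close>

text \<open>
  The argument for the divisor bound: for each prime power \<open>p\<^sup>n\<close> the factor \<open>8 (n + 1)\<^sup>2 \<le> 32\<^sup>n\<close> is at most \<open>p\<^sup>n\<^sup>\<delta>\<close> as soon
  as \<open>p \<ge> 32\<^sup>1\<^sup>/\<^sup>\<delta>\<close>, and each of the finitely many smaller primes costs a constant \<open>M\<close>.
\<close>

lemma submultiplicative_bound:
  fixes f :: "nat \<Rightarrow> real"
  assumes f1: "f 1 \<le> 1"
    and step: "\<And>p n m. prime p \<Longrightarrow> n > 0 \<Longrightarrow> m > 0 \<Longrightarrow> \<not> p dvd m \<Longrightarrow> f (p ^ n * m) \<le> 8 * (real n + 1) ^ 2 * f m"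
    and nonneg: "\<And>m. f m \<ge> 0"
    and \<delta>: "\<delta> > 0"
  obtains C where "C > 0" "\<And>m. m > 0 \<Longrightarrow> f m \<le> C * real m powr \<delta>"
proof -
  define g where "g n = 8 * (real n + 1) ^ 2" for n :: nat
  have "(\<lambda>n :: nat. g n / 2 powr (\<delta> * real n)) \<longlonglongrightarrow> 0"
    unfolding g_def using \<delta> by real_asymp
  hence "Bseq (\<lambda>n. g n / 2 powr (\<delta> * real n))"
    by (intro convergent_imp_Bseq convergentI)
  then obtain M' where "\<forall>n. norm (g n / 2 powr (\<delta> * real n)) \<le> M'"
    unfolding Bseq_def by blast
  hence M': "norm (g n / 2 powr (\<delta> * real n)) \<le> M'" for n by blast
  define M where "M = max 1 M'"
  have M: "M \<ge> 1" "g n \<le> M * 2 powr (\<delta> * real n)" for n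
  proof -
    show "M \<ge> 1" by (simp add: M_def)
    have "g n / 2 powr (\<delta> * real n) \<le> \<bar>g n / 2 powr (\<delta> * real n)\<bar>" by (rule abs_ge_self)
    also have "\<dots> \<le> M'" using M'[of n] by (simp only: real_norm_def)
    also have "\<dots> \<le> M" by (simp add: M_def)
    finally have "g n / 2 powr (\<delta> * real n) \<le> M" .
    thus "g n \<le> M * 2 powr (\<delta> * real n)" by (simp add: field_simps)
  qed
  define P0 where "P0 = nat \<lceil>32 powr (1 / \<delta>)\<rceil>"
  have small: "g n \<le> (if p < P0 then M else 1) * real (p ^ n) powr \<delta>" if p: "prime p" and n: "n > 0" for p n
  proof (cases "p < P0")
    case True
    have p2: "p \<ge> 2" using p by (rule prime_ge_2_nat)
    have "2 powr (\<delta> * real n) = (2 ^ n) powr \<delta>"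
      by (simp add: powr_powr[symmetric] powr_realpow mult.commute[of \<delta>])
    also have "\<dots> \<le> real (p ^ n) powr \<delta>"
      using p2 \<delta> by (intro powr_mono2) (auto intro!: power_mono)
    finally have "M * 2 powr (\<delta> * real n) \<le> M * real (p ^ n) powr \<delta>" using M(1)
      by (intro mult_left_mono) auto
    thus ?thesis using M(2)[of n] True by simp
  next
    case False
    have "real (n + 1) \<le> 2 ^ n" using less_exp[of n] by (metis Suc_eq_plus1 Suc_leI numeral_power_eq_of_nat_cancel_iff of_nat_le_iff of_nat_numeral of_nat_power)
    hence "(real n + 1) ^ 2 \<le> (2 ^ n) ^ 2" by (intro power_mono) auto
    hence "g n \<le> 8 * (2 ^ n) ^ 2" by (simp add: g_def)
    also have "\<dots> \<le> 8 ^ n * (2 ^ n) ^ 2"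
      using n self_le_power[of "8 :: real" n] by (intro mult_right_mono) auto
    also have "\<dots> = 32 ^ n" by (simp add: power_mult_distrib[symmetric] power2_eq_square)
    also have "\<dots> = (32 powr (1 / \<delta>)) powr (\<delta> * real n)"
      using \<delta> by (simp add: powr_powr powr_realpow)
    also have "\<dots> \<le> real p powr (\<delta> * real n)"
    proof (rule powr_mono2)
      have "32 powr (1 / \<delta>) \<le> real P0" unfolding P0_def by linarith
      thus "32 powr (1 / \<delta>) \<le> real p" using False by linarith
    qed (use \<delta> in auto)
    also have "\<dots> = real (p ^ n) powr \<delta>"
      using prime_gt_0_nat[OF p] by (simp add: powr_powr[symmetric] powr_realpow mult.commute[of \<delta>])
    finally show ?thesis using False by simp
  qed
  define K where "K m = M ^ card {p \<in> prime_factors m. p < P0}" for m :: nat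
  have K0: "K m \<ge> 1" for m unfolding K_def using M(1) by (rule one_le_power)
  have bound: "f m \<le> K m * real m powr \<delta>" if "m > 0" for m
    using that
  proof (induction m rule: less_induct)
    case (less m)
    show ?case
    proof (cases "m = 1")
      case True
      have "1 * 1 \<le> K m * real m powr \<delta>" using K0[of m] True by (intro mult_mono) auto
      thus ?thesis using True f1 by simp
    next
      case False
      hence "m > 1" using less.prems by simp
      then obtain p n m' where m: "prime p" "n > 0" "m = p ^ n * m'" "\<not> p dvd m'" "m' > 0" "m' < m"
        by (rule prime_power_split)
      have pf: "prime_factors m = insert p (prime_factors m')"
        using m by (auto simp: prime_factors_product prime_factors_power prime_prime_factors)
      have pn: "p \<notin> prime_factors m'" using m(4) by auto
      have K: "K m = (if p < P0 then M else 1) * K m'"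
      proof (cases "p < P0")
        case True
        hence "{q \<in> prime_factors m. q < P0} = insert p {q \<in> prime_factors m'. q < P0}"
          unfolding pf by auto
        thus ?thesis using True pn by (simp add: K_def)
      next
        case False
        hence "{q \<in> prime_factors m. q < P0} = {q \<in> prime_factors m'. q < P0}"
          unfolding pf by auto
        thus ?thesis using False by (simp add: K_def)
      qed
      have "f m \<le> g n * f m'" unfolding m(3) g_def by (rule step[OF m(1,2,5,4)])
      also have "\<dots> \<le> ((if p < P0 then M else 1) * real (p ^ n) powr \<delta>) * (K m' * real m' powr \<delta>)"
        using M(1) nonneg small[OF m(1,2)] less.IH[OF m(6,5)] by (intro mult_mono) auto
      also have "\<dots> = K m * real m powr \<delta>"
        unfolding K by (simp add: m(3) powr_mult)
      finally show ?thesis .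
    qed
  qed
  have "K m \<le> M ^ P0" for m
  proof -
    have "card {p \<in> prime_factors m. p < P0} \<le> card {..<P0}" by (rule card_mono) auto
    thus ?thesis unfolding K_def using M(1) by (intro power_increasing) auto
  qed
  hence "f m \<le> M ^ P0 * real m powr \<delta>" if "m > 0" for m
    using bound[OF that] by (meson mult_right_mono order.trans powr_ge_zero)
  moreover have "M ^ P0 > 0" using M(1) by simp
  ultimately show ?thesis using that by blast
qed

definition num_divisors :: "nat \<Rightarrow> nat" where
  "num_divisors m = card {d. d dvd m}"

lemma num_divisors_prime_power_mult:
  assumes "prime p" "m > 0"
  shows "num_divisors (p ^ n * m) \<le> (n + 1) * num_divisors m"
proof -
  have "{d. d dvd p ^ n * m} \<subseteq> (\<lambda>(i, e). p ^ i * e) ` ({..n} \<times> {e. e dvd m})"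
  proof
    fix d assume "d \<in> {d. d dvd p ^ n * m}"
    then obtain d1 d2 where d: "d = d1 * d2" "d1 dvd p ^ n" "d2 dvd m"
      using division_decomp[of d "p ^ n" m] by auto
    then obtain i where "i \<le> n" "d1 = p ^ i" using divides_primepow_nat[OF assms(1)] by blast
    thus "d \<in> (\<lambda>(i, e). p ^ i * e) ` ({..n} \<times> {e. e dvd m})" using d by auto
  qed
  moreover have fin: "finite {e. e dvd m}" using assms(2) by simp
  ultimately have "num_divisors (p ^ n * m) \<le> card ((\<lambda>(i, e). p ^ i * e) ` ({..n} \<times> {e. e dvd m}))"
    unfolding num_divisors_def by (intro card_mono) auto
  also have "\<dots> \<le> card ({..n} \<times> {e. e dvd m})" using fin by (intro card_image_le) auto
  finally show ?thesis by (simp add: card_cartesian_product num_divisors_def)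
qed

lemma sum_inverse_le: "(\<Sum>h=1..n. 1 / real h) \<le> 1 + ln (real n)" if "n > 0"
  using that
proof (induction n rule: nat_induct_non_zero)
  case (Suc n)
  have "ln (real n / real (Suc n)) \<le> real n / real (Suc n) - 1"
    using Suc.hyps by (intro ln_le_minus_one) auto
  also have "\<dots> = - (1 / real (Suc n))" by (simp add: field_simps)
  finally have "1 / real (Suc n) \<le> ln (real (Suc n)) - ln (real n)"
    using Suc.hyps by (simp add: ln_div)
  thus ?case using Suc.IH by simp
qed simp

definition harmonic :: "nat \<Rightarrow> real" where
  "harmonic n = (\<Sum>h=1..n. 1 / real h)"

lemma harmonic_mono: "m \<le> n \<Longrightarrow> harmonic m \<le> harmonic n"
  unfolding harmonic_def by (rule sum_mono2) auto

lemma harmonic_bound: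
  assumes "\<delta> > 0"
  obtains C where "C > 0" "\<And>m. m > 0 \<Longrightarrow> harmonic m \<le> C * real m powr \<delta>"
proof (rule that)
  fix m :: nat assume m: "m > 0"
  have "ln (real m) \<le> real m powr \<delta> / \<delta>" using m assms by (intro ln_powr_bound) auto
  moreover have "1 \<le> real m powr \<delta>" using m assms by (intro ge_one_powr_ge_zero) auto
  ultimately show "harmonic m \<le> (1 + 1 / \<delta>) * real m powr \<delta>"
    using sum_inverse_le[OF m] by (simp add: harmonic_def algebra_simps)
qed (use assms in \<open>simp add: add_pos_pos\<close>)

text \<open>
  Bound the gcd by the sum of all common divisors \<open>d\<close> and put \<open>h = d j\<close>.
\<close>

lemma sum_gcd_div_le:
  assumes "m > 0"
  shows "(\<Sum>h=1..m. real (gcd h m) / real h) \<le> real (num_divisors m) * harmonic m"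
proof -
  have fin: "finite {d. d dvd m}" using assms by simp
  have "(\<Sum>h=1..m. real (gcd h m) / real h) \<le> (\<Sum>h=1..m. \<Sum>d\<in>{d. d dvd m}. if d dvd h then real d / real h else 0)"
  proof (rule sum_mono)
    fix h
    have "real (gcd h m) / real h = (\<Sum>d\<in>{gcd h m}. if d dvd h then real d / real h else 0)" by simp
    also have "\<dots> \<le> (\<Sum>d\<in>{d. d dvd m}. if d dvd h then real d / real h else 0)"
      using fin by (intro sum_mono2) auto
    finally show "real (gcd h m) / real h \<le> (\<Sum>d\<in>{d. d dvd m}. if d dvd h then real d / real h else 0)" .
  qed
  also have "\<dots> = (\<Sum>d\<in>{d. d dvd m}. \<Sum>h=1..m. if d dvd h then real d / real h else 0)"
    by (rule sum.swap)
  also have "\<dots> \<le> (\<Sum>d\<in>{d. d dvd m}. harmonic m)"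
  proof (rule sum_mono)
    fix d assume "d \<in> {d. d dvd m}"
    hence d: "d dvd m" "d > 0" using assms by (auto intro: dvd_pos_nat)
    have "(\<Sum>h=1..m. if d dvd h then real d / real h else 0) = (\<Sum>h\<in>{h \<in> {1..m}. d dvd h}. real d / real h)"
      by (rule sum.inter_filter[symmetric]) simp
    also have "\<dots> = (\<Sum>j=1..m div d. 1 / real j)"
    proof (rule sum.reindex_bij_witness[of _ "\<lambda>j. d * j" "\<lambda>h. h div d"])
      fix j assume j: "j \<in> {1..m div d}"
      hence "d * j \<le> d * (m div d)" by simp
      thus "d * j \<in> {h \<in> {1..m}. d dvd h}" using j d by auto
    qed (use d in \<open>auto simp: div_le_mono elim!: dvdE\<close>)
    also have "\<dots> \<le> harmonic m" unfolding harmonic_def[symmetric] by (rule harmonic_mono) simp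
    finally show "(\<Sum>h=1..m. if d dvd h then real d / real h else 0) \<le> harmonic m" .
  qed
  finally show ?thesis by (simp add: num_divisors_def)
qed

section \<open>Completion\<close>

lemma sin_ge_third:
  fixes x :: real
  assumes "0 \<le> x" "x \<le> pi / 2"
  shows "sin x \<ge> x / 3"
proof -
  have "\<bar>sin x - (\<Sum>m<3. sin_coeff m * x ^ m)\<bar> \<le> inverse (fact 3) * \<bar>x\<bar> ^ 3"
    by (rule Maclaurin_sin_bound)
  moreover have "(\<Sum>m<3. sin_coeff m * x ^ m) = x" by (simp add: sin_coeff_def numeral_3_eq_3)
  moreover have "inverse (fact 3) * \<bar>x\<bar> ^ 3 = x * x ^ 2 / 6"
    using assms(1) by (simp add: fact_numeral power2_eq_square power3_eq_cube)
  ultimately have "\<bar>sin x - x\<bar> \<le> x * x ^ 2 / 6" by simp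
  moreover have "x ^ 2 \<le> 2 ^ 2" using assms pi_less_4 by (intro power_mono) auto
  hence "x * x ^ 2 \<le> x * 2 ^ 2" using assms by (intro mult_left_mono)
  hence "x * x ^ 2 \<le> 4 * x" by simp
  ultimately show ?thesis by linarith
qed

lemma norm_1_minus_ee: "norm (1 - ee x) = 2 * \<bar>sin (pi * x)\<bar>"
proof -
  have "norm (1 - ee x) ^ 2 = (1 - cos (2 * (pi * x))) ^ 2 + sin (2 * (pi * x)) ^ 2"
    by (simp add: ee_def cmod_power2 mult.assoc)
  also have "\<dots> = 2 - 2 * cos (2 * (pi * x))"
    using sin_cos_squared_add[of "2 * (pi * x)"] by (simp add: power2_eq_square algebra_simps)
  also have "\<dots> = (2 * \<bar>sin (pi * x)\<bar>) ^ 2" by (simp add: cos_double_sin power_mult_distrib)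
  finally show ?thesis by (rule power2_eq_imp_eq) simp_all
qed

lemma norm_1_minus_ee_ge:
  assumes "0 < h" "h < m"
  shows "norm (1 - ee (- (real h / real m))) \<ge> real (min h (m - h)) / real m"
proof -
  define j where "j = min h (m - h)"
  have j: "2 * j \<le> m" using assms by (auto simp: j_def)
  have m: "real m > 0" using assms by simp
  have "sin (pi * (real h / real m)) = sin (pi * (real j / real m))"
  proof (cases "h \<le> m - h")
    case False
    hence "real j = real m - real h" using assms by (simp add: j_def of_nat_diff)
    hence "real j / real m = 1 - real h / real m" using m by (simp add: diff_divide_distrib)
    hence "pi * (real j / real m) = pi - pi * (real h / real m)" by (simp add: right_diff_distrib)
    thus ?thesis by simp
  qed (simp add: j_def)
  moreover have "sin (pi * (real j / real m)) \<ge> pi * (real j / real m) / 3"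
  proof (rule sin_ge_third)
    have "real j / real m \<le> 1 / 2" using j m by (simp add: field_simps)
    hence "pi * (real j / real m) \<le> pi * (1 / 2)" by (intro mult_left_mono) auto
    thus "pi * (real j / real m) \<le> pi / 2" by simp
  qed simp
  moreover have "2 * (real j / real m) \<le> pi * (real j / real m)"
    using pi_ge_two m by (intro mult_right_mono) auto
  moreover have "real j / real m \<ge> 0" by simp
  moreover have "P / 3 \<le> s \<Longrightarrow> 2 * \<theta> \<le> P \<Longrightarrow> 0 \<le> \<theta> \<Longrightarrow> \<theta> \<le> 2 * \<bar>s\<bar>" for P s \<theta> :: real
    by linarith
  ultimately have "2 * \<bar>sin (pi * (real h / real m))\<bar> \<ge> real j / real m" by metis
  moreover have "norm (1 - ee (- (real h / real m))) = 2 * \<bar>sin (pi * (real h / real m))\<bar>"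
    unfolding norm_1_minus_ee by simp
  ultimately show ?thesis by (simp add: j_def)
qed

definition interval_sum :: "nat \<Rightarrow> int \<Rightarrow> int \<Rightarrow> int \<Rightarrow> complex" where
  "interval_sum m U X h = (\<Sum>u\<in>{U + 1..U + X}. ee (of_int (- h * u) / real m))"

lemma norm_interval_sum_le_card:
  "X \<ge> 0 \<Longrightarrow> norm (interval_sum m U X h) \<le> of_int X"
  unfolding interval_sum_def by (rule order.trans[OF norm_sum]) simp

text \<open>
  A geometric series with ratio \<open>z = e(- h / m)\<close>, bounded by \<open>2 / norm (1 - z)\<close>.
\<close>

lemma norm_interval_sum_le:
  assumes "0 < h" "h < m"
  shows "norm (interval_sum m U X (int h)) \<le> 2 * (real m / real h + real m / real (m - h))"
proof -
  define z where "z = ee (- (real h / real m))"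
  have m: "real m > 0" using assms by simp
  have j: "real (min h (m - h)) > 0" using assms by simp
  have z1: "norm (1 - z) \<ge> real (min h (m - h)) / real m"
    unfolding z_def by (rule norm_1_minus_ee_ge[OF assms])
  have pos: "real (min h (m - h)) / real m > 0" using j m by simp
  have z0: "norm (1 - z) > 0" using z1 pos by linarith
  have zn: "ee (of_int (- int h * (U + 1 + int n)) / real m) = ee (of_int (- int h * (U + 1)) / real m) * z ^ n" for n
  proof (induction n)
    case (Suc n)
    have "of_int (- int h * (U + 1 + int (Suc n))) / real m =
        of_int (- int h * (U + 1 + int n)) / real m + - (real h / real m)"
      using m by (simp add: field_simps)
    thus ?case by (simp only: ee_add Suc z_def[symmetric] power_Suc2 mult.assoc)
  qed simp
  have "interval_sum m U X (int h) = (\<Sum>n<nat X. ee (of_int (- int h * (U + 1 + int n)) / real m))"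
    unfolding interval_sum_def
    by (rule sum.reindex_bij_witness[of _ "\<lambda>n. U + 1 + int n" "\<lambda>u. nat (u - U - 1)"]) auto
  also have "\<dots> = ee (of_int (- int h * (U + 1)) / real m) * (\<Sum>n<nat X. z ^ n)"
    by (simp only: zn sum_distrib_left)
  finally have "norm (interval_sum m U X (int h)) = norm (\<Sum>n<nat X. z ^ n)"
    by (simp only: norm_mult norm_ee mult_1_left)
  hence "norm (interval_sum m U X (int h)) * norm (1 - z) = norm ((1 - z) * (\<Sum>n<nat X. z ^ n))"
    by (simp add: norm_mult)
  also have "(1 - z) * (\<Sum>n<nat X. z ^ n) = 1 - z ^ nat X" by (rule one_diff_power_eq[symmetric])
  also have "norm (1 - z ^ nat X) \<le> norm (1 :: complex) + norm (z ^ nat X)" by (rule norm_triangle_ineq4)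
  also have "\<dots> = 2" by (simp add: norm_power z_def)
  finally have "norm (interval_sum m U X (int h)) \<le> 2 / norm (1 - z)" using z0 by (simp add: field_simps)
  also have "\<dots> \<le> 2 / (real (min h (m - h)) / real m)"
    by (rule divide_left_mono[OF z1]) (use z0 pos in \<open>simp_all only: mult_pos_pos zero_le_numeral\<close>)
  also have "\<dots> = 2 * (real m / real (min h (m - h)))" by simp
  also have "\<dots> \<le> 2 * (real m / real h + real m / real (m - h))" by (cases "h \<le> m - h") (simp_all add: min_def)
  finally show ?thesis .
qed

lemma sum_interval_gcd_le:
  assumes "m > 0"
  shows "(\<Sum>h\<in>{1..<int m}. norm (interval_sum m U X h) * of_int (gcd h (int m))) \<le>
    4 * real m * (real (num_divisors m) * harmonic m)"
proof -
  have "(\<Sum>h\<in>{1..<int m}. norm (interval_sum m U X h) * of_int (gcd h (int m))) =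
    (\<Sum>h\<in>{1..<m}. norm (interval_sum m U X (int h)) * real (gcd h m))"
    by (rule sum.reindex_bij_witness[of _ int nat]) (auto simp: gcd_int_def)
  also have "\<dots> \<le> (\<Sum>h\<in>{1..<m}. (2 * (real m / real h + real m / real (m - h))) * real (gcd h m))"
    using norm_interval_sum_le by (intro sum_mono mult_right_mono) auto
  also have "\<dots> = 2 * real m * (\<Sum>h\<in>{1..<m}. real (gcd h m) / real h) + 2 * real m * (\<Sum>h\<in>{1..<m}. real (gcd h m) / real (m - h))"
    by (simp add: distrib_right distrib_left sum.distrib sum_distrib_left mult.assoc)
  also have "(\<Sum>h\<in>{1..<m}. real (gcd h m) / real (m - h)) = (\<Sum>h\<in>{1..<m}. real (gcd h m) / real h)"
    by (rule sum.reindex_bij_witness[of _ "\<lambda>h. m - h" "\<lambda>h. m - h"]) (auto simp: gcd_diff2_nat)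
  also have "2 * real m * (\<Sum>h\<in>{1..<m}. real (gcd h m) / real h) + 2 * real m * (\<Sum>h\<in>{1..<m}. real (gcd h m) / real h) =
      4 * real m * (\<Sum>h\<in>{1..<m}. real (gcd h m) / real h)" by simp
  also have "(\<Sum>h\<in>{1..<m}. real (gcd h m) / real h) \<le> (\<Sum>h=1..m. real (gcd h m) / real h)"
    by (rule sum_mono2) auto
  also have "\<dots> \<le> real (num_divisors m) * harmonic m" by (rule sum_gcd_div_le[OF assms])
  finally show ?thesis by (simp add: mult_left_mono)
qed

definition box_points :: "nat \<Rightarrow> int \<Rightarrow> int \<Rightarrow> int \<Rightarrow> int \<Rightarrow> int \<Rightarrow> (int \<times> int) set" where
  "box_points m a X Y U V = {(x, y). x \<in> {U + 1..U + X} \<and> y \<in> {V + 1..V + Y} \<and> [x * y = a] (mod int m)}"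

lemma box_points_fourier:
  assumes m: "m > 0"
  shows "of_nat (m ^ 2 * card (box_points m a X Y U V)) =
    (\<Sum>h\<in>{0..<int m}. \<Sum>k\<in>{0..<int m}. interval_sum m U X h * interval_sum m V Y k * kloo m a h k)"
proof -
  let ?I = "{0..<int m}" and ?X = "{U + 1..U + X}" and ?Y = "{V + 1..V + Y}" and ?H = "hyperbola m a"
  define E where "E t = ee (of_int t / real m)" for t
  have E_add: "E (s + t) = E s * E t" for s t by (simp add: E_def add_divide_distrib ee_add)
  have E_sum: "(\<Sum>h\<in>?I. E (w * h)) = (if int m dvd w then of_nat m else 0)" for w
    unfolding E_def by (rule sum_ee[OF m])
  have "(\<Sum>h\<in>?I. \<Sum>k\<in>?I. interval_sum m U X h * interval_sum m V Y k * kloo m a h k) =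
    (\<Sum>h\<in>?I. \<Sum>k\<in>?I. \<Sum>u\<in>?X. \<Sum>v\<in>?Y. \<Sum>z\<in>?H. E ((fst z - u) * h) * E ((snd z - v) * k))"
  proof (intro sum.cong refl)
    fix h k
    have "interval_sum m U X h * interval_sum m V Y k * kloo m a h k =
      (\<Sum>u\<in>?X. \<Sum>v\<in>?Y. \<Sum>z\<in>?H. E (- h * u) * E (- k * v) * E (h * fst z + k * snd z))"
    proof -
      have I: "interval_sum m U X h * interval_sum m V Y k = (\<Sum>u\<in>?X. \<Sum>v\<in>?Y. E (- h * u) * E (- k * v))"
        unfolding interval_sum_def E_def sum_product by (rule refl)
      have K: "kloo m a h k = (\<Sum>z\<in>?H. E (h * fst z + k * snd z))"
        unfolding kloo_def E_def case_prod_unfold by (rule refl)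
      show ?thesis unfolding I sum_distrib_right by (simp only: K sum_distrib_left)
    qed
    also have "\<dots> = (\<Sum>u\<in>?X. \<Sum>v\<in>?Y. \<Sum>z\<in>?H. E ((fst z - u) * h) * E ((snd z - v) * k))"
      by (intro sum.cong refl) (simp add: algebra_simps flip: E_add)
    finally show "interval_sum m U X h * interval_sum m V Y k * kloo m a h k = \<dots>" .
  qed
  also have "\<dots> = (\<Sum>u\<in>?X. \<Sum>v\<in>?Y. \<Sum>z\<in>?H. \<Sum>h\<in>?I. \<Sum>k\<in>?I. E ((fst z - u) * h) * E ((snd z - v) * k))"
  proof -
    have "(\<Sum>h\<in>?I. \<Sum>k\<in>?I. \<Sum>u\<in>?X. \<Sum>v\<in>?Y. \<Sum>z\<in>?H. F h k u v z) =
      (\<Sum>u\<in>?X. \<Sum>v\<in>?Y. \<Sum>z\<in>?H. \<Sum>h\<in>?I. \<Sum>k\<in>?I. F h k u v z)" for F :: "int \<Rightarrow> int \<Rightarrow> int \<Rightarrow> int \<Rightarrow> int \<times> int \<Rightarrow> complex"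
    proof -
      have L1: "(\<Sum>h\<in>?I. \<Sum>k\<in>?I. g h k) = (\<Sum>q\<in>?I \<times> ?I. g (fst q) (snd q))" for g :: "int \<Rightarrow> int \<Rightarrow> complex"
        by (simp add: sum.cartesian_product case_prod_unfold)
      have L2: "(\<Sum>u\<in>?X. \<Sum>v\<in>?Y. \<Sum>z\<in>?H. g u v z) =
        (\<Sum>w\<in>?X \<times> ?Y \<times> ?H. g (fst w) (fst (snd w)) (snd (snd w)))" for g :: "int \<Rightarrow> int \<Rightarrow> int \<times> int \<Rightarrow> complex"
        by (simp add: sum.cartesian_product case_prod_unfold)
      show ?thesis unfolding L1 L2 by (rule sum.swap)
    qed
    thus ?thesis .
  qed
  also have "\<dots> = (\<Sum>u\<in>?X. \<Sum>v\<in>?Y. if [u * v = a] (mod int m) then of_nat (m ^ 2) else 0)"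
  proof (intro sum.cong refl)
    fix u v
    have "(\<Sum>z\<in>?H. \<Sum>h\<in>?I. \<Sum>k\<in>?I. E ((fst z - u) * h) * E ((snd z - v) * k)) =
      (\<Sum>z\<in>?H. (if int m dvd fst z - u then of_nat m else 0) * (if int m dvd snd z - v then of_nat m else 0))"
      unfolding E_sum[symmetric] sum_product by (rule refl)
    also have "\<dots> = (\<Sum>z\<in>?H. if z = (u mod int m, v mod int m) then of_nat (m ^ 2) else 0)"
    proof (intro sum.cong refl)
      fix z assume z: "z \<in> ?H"
      obtain x y where xy: "z = (x, y)" by (cases z)
      have "int m dvd x - u \<longleftrightarrow> x = u mod int m" "int m dvd y - v \<longleftrightarrow> y = v mod int m"
        using z by (auto simp: xy hyperbola_def mod_eq_dvd_iff[symmetric])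
      thus "(if int m dvd fst z - u then of_nat m else 0) * (if int m dvd snd z - v then of_nat m else 0) =
        (if z = (u mod int m, v mod int m) then of_nat (m ^ 2) else (0 :: complex))"
        by (simp add: xy power2_eq_square)
    qed
    also have "\<dots> = (if (u mod int m, v mod int m) \<in> ?H then of_nat (m ^ 2) else 0)"
      by (simp add: sum.delta)
    also have "(u mod int m, v mod int m) \<in> ?H \<longleftrightarrow> [u * v = a] (mod int m)"
    proof -
      have "[(u mod int m) * (v mod int m) = a] (mod int m) \<longleftrightarrow> [u * v = a] (mod int m)"
        unfolding Cong.cong_def mod_mult_eq by (rule refl)
      thus ?thesis using m by (simp add: hyperbola_def)
    qed
    finally show "(\<Sum>z\<in>?H. \<Sum>h\<in>?I. \<Sum>k\<in>?I. E ((fst z - u) * h) * E ((snd z - v) * k)) =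
      (if [u * v = a] (mod int m) then of_nat (m ^ 2) else 0)" .
  qed
  also have "\<dots> = (\<Sum>z\<in>?X \<times> ?Y. if [fst z * snd z = a] (mod int m) then of_nat (m ^ 2) else 0)"
    by (simp add: sum.cartesian_product case_prod_unfold)
  also have "\<dots> = (\<Sum>z\<in>{z \<in> ?X \<times> ?Y. [fst z * snd z = a] (mod int m)}. of_nat (m ^ 2))"
    by (rule sum.inter_filter[symmetric]) simp
  also have "{z \<in> ?X \<times> ?Y. [fst z * snd z = a] (mod int m)} = box_points m a X Y U V"
    by (auto simp: box_points_def)
  finally show ?thesis by (simp add: mult.commute)
qed

lemma card_hyperbola_totient:
  assumes m: "m > 1" and a: "coprime a (int m)"
  shows "card (hyperbola m a) = totient m"
proof -
  have "fst ` hyperbola m a = int ` totatives m"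
  proof (intro Set.set_eqI iffI)
    fix x assume "x \<in> fst ` hyperbola m a"
    then obtain y where xy: "(x, y) \<in> hyperbola m a" by auto
    hence x: "0 \<le> x" "x < int m" "coprime x (int m)"
      using hyperbola_coprime[OF xy a] by (auto simp: hyperbola_def)
    have "x \<noteq> 0" using x(3) m by auto
    hence "nat x \<in> totatives m" using x by (auto simp: totatives_def simp flip: coprime_int_iff)
    thus "x \<in> int ` totatives m" using x by (intro image_eqI[of _ _ "nat x"]) auto
  next
    fix x assume "x \<in> int ` totatives m"
    then obtain n where n: "x = int n" "0 < n" "n \<le> m" "coprime n m" by (auto simp: totatives_def)
    hence "n \<noteq> m" using m by auto
    hence "x \<in> {0..<int m}" "coprime x (int m)" using n by auto
    then obtain y where "(x, y) \<in> hyperbola m a" using hyperbola_ex m by (metis gr_implies_not0 neq0_conv)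
    thus "x \<in> fst ` hyperbola m a" by force
  qed
  hence "card (fst ` hyperbola m a) = totient m"
    by (simp add: totient_def card_image)
  thus ?thesis using card_image[OF inj_on_fst_hyperbola[OF a]] by simp
qed

text \<open>
  For \<open>h \<noteq> 0\<close> the square root of the gcd is replaced by \<open>gcd(h, m)\<close>, and for \<open>h = 0\<close> by \<open>gcd(k, m)\<close>; then the
  sum over the frequencies factorizes.
\<close>

lemma box_points_error:
  assumes m: "m > 1" and a: "coprime a (int m)"
    and X: "1 \<le> X" "X < int m" and Y: "1 \<le> Y" "Y < int m"
  shows "\<bar>real (card (box_points m a X Y U V)) - real (totient m) / (real m)\<^sup>2 * of_int X * of_int Y\<bar> \<le>
    24 * sqrt (real m) * (8 ^ card (prime_factors m) * real (num_divisors m) ^ 2) * harmonic m ^ 2"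
proof -
  let ?I = "{0..<int m}" and ?I' = "{1..<int m}"
  have m0: "m > 0" using m by simp
  define N where "N = card (box_points m a X Y U V)"
  define D where "D = 8 ^ card (prime_factors m) * sqrt (real m)"
  define t where "t = real (num_divisors m) * harmonic m"
  define B where "B = 4 * real m * t"
  define A where "A h = norm (interval_sum m U X h)" for h
  define A' where "A' k = norm (interval_sum m V Y k)" for k
  define T where "T h k = interval_sum m U X h * interval_sum m V Y k * kloo m a h k" for h k
  have D0: "D \<ge> 0" by (simp add: D_def)
  have A0: "A h \<ge> 0" "A' h \<ge> 0" for h by (simp_all add: A_def A'_def)
  have t1: "t \<ge> 1"
  proof -
    have "card {1 :: nat} \<le> num_divisors m" unfolding num_divisors_def using m0 by (intro card_mono) auto
    hence "num_divisors m \<ge> 1" by simp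
    moreover have "harmonic 1 \<le> harmonic m" using m0 by (intro harmonic_mono) auto
    hence "harmonic m \<ge> 1" by (simp add: harmonic_def)
    ultimately have "1 * 1 \<le> real (num_divisors m) * harmonic m" by (intro mult_mono) auto
    thus ?thesis by (simp add: t_def)
  qed
  have B0: "B \<ge> 0" using t1 by (simp add: B_def)
  have AB: "(\<Sum>h\<in>?I'. A h * of_int (gcd h (int m))) \<le> B" "(\<Sum>k\<in>?I'. A' k * of_int (gcd k (int m))) \<le> B"
    unfolding A_def A'_def B_def t_def by (rule sum_interval_gcd_le[OF m0])+
  have Am: "A h \<le> real m" "A' h \<le> real m" for h
    using norm_interval_sum_le_card[of X m U h] norm_interval_sum_le_card[of Y m V h] X Y
    unfolding A_def A'_def by linarith+
  have I: "?I = insert 0 ?I'" using m by auto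
  have AI: "(\<Sum>k\<in>?I. A' k) \<le> real m + B"
  proof -
    have "(\<Sum>k\<in>?I'. A' k * 1) \<le> (\<Sum>k\<in>?I'. A' k * of_int (gcd k (int m)))"
    proof (intro sum_mono mult_left_mono)
      fix k assume "k \<in> ?I'"
      hence "gcd k (int m) > 0" by (simp add: gcd_pos_int)
      thus "1 \<le> real_of_int (gcd k (int m))" by linarith
    qed (use A0 in auto)
    thus ?thesis unfolding I using AB(2) Am(2)[of 0] by simp
  qed
  have sg: "sqrt (gcd3 h k m) \<le> of_int (gcd h (int m))" "sqrt (gcd3 h k m) \<le> of_int (gcd k (int m))" for h k
  proof -
    have s: "sqrt (gcd3 h k m) \<le> gcd3 h k m"
    proof -
      have "gcd3 h k m * 1 \<le> gcd3 h k m * gcd3 h k m"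
        using gcd3_ge_1[OF m0, of h k] by (intro mult_left_mono) auto
      thus ?thesis using gcd3_ge_1[OF m0, of h k] by (intro real_le_lsqrt) (auto simp: power2_eq_square)
    qed
    have "gcd (gcd h k) (int m) dvd gcd h (int m)" "gcd (gcd h k) (int m) dvd gcd k (int m)"
      by (intro gcd_mono; simp)+
    hence "gcd (gcd h k) (int m) \<le> gcd h (int m)" "gcd (gcd h k) (int m) \<le> gcd k (int m)"
      using m0 by (auto intro!: zdvd_imp_le simp: gcd_pos_int)
    hence "gcd3 h k m \<le> of_int (gcd h (int m))" "gcd3 h k m \<le> of_int (gcd k (int m))"
      unfolding gcd3_def by (simp_all only: of_int_le_iff)
    thus "sqrt (gcd3 h k m) \<le> of_int (gcd h (int m))" "sqrt (gcd3 h k m) \<le> of_int (gcd k (int m))"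
      using s by linarith+
  qed
  have nT: "norm (T h k) \<le> D * (A h * A' k * sqrt (gcd3 h k m))" for h k
  proof -
    have "norm (T h k) = A h * A' k * norm (kloo m a h k)" by (simp add: T_def A_def A'_def norm_mult)
    also have "\<dots> \<le> A h * A' k * (8 ^ card (prime_factors m) * sqrt (real m) * sqrt (gcd3 h k m))"
      using A0 by (intro mult_left_mono norm_kloo_le m0 a) auto
    finally show ?thesis by (simp add: D_def mult_ac)
  qed
  have "of_nat (m ^ 2 * N) = (\<Sum>h\<in>?I. \<Sum>k\<in>?I. T h k)"
    unfolding N_def T_def by (rule box_points_fourier[OF m0])
  also have "\<dots> = T 0 0 + (\<Sum>k\<in>?I'. T 0 k) + (\<Sum>h\<in>?I'. \<Sum>k\<in>?I. T h k)"
    by (subst I) (simp, simp add: I)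
  finally have "of_nat (m ^ 2 * N) - T 0 0 = (\<Sum>k\<in>?I'. T 0 k) + (\<Sum>h\<in>?I'. \<Sum>k\<in>?I. T h k)"
    by simp
  moreover have "T 0 0 = of_real (of_int X * of_int Y * real (totient m))"
    using card_hyperbola_totient[OF m a] X Y
    by (simp add: T_def interval_sum_def kloo_def case_prod_unfold)
  ultimately have "of_real (real (m ^ 2 * N) - of_int X * of_int Y * real (totient m)) =
      (\<Sum>k\<in>?I'. T 0 k) + (\<Sum>h\<in>?I'. \<Sum>k\<in>?I. T h k)" by simp
  hence "\<bar>real (m ^ 2 * N) - of_int X * of_int Y * real (totient m)\<bar> =
      norm ((\<Sum>k\<in>?I'. T 0 k) + (\<Sum>h\<in>?I'. \<Sum>k\<in>?I. T h k))"
    by (metis norm_of_real)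
  also have "\<dots> \<le> (\<Sum>k\<in>?I'. norm (T 0 k)) + (\<Sum>h\<in>?I'. \<Sum>k\<in>?I. norm (T h k))"
    by (intro order.trans[OF norm_triangle_ineq] add_mono norm_sum order.trans[OF norm_sum] sum_mono)
  also have "(\<Sum>k\<in>?I'. norm (T 0 k)) \<le> (\<Sum>k\<in>?I'. (D * real m) * (A' k * of_int (gcd k (int m))))"
  proof (rule sum_mono)
    fix k
    have "norm (T 0 k) \<le> D * (A 0 * A' k * sqrt (gcd3 0 k m))" by (rule nT)
    also have "\<dots> \<le> D * (real m * A' k * of_int (gcd k (int m)))"
      using D0 A0 Am sg(2)[of 0 k] by (intro mult_left_mono mult_mono) (auto simp: gcd3_def)
    finally show "norm (T 0 k) \<le> (D * real m) * (A' k * of_int (gcd k (int m)))" by (simp add: mult_ac)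
  qed
  also have "\<dots> = (D * real m) * (\<Sum>k\<in>?I'. A' k * of_int (gcd k (int m)))" by (simp add: sum_distrib_left)
  also have "\<dots> \<le> (D * real m) * B" using D0 AB by (intro mult_left_mono) auto
  also have "(\<Sum>h\<in>?I'. \<Sum>k\<in>?I. norm (T h k)) \<le> (\<Sum>h\<in>?I'. \<Sum>k\<in>?I. D * ((A h * of_int (gcd h (int m))) * A' k))"
  proof (intro sum_mono)
    fix h k
    have "norm (T h k) \<le> D * (A h * A' k * sqrt (gcd3 h k m))" by (rule nT)
    also have "\<dots> \<le> D * (A h * A' k * of_int (gcd h (int m)))"
      using D0 A0 sg(1)[of h k] by (intro mult_left_mono) auto
    finally show "norm (T h k) \<le> D * ((A h * of_int (gcd h (int m))) * A' k)" by (simp add: mult_ac)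
  qed
  also have "\<dots> = D * ((\<Sum>h\<in>?I'. A h * of_int (gcd h (int m))) * (\<Sum>k\<in>?I. A' k))"
    by (simp only: sum_product) (simp only: sum_distrib_left)
  also have "\<dots> \<le> D * (B * (real m + B))"
    using D0 A0 B0 AB AI by (intro mult_left_mono mult_mono) (auto intro!: sum_nonneg)
  finally have main: "\<bar>real (m ^ 2 * N) - of_int X * of_int Y * real (totient m)\<bar> \<le> D * real m * B + D * (B * (real m + B))"
    by simp
  have "D * real m * B + D * (B * (real m + B)) = D * real m ^ 2 * (8 * t + 16 * t ^ 2)"
    by (simp add: B_def power2_eq_square algebra_simps)
  also have "\<dots> \<le> D * real m ^ 2 * (24 * t ^ 2)"
  proof -
    have "t * 1 \<le> t * t" using t1 by (intro mult_left_mono) auto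
    hence "8 * t + 16 * t ^ 2 \<le> 24 * t ^ 2" by (simp add: power2_eq_square)
    thus ?thesis using D0 by (intro mult_left_mono) auto
  qed
  finally have main': "\<bar>real (m ^ 2 * N) - of_int X * of_int Y * real (totient m)\<bar> \<le> D * real m ^ 2 * (24 * t ^ 2)"
    using main by linarith
  have "real N - real (totient m) / (real m)\<^sup>2 * of_int X * of_int Y =
      (real (m ^ 2 * N) - of_int X * of_int Y * real (totient m)) / real m ^ 2"
    using m0 by (simp add: field_simps)
  hence "\<bar>real N - real (totient m) / (real m)\<^sup>2 * of_int X * of_int Y\<bar> =
      \<bar>real (m ^ 2 * N) - of_int X * of_int Y * real (totient m)\<bar> / real m ^ 2"
    by simp
  also have "\<dots> \<le> (D * real m ^ 2 * (24 * t ^ 2)) / real m ^ 2"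
    using main' by (rule divide_right_mono) simp
  also have "\<dots> = 24 * sqrt (real m) * (8 ^ card (prime_factors m) * real (num_divisors m) ^ 2) * harmonic m ^ 2"
    using m0 by (simp add: D_def t_def power_mult_distrib)
  finally show ?thesis by (simp only: N_def)
qed

section \<open>The asymptotic formula\<close>

theorem mainTheorem1:
  fixes \<epsilon> :: real
  assumes "\<epsilon> > 0"
  shows "\<exists>C::real. C > 0 \<and>
    (\<forall>(m::nat) (a::int) (X::int) (Y::int) (U::int) (V::int).
      m > 0 \<longrightarrow> gcd a (int m) = 1 \<longrightarrow>
      1 \<le> X \<longrightarrow> X < int m \<longrightarrow> 1 \<le> Y \<longrightarrow> Y < int m \<longrightarrow> U \<ge> 0 \<longrightarrow> V \<ge> 0 \<longrightarrow>
      \<bar>real (card {(x, y). x \<in> {U + 1..U + X} \<and> y \<in> {V + 1..V + Y} \<and> [x * y = a] (mod int m)})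
        - real (totient m) / (real m)\<^sup>2 * real_of_int X * real_of_int Y\<bar>
      \<le> C * real m powr (1 / 2 + \<epsilon>))"
proof -
  define f where "f m = 8 ^ card (prime_factors m) * real (num_divisors m) ^ 2" for m
  have "\<exists>C1. C1 > 0 \<and> (\<forall>m>0. f m \<le> C1 * real m powr (\<epsilon> / 2))"
  proof (rule submultiplicative_bound[of f "\<epsilon> / 2"])
    show "f 1 \<le> 1" by (simp add: f_def num_divisors_def)
    show "f m \<ge> 0" for m by (simp add: f_def)
    show "\<epsilon> / 2 > 0" using assms by simp
  next
    fix p n m :: nat assume p: "prime p" "n > 0" "m > 0" "\<not> p dvd m"
    have "prime_factors (p ^ n * m) = insert p (prime_factors m)"
      using p by (auto simp: prime_factors_product prime_factors_power prime_prime_factors prime_gt_0_nat)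
    moreover have "p \<notin> prime_factors m" using p(4) by auto
    ultimately have c: "card (prime_factors (p ^ n * m)) = Suc (card (prime_factors m))" by simp
    have "real (num_divisors (p ^ n * m)) \<le> real ((n + 1) * num_divisors m)"
      using num_divisors_prime_power_mult[OF p(1,3)] by (simp only: of_nat_le_iff)
    hence "real (num_divisors (p ^ n * m)) ^ 2 \<le> ((real n + 1) * real (num_divisors m)) ^ 2"
      by (intro power_mono) (auto simp: algebra_simps)
    thus "f (p ^ n * m) \<le> 8 * (real n + 1) ^ 2 * f m"
      unfolding f_def c by (simp add: power_mult_distrib)
  next
    fix C assume "C > 0" "\<And>m. m > 0 \<Longrightarrow> f m \<le> C * real m powr (\<epsilon> / 2)"
    thus "\<exists>C1. C1 > 0 \<and> (\<forall>m>0. f m \<le> C1 * real m powr (\<epsilon> / 2))" by blast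
  qed
  then obtain C1 where C1: "C1 > 0" "\<And>m. m > 0 \<Longrightarrow> f m \<le> C1 * real m powr (\<epsilon> / 2)" by blast
  obtain C2 where C2: "C2 > 0" "\<And>m. m > 0 \<Longrightarrow> harmonic m \<le> C2 * real m powr (\<epsilon> / 4)"
    using harmonic_bound[of "\<epsilon> / 4"] assms by auto
  have "24 * C1 * C2 ^ 2 > 0" using C1 C2 by simp
  moreover have "\<bar>real (card {(x, y). x \<in> {U + 1..U + X} \<and> y \<in> {V + 1..V + Y} \<and> [x * y = a] (mod int m)})
        - real (totient m) / (real m)\<^sup>2 * real_of_int X * real_of_int Y\<bar>
      \<le> 24 * C1 * C2 ^ 2 * real m powr (1 / 2 + \<epsilon>)"
    if *: "gcd a (int m) = 1" "1 \<le> X" "X < int m" "1 \<le> Y" "Y < int m" for m a X Y U V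
  proof -
    have m: "m > 1" using * by linarith
    have cop: "coprime a (int m)" using *(1) by (rule gcd_eq_1_imp_coprime)
    have H0: "harmonic m \<ge> 0" by (simp add: harmonic_def sum_nonneg)
    have "harmonic m ^ 2 \<le> (C2 * real m powr (\<epsilon> / 4)) ^ 2"
      using C2(2)[of m] m H0 by (intro power_mono) auto
    also have "\<dots> = C2 ^ 2 * real m powr (\<epsilon> / 2)"
      by (simp add: power_mult_distrib power2_eq_square flip: powr_add)
    finally have H: "harmonic m ^ 2 \<le> C2 ^ 2 * real m powr (\<epsilon> / 2)" .
    have "\<bar>real (card (box_points m a X Y U V)) - real (totient m) / (real m)\<^sup>2 * of_int X * of_int Y\<bar> \<le>
      24 * sqrt (real m) * f m * harmonic m ^ 2"
      unfolding f_def by (rule box_points_error[OF m cop *(2-5)])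
    also have "\<dots> \<le> 24 * sqrt (real m) * (C1 * real m powr (\<epsilon> / 2)) * (C2 ^ 2 * real m powr (\<epsilon> / 2))"
      using H C1 C1(2)[of m] m by (intro mult_mono mult_left_mono) auto
    also have "\<dots> = 24 * C1 * C2 ^ 2 * (real m powr (1 / 2) * (real m powr (\<epsilon> / 2) * real m powr (\<epsilon> / 2)))"
      using m by (simp add: powr_half_sqrt)
    also have "real m powr (1 / 2) * (real m powr (\<epsilon> / 2) * real m powr (\<epsilon> / 2)) = real m powr (1 / 2 + \<epsilon>)"
      by (simp flip: powr_add)
    finally show ?thesis unfolding box_points_def .
  qed
  ultimately show ?thesis
    by (intro exI[of _ "24 * C1 * C2 ^ 2"] conjI allI impI)
qed

end
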